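(* Every bounded linear operator from $Z_3$ into a twisted Hilbert space is strictly singular. In particular, $Z_3$ does not contain complemented copies of either $Z_2$ or $\ell_2$.
   Context: All spaces are complex. For the couple $(X_0,X_1)=(\ell_\infty,\ell_1)$ put $\Sigma=\ell_\infty+\ell_1$. The Calderón space $\mathcal C$ of the couple is the Banach space of bounded continuous functions $F:\{z\in\mathbb C:0\le \mathrm{Re}\,z\le 1\}\to\Sigma$, analytic on the open strip, such that for $j=0,1$ the map $t\mapsto F(j+it)$ is continuous from $\mathbb R$ into $X_j$ and tends to $0$ as $|t|\to\infty$, with norm $\|F\|=\max_{j=0,1}\sup_{t}\|F(j+it)\|_{X_j}$. For $k=0,1,2$ let $\Delta_k:\mathcal C\to\Sigma$, $\Delta_k(F)=F^{(k)}(1/2)/k!$. Put $Z_2=\{(\Delta_1F,\Delta_0F):F\in\mathcal C\}$ (the Kalton-Peck space) and $Z_3=\{(\Delta_2F,\Delta_1F,\Delta_0F):F\in\mathcal C\}$, each with the quotient norm (the infimum of $\|F\|$ over all $F\in\mathcal C$ representing the given element). A twisted Hilbert space is a Banach space $X$ having a closed subspace $H$ such that both $H$ and $X/H$ are isomorphic to Hilbert spaces. An operator is strictly singular if its restriction to any infinite dimensional closed subspace is not an isomorphism onto its image. *)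

theory Defs
  imports "HOL-Analysis.Analysis"
begin

section \<open>Complex normed spaces with explicit carrier\<close>

text \<open>
  HOL-Analysis has type classes for real normed spaces only. Since subspaces, quotients,
  the Calderon space and the derived spaces all occur as spaces in their own right,
  complex normed spaces are treated here as records with a carrier set.  All conditions are
  relative to the carrier; values of the operations outside it are irrelevant.
\<close>

record 'a cspace =
  carr :: "'a set"
  add :: "'a \<Rightarrow> 'a \<Rightarrow> 'a"
  zer :: 'a
  scl :: "complex \<Rightarrow> 'a \<Rightarrow> 'a"
  nrm :: "'a \<Rightarrow> real"

definition vdiff :: "'a cspace \<Rightarrow> 'a \<Rightarrow> 'a \<Rightarrow> 'a" where
  "vdiff V x y = add V x (scl V (- 1) y)"

locale complex_normed_space =
  fixes V :: "'a cspace"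
  assumes zer_closed: "zer V \<in> carr V"
    and add_closed: "\<lbrakk>x \<in> carr V; y \<in> carr V\<rbrakk> \<Longrightarrow> add V x y \<in> carr V"
    and scl_closed: "x \<in> carr V \<Longrightarrow> scl V c x \<in> carr V"
    and add_assoc: "\<lbrakk>x \<in> carr V; y \<in> carr V; z \<in> carr V\<rbrakk>
          \<Longrightarrow> add V (add V x y) z = add V x (add V y z)"
    and add_commute: "\<lbrakk>x \<in> carr V; y \<in> carr V\<rbrakk> \<Longrightarrow> add V x y = add V y x"
    and add_zer: "x \<in> carr V \<Longrightarrow> add V x (zer V) = x"
    and diff_self: "x \<in> carr V \<Longrightarrow> vdiff V x x = zer V"
    and scl_one: "x \<in> carr V \<Longrightarrow> scl V 1 x = x"
    and scl_scl: "x \<in> carr V \<Longrightarrow> scl V a (scl V b x) = scl V (a * b) x"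
    and scl_add_left: "x \<in> carr V \<Longrightarrow> scl V (a + b) x = add V (scl V a x) (scl V b x)"
    and scl_add_right: "\<lbrakk>x \<in> carr V; y \<in> carr V\<rbrakk>
          \<Longrightarrow> scl V a (add V x y) = add V (scl V a x) (scl V a y)"
    and nrm_nonneg: "x \<in> carr V \<Longrightarrow> 0 \<le> nrm V x"
    and nrm_eq_0: "x \<in> carr V \<Longrightarrow> nrm V x = 0 \<longleftrightarrow> x = zer V"
    and nrm_scl: "x \<in> carr V \<Longrightarrow> nrm V (scl V a x) = cmod a * nrm V x"
    and nrm_triangle: "\<lbrakk>x \<in> carr V; y \<in> carr V\<rbrakk> \<Longrightarrow> nrm V (add V x y) \<le> nrm V x + nrm V y"

definition converges_to :: "'a cspace \<Rightarrow> (nat \<Rightarrow> 'a) \<Rightarrow> 'a \<Rightarrow> bool" where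
  "converges_to V s l \<longleftrightarrow> (\<lambda>n. nrm V (vdiff V (s n) l)) \<longlonglongrightarrow> 0"

definition cauchy_in :: "'a cspace \<Rightarrow> (nat \<Rightarrow> 'a) \<Rightarrow> bool" where
  "cauchy_in V s \<longleftrightarrow> (\<forall>e>0. \<exists>N. \<forall>m\<ge>N. \<forall>n\<ge>N. nrm V (vdiff V (s m) (s n)) < e)"

locale complex_banach_space = complex_normed_space V for V :: "'a cspace" +
  assumes complete: "\<lbrakk>\<And>n. s n \<in> carr V; cauchy_in V s\<rbrakk> \<Longrightarrow> \<exists>l\<in>carr V. converges_to V s l"

definition inner_product_of :: "'a cspace \<Rightarrow> ('a \<Rightarrow> 'a \<Rightarrow> complex) \<Rightarrow> bool" where
  "inner_product_of V ip \<longleftrightarrow>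
     (\<forall>x\<in>carr V. \<forall>y\<in>carr V. \<forall>z\<in>carr V. ip (add V x y) z = ip x z + ip y z) \<and>
     (\<forall>c. \<forall>x\<in>carr V. \<forall>y\<in>carr V. ip (scl V c x) y = c * ip x y) \<and>
     (\<forall>x\<in>carr V. \<forall>y\<in>carr V. ip y x = cnj (ip x y)) \<and>
     (\<forall>x\<in>carr V. ip x x = complex_of_real ((nrm V x)\<^sup>2))"

definition hilbert_space :: "'a cspace \<Rightarrow> bool" where
  "hilbert_space V \<longleftrightarrow> complex_banach_space V \<and> (\<exists>ip. inner_product_of V ip)"


section \<open>Operators, subspaces and quotients\<close>

definition bounded_operator :: "'a cspace \<Rightarrow> 'b cspace \<Rightarrow> ('a \<Rightarrow> 'b) \<Rightarrow> bool" where
  "bounded_operator V W T \<longleftrightarrow>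
     (\<forall>x\<in>carr V. T x \<in> carr W) \<and>
     (\<forall>x\<in>carr V. \<forall>y\<in>carr V. T (add V x y) = add W (T x) (T y)) \<and>
     (\<forall>c. \<forall>x\<in>carr V. T (scl V c x) = scl W c (T x)) \<and>
     (\<exists>K. \<forall>x\<in>carr V. nrm W (T x) \<le> K * nrm V x)"

definition isomorphism :: "'a cspace \<Rightarrow> 'b cspace \<Rightarrow> ('a \<Rightarrow> 'b) \<Rightarrow> bool" where
  "isomorphism V W T \<longleftrightarrow>
     bounded_operator V W T \<and> bij_betw T (carr V) (carr W) \<and>
     bounded_operator W V (inv_into (carr V) T)"

definition isomorphic :: "'a cspace \<Rightarrow> 'b cspace \<Rightarrow> bool" where
  "isomorphic V W \<longleftrightarrow> (\<exists>T. isomorphism V W T)"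

definition subspace_as_space :: "'a cspace \<Rightarrow> 'a set \<Rightarrow> 'a cspace" where
  "subspace_as_space V S = V\<lparr>carr := S\<rparr>"

definition linear_subspace :: "'a cspace \<Rightarrow> 'a set \<Rightarrow> bool" where
  "linear_subspace V S \<longleftrightarrow>
     S \<subseteq> carr V \<and> zer V \<in> S \<and> (\<forall>x\<in>S. \<forall>y\<in>S. add V x y \<in> S) \<and> (\<forall>c. \<forall>x\<in>S. scl V c x \<in> S)"

definition closed_subspace :: "'a cspace \<Rightarrow> 'a set \<Rightarrow> bool" where
  "closed_subspace V S \<longleftrightarrow>
     linear_subspace V S \<and>
     (\<forall>s l. (\<forall>n. s n \<in> S) \<and> l \<in> carr V \<and> converges_to V s l \<longrightarrow> l \<in> S)"

definition finite_dimensional :: "'a cspace \<Rightarrow> 'a set \<Rightarrow> bool" where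
  "finite_dimensional V S \<longleftrightarrow> (\<exists>B. finite B \<and> B \<subseteq> S \<and> linear_subspace V hull B = S)"

definition coset :: "'a cspace \<Rightarrow> 'a set \<Rightarrow> 'a \<Rightarrow> 'a set" where
  "coset V H x = (\<lambda>h. add V x h) ` H"

text \<open>In the scalar multiplication, \<open>H\<close> is added so that \<open>0 \<cdot> A\<close> is the coset \<open>H\<close>
  and not just the singleton of zero.\<close>

definition quotient_space :: "'a cspace \<Rightarrow> 'a set \<Rightarrow> 'a set cspace" where
  "quotient_space V H =
     \<lparr>carr = coset V H ` carr V,
      add = (\<lambda>A B. {add V a b | a b. a \<in> A \<and> b \<in> B}),
      zer = H,
      scl = (\<lambda>c A. {add V (scl V c a) h | a h. a \<in> A \<and> h \<in> H}),
      nrm = (\<lambda>A. INF a\<in>A. nrm V a)\<rparr>"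

text \<open>The Hilbert space is taken over the same type as \<open>V\<close>. This is no restriction: an
  isomorphic Hilbert space over another type can be transported along the bijection.\<close>

definition isomorphic_to_hilbert :: "'a cspace \<Rightarrow> bool" where
  "isomorphic_to_hilbert V \<longleftrightarrow> (\<exists>K :: 'a cspace. hilbert_space K \<and> isomorphic V K)"

definition twisted_hilbert_space :: "'a cspace \<Rightarrow> bool" where
  "twisted_hilbert_space X \<longleftrightarrow>
     complex_banach_space X \<and>
     (\<exists>H. closed_subspace X H \<and> isomorphic_to_hilbert (subspace_as_space X H) \<and>
          isomorphic_to_hilbert (quotient_space X H))"

definition strictly_singular :: "'a cspace \<Rightarrow> 'b cspace \<Rightarrow> ('a \<Rightarrow> 'b) \<Rightarrow> bool" where
  "strictly_singular V W T \<longleftrightarrow>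
     (\<forall>S. closed_subspace V S \<and> \<not> finite_dimensional V S \<longrightarrow>
          \<not> isomorphism (subspace_as_space V S) (subspace_as_space W (T ` S)) T)"

definition complemented_subspace :: "'a cspace \<Rightarrow> 'a set \<Rightarrow> bool" where
  "complemented_subspace V S \<longleftrightarrow>
     closed_subspace V S \<and>
     (\<exists>P. bounded_operator V V P \<and> P ` carr V = S \<and> (\<forall>x\<in>S. P x = x))"

definition contains_complemented_copy :: "'a cspace \<Rightarrow> 'b cspace \<Rightarrow> bool" where
  "contains_complemented_copy V Y \<longleftrightarrow>
     (\<exists>S. complemented_subspace V S \<and> isomorphic (subspace_as_space V S) Y)"


section \<open>Sequence spaces\<close>

type_synonym cseq = "nat \<Rightarrow> complex"

definition linf :: "cseq cspace" where
  "linf = \<lparr>carr = {x. bounded (range x)},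
           add = (\<lambda>x y n. x n + y n), zer = (\<lambda>n. 0), scl = (\<lambda>c x n. c * x n),
           nrm = (\<lambda>x. SUP n. cmod (x n))\<rparr>"

definition l1 :: "cseq cspace" where
  "l1 = \<lparr>carr = {x. summable (\<lambda>n. cmod (x n))},
         add = (\<lambda>x y n. x n + y n), zer = (\<lambda>n. 0), scl = (\<lambda>c x n. c * x n),
         nrm = (\<lambda>x. \<Sum>n. cmod (x n))\<rparr>"

definition l2 :: "cseq cspace" where
  "l2 = \<lparr>carr = {x. summable (\<lambda>n. (cmod (x n))\<^sup>2)},
         add = (\<lambda>x y n. x n + y n), zer = (\<lambda>n. 0), scl = (\<lambda>c x n. c * x n),
         nrm = (\<lambda>x. sqrt (\<Sum>n. (cmod (x n))\<^sup>2))\<rparr>"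

text \<open>The sum of a couple, for two spaces with the same ambient vector operations.\<close>

definition sum_space :: "'a cspace \<Rightarrow> 'a cspace \<Rightarrow> 'a cspace" where
  "sum_space X0 X1 = X0
     \<lparr>carr := {add X0 a b | a b. a \<in> carr X0 \<and> b \<in> carr X1},
      nrm := (\<lambda>x. Inf {nrm X0 a + nrm X1 b | a b.
                         a \<in> carr X0 \<and> b \<in> carr X1 \<and> add X0 a b = x})\<rparr>"


section \<open>The Calderon space\<close>

definition continuous_into :: "'a cspace \<Rightarrow> 't::topological_space set \<Rightarrow> ('t \<Rightarrow> 'a) \<Rightarrow> bool" where
  "continuous_into V S f \<longleftrightarrow>
     (\<forall>t\<in>S. f t \<in> carr V) \<and>
     (\<forall>t\<in>S. ((\<lambda>s. nrm V (vdiff V (f s) (f t))) \<longlongrightarrow> 0) (at t within S))"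

definition has_cderiv :: "'a cspace \<Rightarrow> (complex \<Rightarrow> 'a) \<Rightarrow> 'a \<Rightarrow> complex \<Rightarrow> bool" where
  "has_cderiv V F D z \<longleftrightarrow>
     D \<in> carr V \<and>
     ((\<lambda>w. nrm V (vdiff V (scl V (1 / (w - z)) (vdiff V (F w) (F z))) D)) \<longlongrightarrow> 0) (at z)"

definition cderiv :: "'a cspace \<Rightarrow> (complex \<Rightarrow> 'a) \<Rightarrow> complex \<Rightarrow> 'a" where
  "cderiv V F z = (THE D. has_cderiv V F D z)"

definition closed_strip :: "complex set" where
  "closed_strip = {z. 0 \<le> Re z \<and> Re z \<le> 1}"

definition open_strip :: "complex set" where
  "open_strip = {z. 0 < Re z \<and> Re z < 1}"

text \<open>A function on the closed strip is represented by its extension by zero to the plane.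
  Analyticity on the open strip is norm differentiability in the complex sense at each point.\<close>

definition calderon_space :: "'a cspace \<Rightarrow> 'a cspace \<Rightarrow> (complex \<Rightarrow> 'a) cspace" where
  "calderon_space X0 X1 =
    (let \<Sigma> = sum_space X0 X1 in
     \<lparr>carr = {F. (\<forall>z. z \<notin> closed_strip \<longrightarrow> F z = zer \<Sigma>) \<and>
                 continuous_into \<Sigma> closed_strip F \<and>
                 (\<exists>M. \<forall>z\<in>closed_strip. nrm \<Sigma> (F z) \<le> M) \<and>
                 (\<forall>z\<in>open_strip. \<exists>D. has_cderiv \<Sigma> F D z) \<and>
                 continuous_into X0 UNIV (\<lambda>t::real. F (Complex 0 t)) \<and>
                 ((\<lambda>t::real. nrm X0 (F (Complex 0 t))) \<longlongrightarrow> 0) at_infinity \<and>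
                 continuous_into X1 UNIV (\<lambda>t::real. F (Complex 1 t)) \<and>
                 ((\<lambda>t::real. nrm X1 (F (Complex 1 t))) \<longlongrightarrow> 0) at_infinity},
      add = (\<lambda>F G z. add \<Sigma> (F z) (G z)),
      zer = (\<lambda>z. zer \<Sigma>),
      scl = (\<lambda>c F z. scl \<Sigma> c (F z)),
      nrm = (\<lambda>F. max (SUP t::real. nrm X0 (F (Complex 0 t)))
                     (SUP t::real. nrm X1 (F (Complex 1 t))))\<rparr>)"


section \<open>The derived spaces\<close>

definition Sigma_space :: "cseq cspace" where
  "Sigma_space = sum_space linf l1"

definition calderon :: "(complex \<Rightarrow> cseq) cspace" where
  "calderon = calderon_space linf l1"

definition \<Delta> :: "nat \<Rightarrow> (complex \<Rightarrow> cseq) \<Rightarrow> cseq" where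
  "\<Delta> k F = scl Sigma_space (1 / fact k) ((cderiv Sigma_space ^^ k) F (1 / 2))"

definition quotient_norm :: "'a cspace \<Rightarrow> ('a \<Rightarrow> 'b) \<Rightarrow> 'b \<Rightarrow> real" where
  "quotient_norm C \<Phi> v = (INF F\<in>{F \<in> carr C. \<Phi> F = v}. nrm C F)"

definition Z2 :: "(cseq \<times> cseq) cspace" where
  "Z2 =
    (let \<Phi> = (\<lambda>F. (\<Delta> 1 F, \<Delta> 0 F)) in
     \<lparr>carr = \<Phi> ` carr calderon,
      add = (\<lambda>(x1, x0) (y1, y0). (add Sigma_space x1 y1, add Sigma_space x0 y0)),
      zer = (zer Sigma_space, zer Sigma_space),
      scl = (\<lambda>c (x1, x0). (scl Sigma_space c x1, scl Sigma_space c x0)),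
      nrm = quotient_norm calderon \<Phi>\<rparr>)"

definition Z3 :: "(cseq \<times> cseq \<times> cseq) cspace" where
  "Z3 =
    (let \<Phi> = (\<lambda>F. (\<Delta> 2 F, \<Delta> 1 F, \<Delta> 0 F)) in
     \<lparr>carr = \<Phi> ` carr calderon,
      add = (\<lambda>(x2, x1, x0) (y2, y1, y0).
               (add Sigma_space x2 y2, add Sigma_space x1 y1, add Sigma_space x0 y0)),
      zer = (zer Sigma_space, zer Sigma_space, zer Sigma_space),
      scl = (\<lambda>c (x2, x1, x0). (scl Sigma_space c x2, scl Sigma_space c x1, scl Sigma_space c x0)),
      nrm = quotient_norm calderon \<Phi>\<rparr>)"

end

theory Submission
  imports Defs "HOL-Complex_Analysis.Complex_Analysis" "HOL-Library.Function_Algebras"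
begin

text \<open>
  Writing \<open>\<Phi>\<close> for multiplication by a function \<open>phi\<close> with a simple zero at \<open>1/2\<close>, an element of
  \<open>Z\<^sub>3\<close> is the 2-jet at \<open>1/2\<close> of a function \<open>F\<close> in the Calderon space, and \<open>\<Phi>\<close> acts on jets as a
  nilpotent operator. If \<open>F\<close> is a signed sum of \<open>N\<close> disjoint bounded blocks, then
  \<open>N powr (1/2 - z) F\<close> has norm \<open>O(\<surd>N)\<close>; expanding the exponential in powers of \<open>phi\<close> shows that
  the jets of \<open>F\<close>, \<open>\<Phi> F\<close>, \<open>\<Phi>\<^sup>2 F\<close> have norms of exact order \<open>L\<^sup>2 \<surd>N\<close>, \<open>L \<surd>N\<close>, \<open>\<surd>N\<close> with \<open>L = ln N\<close>,
  each being a multiple of the next one up to lower order.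

  In a twisted Hilbert space \<open>X\<close>, on the other hand, any \<open>N\<close> vectors of norm at most 1 have a signed sum
  of norm \<open>O(L \<surd>N)\<close>. For an operator \<open>T : Z\<^sub>3 \<rightarrow> X\<close> this forces the images of
  \<open>F\<close>, \<open>\<Phi> F\<close>, \<open>\<Phi>\<^sup>2 F\<close> to have norms \<open>O(L \<surd>N)\<close>, \<open>O(\<surd>N)\<close>, \<open>O(\<surd>N / L)\<close>, one factor \<open>L\<close> short, so \<open>T\<close>
  is not bounded below on \<open>\<Phi>\<^sup>j\<close> of any block sequence whose values at \<open>1/2\<close> do not tend to 0 in \<open>\<ell>\<^sub>2\<close>.
  A gliding hump argument shows that every infinite dimensional subspace of \<open>Z\<^sub>3\<close> contains, up to
  small perturbations, such a sequence for some \<open>j \<le> 2\<close>. The spaces \<open>\<ell>\<^sub>2\<close> and \<open>Z\<^sub>2\<close> admit the same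
  signed sum estimate, so the same argument excludes projections onto copies of them.
\<close>

section \<open>The sum space\<close>

text \<open>Why \<open>L\<close> is lost only once in a twisted Hilbert space: the square of its
  norm is equivalent to a sum of two terms, the first (from the quotient) obeying the parallelogram
  law, the second (from the subspace) obeying it up to a multiple of the first. With
  \<open>N = 2 ^ k\<close>, signs are chosen along a binary tree of depth \<open>k\<close>; Young's
  inequality with parameter \<open>k\<close> keeps the growth of the second term bounded and lets
  the first feed into it by a factor of order \<open>k\<^sup>2\<close>, that is \<open>k\<close> for
  the norm. The signs are chosen for \<open>F\<close> alone. The bounds for its products with
  \<open>phi\<close> come from solving the expansion of \<open>F\<close> for its last term, whose
  coefficient has order \<open>L\<^sup>2\<close>. Two obstacles shape the rest. Division by
  \<open>phi\<close> needs the value at \<open>1/2\<close> to vanish, so the growth argument serves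
  to force these values to 0, once for each power of \<open>phi\<close>; the third power is 0 on
  2-jets and ends the process. And truncations need not converge in the Calderon norm, because
  bounded sequences need not have small tails on the line \<open>Re z = 0\<close>; they converge in
  the quotient norm, after the two boundary lines have been balanced by an exponential.\<close>

lemma linf_simps [simp]:
  "carr linf = {x. bounded (range x)}" "add linf x y = (\<lambda>n. x n + y n)"
  "zer linf = (\<lambda>n. 0)" "scl linf c x = (\<lambda>n. c * x n)"
  by (simp_all add: linf_def)

lemma l1_simps [simp]:
  "carr l1 = {x. summable (\<lambda>n. cmod (x n))}" "add l1 x y = (\<lambda>n. x n + y n)"
  "zer l1 = (\<lambda>n. 0)" "scl l1 c x = (\<lambda>n. c * x n)" "nrm l1 x = (\<Sum>n. cmod (x n))"
  by (simp_all add: l1_def)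

lemma nrm_linf: "nrm linf x = (SUP n. cmod (x n))"
  by (simp add: linf_def)

lemma bdd_above_range_cmod: "bounded (range x) \<Longrightarrow> bdd_above (range (\<lambda>n. cmod (x n)))"
  by (force simp: bounded_iff bdd_above_def)

lemma cmod_le_nrm_linf: "bounded (range x) \<Longrightarrow> cmod (x n) \<le> nrm linf x"
  unfolding nrm_linf by (rule cSUP_upper) (auto intro: bdd_above_range_cmod)

lemma nrm_linf_leI: "(\<And>n. cmod (x n) \<le> K) \<Longrightarrow> nrm linf x \<le> K"
  unfolding nrm_linf by (rule cSUP_least) auto

lemma nrm_linf_nonneg: "bounded (range x) \<Longrightarrow> 0 \<le> nrm linf x"
  using cmod_le_nrm_linf[of x 0] norm_ge_zero order_trans by blast

lemma summable_cmod_bounded: "summable (\<lambda>n. cmod (x n)) \<Longrightarrow> bounded (range x)"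
  using summable_norm_cancel summable_imp_bounded by blast

lemma nrm_linf_le_nrm_l1:
  assumes "summable (\<lambda>n. cmod (x n))" shows "nrm linf x \<le> (\<Sum>n. cmod (x n))"
proof (rule nrm_linf_leI)
  fix n show "cmod (x n) \<le> (\<Sum>n. cmod (x n))"
    using sum_le_suminf[OF assms, of "{n}"] by simp
qed

lemma bounded_range_add: "bounded (range x) \<Longrightarrow> bounded (range y) \<Longrightarrow> bounded (range (\<lambda>n. x n + y n :: complex))"
  by (rule bounded_plus_comp)

lemma Sigma_space_simps [simp]:
  "add Sigma_space x y = (\<lambda>n. x n + y n)" "zer Sigma_space = (\<lambda>n. 0)"
  "scl Sigma_space c x = (\<lambda>n. c * x n)"
  by (simp_all add: Sigma_space_def sum_space_def)

lemma carr_Sigma_space [simp]: "carr Sigma_space = {x. bounded (range x)}"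
proof -
  have "carr Sigma_space = {\<lambda>n. a n + b n | a b. bounded (range a) \<and> summable (\<lambda>n. cmod (b n))}"
    by (simp add: Sigma_space_def sum_space_def)
  also have "\<dots> = {x. bounded (range x)}"
  proof safe
    fix x :: cseq assume "bounded (range x)"
    then show "\<exists>a b. x = (\<lambda>n. a n + b n) \<and> bounded (range a) \<and> summable (\<lambda>n. cmod (b n))"
      by (intro exI[of _ x] exI[of _ "\<lambda>n. 0"]) auto
  qed (auto intro: bounded_range_add summable_cmod_bounded)
  finally show ?thesis .
qed

text \<open>The sup norm is dominated by the \<open>l1\<close> norm, so no decomposition beats
  \<open>x = x + 0\<close>.\<close>

lemma nrm_Sigma_space [simp]:
  assumes "bounded (range x)" shows "nrm Sigma_space x = nrm linf x"
proof -
  have "nrm Sigma_space x = Inf {nrm linf a + (\<Sum>n. cmod (b n)) | a b.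
      bounded (range a) \<and> summable (\<lambda>n. cmod (b n)) \<and> (\<lambda>n. a n + b n) = x}"
    by (simp add: Sigma_space_def sum_space_def)
  also have "\<dots> = nrm linf x"
  proof (rule cInf_eq_minimum)
    show "nrm linf x \<in> {nrm linf a + (\<Sum>n. cmod (b n)) | a b.
      bounded (range a) \<and> summable (\<lambda>n. cmod (b n)) \<and> (\<lambda>n. a n + b n) = x}"
      using assms by (intro CollectI exI[of _ x] exI[of _ "\<lambda>n. 0"]) (simp add: nrm_linf)
  next
    fix y assume "y \<in> {nrm linf a + (\<Sum>n. cmod (b n)) | a b.
      bounded (range a) \<and> summable (\<lambda>n. cmod (b n)) \<and> (\<lambda>n. a n + b n) = x}"
    then obtain a b where ab: "bounded (range a)" "summable (\<lambda>n. cmod (b n))"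
      "x = (\<lambda>n. a n + b n)" "y = nrm linf a + (\<Sum>n. cmod (b n))" by auto
    show "nrm linf x \<le> y"
    proof (rule nrm_linf_leI)
      fix n
      have "cmod (x n) \<le> cmod (a n) + cmod (b n)" using ab by (simp add: norm_triangle_ineq)
      also have "\<dots> \<le> y" using cmod_le_nrm_linf[OF ab(1), of n]
          cmod_le_nrm_linf[OF summable_cmod_bounded[OF ab(2)], of n] nrm_linf_le_nrm_l1[OF ab(2)] ab
        by linarith
      finally show "cmod (x n) \<le> y" .
    qed
  qed
  finally show ?thesis .
qed

lemma vdiff_simps [simp]:
  "vdiff linf x y = (\<lambda>n. x n - y n)" "vdiff l1 x y = (\<lambda>n. x n - y n)"
  "vdiff Sigma_space x y = (\<lambda>n. x n - y n)"
  by (auto simp: vdiff_def)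

text \<open>Trades the supremum for an estimate uniform in the coordinate, the form in which
  \<open>calf\<close> is stated.\<close>

lemma linf_tendsto_0_iff:
  assumes "\<forall>\<^sub>F s in A. bounded (range (f s))"
  shows "((\<lambda>s. nrm linf (f s)) \<longlongrightarrow> 0) A \<longleftrightarrow> (\<forall>e>0. \<forall>\<^sub>F s in A. \<forall>n. cmod (f s n) \<le> e)"
proof safe
  fix e :: real assume "((\<lambda>s. nrm linf (f s)) \<longlongrightarrow> 0) A" "e > 0"
  then have "\<forall>\<^sub>F s in A. dist (nrm linf (f s)) 0 < e" by (rule tendstoD)
  with assms show "\<forall>\<^sub>F s in A. \<forall>n. cmod (f s n) \<le> e"
  proof eventually_elim
    case (elim s)
    then show ?case using cmod_le_nrm_linf[of "f s"] by (smt (verit, best) dist_real_def)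
  qed
next
  assume *: "\<forall>e>0. \<forall>\<^sub>F s in A. \<forall>n. cmod (f s n) \<le> e"
  show "((\<lambda>s. nrm linf (f s)) \<longlongrightarrow> 0) A"
  proof (rule tendstoI)
    fix e :: real assume "e > 0"
    then have "\<forall>\<^sub>F s in A. \<forall>n. cmod (f s n) \<le> e / 2" using * half_gt_zero by blast
    with assms show "\<forall>\<^sub>F s in A. dist (nrm linf (f s)) 0 < e"
    proof eventually_elim
      case (elim s)
      then show ?case using nrm_linf_leI[of "f s" "e/2"] nrm_linf_nonneg[of "f s"] \<open>e > 0\<close> by auto
    qed
  qed
qed

section \<open>Derivatives\<close>

lemma open_open_strip: "open open_strip"
proof -
  have *: "open_strip = {z. 0 < Re z} \<inter> {z. Re z < 1}" by (auto simp: open_strip_def)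
  show ?thesis unfolding * by (intro open_Int open_halfspace_Re_gt open_halfspace_Re_lt)
qed

lemma closed_closed_strip: "closed closed_strip"
proof -
  have *: "closed_strip = {z. 0 \<le> Re z} \<inter> {z. Re z \<le> 1}" by (auto simp: closed_strip_def)
  show ?thesis unfolding * by (intro closed_Int closed_halfspace_Re_ge closed_halfspace_Re_le)
qed

lemma open_strip_subset: "open_strip \<subseteq> closed_strip"
  by (auto simp: open_strip_def closed_strip_def)

lemma half_in_open_strip [simp]: "1/2 \<in> open_strip"
  by (simp add: open_strip_def)

lemma cball_half_subset: "cball (1/2) (1/4) \<subseteq> open_strip"
proof
  fix z :: complex assume "z \<in> cball (1/2) (1/4)"
  then have "cmod (z - 1/2) \<le> 1/4" by (simp add: dist_norm norm_minus_commute)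
  then have "\<bar>Re (z - 1/2)\<bar> \<le> 1/4" using abs_Re_le_cmod order_trans by blast
  then have "\<bar>Re z - 1/2\<bar> \<le> 1/4" by (metis Re_divide_numeral minus_complex.sel(1) one_complex.sel(1))
  then show "z \<in> open_strip" unfolding open_strip_def abs_le_iff by auto
qed

text \<open>Cauchy's inequality on circles of radius \<open>r/4\<close> bounds the second derivative
  on the half ball by \<open>2 * M / (r/4)\<^sup>2\<close>, whence the 32. The bound depends on
  \<open>f\<close> through \<open>M\<close> alone, so it serves all coordinates of a sequence-valued
  function at once.\<close>

lemma deriv_remainder_bound:
  assumes hol: "f holomorphic_on ball z r" and bd: "\<And>u. u \<in> ball z r \<Longrightarrow> cmod (f u) \<le> M"
    and r: "0 < r" and w: "w \<in> ball z (r/2)" "w \<noteq> z"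
  shows "cmod ((f w - f z) / (w - z) - deriv f z) \<le> 32 * M / r\<^sup>2 * cmod (w - z)"
proof -
  have sub: "cball u (r/4) \<subseteq> ball z r" if "u \<in> ball z (r/2)" for u
  proof
    fix v assume "v \<in> cball u (r/4)"
    with that have "dist z u < r/2" "dist u v \<le> r/4" by auto
    with dist_triangle[of z v u] r show "v \<in> ball z r" by auto
  qed
  have B: "cmod ((deriv ^^ Suc 1) f u) \<le> 32 * M / r\<^sup>2" if u: "u \<in> ball z (r/2)" for u
  proof -
    have "cmod ((deriv ^^ 2) f u) \<le> fact 2 * M / (r/4)^2"
    proof (rule Cauchy_inequality)
      show "f holomorphic_on ball u (r/4)"
        using sub[OF u] ball_subset_cball hol holomorphic_on_subset by blast
      show "continuous_on (cball u (r/4)) f"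
        using sub[OF u] hol holomorphic_on_imp_continuous_on continuous_on_subset by blast
      show "cmod (f x) \<le> M" if "norm (u - x) = r/4" for x
        using sub[OF u] that by (intro bd) (auto simp: dist_norm)
    qed (use r in auto)
    also have "\<dots> = 32 * M / r\<^sup>2" by (simp add: power_divide)
    finally show ?thesis by (simp add: numeral_2_eq_2)
  qed
  have "cmod ((deriv ^^ 0) f w - (\<Sum>i\<le>1. (deriv ^^ i) f z * (w - z) ^ i / fact i))
        \<le> 32 * M / r\<^sup>2 * cmod (w - z) ^ Suc 1 / fact 1"
  proof (rule complex_Taylor[of "ball z (r/2)"])
    fix i x assume x: "x \<in> ball z (r/2)" "i \<le> (1::nat)"
    have "(deriv ^^ i) f holomorphic_on ball z r"
      using hol by (intro holomorphic_higher_deriv) auto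
    then show "((deriv ^^ i) f has_field_derivative (deriv ^^ Suc i) f x) (at x within ball z (r/2))"
      using x r holomorphic_derivI[of "(deriv ^^ i) f" "ball z r" x]
      by (auto intro: has_field_derivative_at_within)
  qed (use B w r in auto)
  then have "cmod (f w - f z - deriv f z * (w - z)) \<le> 32 * M / r\<^sup>2 * (cmod (w - z))\<^sup>2"
    by (simp add: power2_eq_square diff_diff_eq)
  then have "cmod (f w - f z - deriv f z * (w - z)) / cmod (w - z) \<le> 32 * M / r\<^sup>2 * cmod (w - z)"
    using w by (simp add: divide_le_eq power2_eq_square mult.assoc)
  moreover have "cmod (f w - f z - deriv f z * (w - z)) / cmod (w - z)
      = cmod ((f w - f z) / (w - z) - deriv f z)"
    using w by (simp add: norm_divide[symmetric] diff_divide_distrib)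
  ultimately show ?thesis by simp
qed

lemma has_cderiv_Sigma_iff:
  assumes "open U" "z \<in> U" "\<And>w. w \<in> U \<Longrightarrow> bounded (range (F w))"
  shows "has_cderiv Sigma_space F D z \<longleftrightarrow> bounded (range D) \<and>
    (\<forall>e>0. \<forall>\<^sub>F w in at z. \<forall>n. cmod ((F w n - F z n) / (w - z) - D n) \<le> e)"
proof (cases "bounded (range D)")
  case True
  define Q where "Q = (\<lambda>w n. (F w n - F z n) / (w - z) - D n)"
  have bd: "\<forall>\<^sub>F w in at z. bounded (range (Q w))"
    using eventually_at_in_open'[OF assms(1,2)]
  proof eventually_elim
    case (elim w)
    obtain A B C where "\<And>n. cmod (F w n) \<le> A" "\<And>n. cmod (F z n) \<le> B" "\<And>n. cmod (D n) \<le> C"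
      using True assms elim by (metis bounded_iff rangeI)
    then have "cmod (Q w n) \<le> (A + B) / cmod (w - z) + C" for n
      unfolding Q_def
      by (intro order_trans[OF norm_triangle_ineq4] add_mono)
         (auto simp: norm_divide intro!: divide_right_mono order_trans[OF norm_triangle_ineq4] add_mono)
    then show ?case by (force simp: bounded_iff)
  qed
  have "has_cderiv Sigma_space F D z \<longleftrightarrow> ((\<lambda>w. nrm Sigma_space (Q w)) \<longlongrightarrow> 0) (at z)"
    using True by (simp add: has_cderiv_def Q_def)
  also have "\<dots> \<longleftrightarrow> ((\<lambda>w. nrm linf (Q w)) \<longlongrightarrow> 0) (at z)"
    by (rule filterlim_cong) (auto intro: eventually_mono[OF bd])
  also have "\<dots> \<longleftrightarrow> (\<forall>e>0. \<forall>\<^sub>F w in at z. \<forall>n. cmod (Q w n) \<le> e)"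
    using linf_tendsto_0_iff[OF bd] .
  finally show ?thesis using True by (simp add: Q_def)
qed (simp add: has_cderiv_def)

lemma has_cderiv_coord:
  assumes "open U" "z \<in> U" "\<And>w. w \<in> U \<Longrightarrow> bounded (range (F w))" "has_cderiv Sigma_space F D z"
  shows "((\<lambda>w. F w n) has_field_derivative D n) (at z)"
  unfolding DERIV_def LIM_def
proof -
  have ev: "\<forall>e>0. \<forall>\<^sub>F w in at z. \<forall>n. cmod ((F w n - F z n) / (w - z) - D n) \<le> e"
    using has_cderiv_Sigma_iff[OF assms(1,2), of F D] assms(3,4) by blast
  have "((\<lambda>w. (F w n - F z n) / (w - z)) \<longlongrightarrow> D n) (at z)"
  proof (rule tendstoI)
    fix e :: real assume "e > 0"
    then have "\<forall>\<^sub>F w in at z. \<forall>n. cmod ((F w n - F z n) / (w - z) - D n) \<le> e / 2" using ev half_gt_zero by blast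
    then show "\<forall>\<^sub>F w in at z. dist ((F w n - F z n) / (w - z)) (D n) < e"
    proof eventually_elim
      case (elim w)
      then have "cmod ((F w n - F z n) / (w - z) - D n) \<le> e / 2" by blast
      with \<open>e > 0\<close> show ?case by (simp add: dist_norm)
    qed
  qed
  then show "\<forall>r>0. \<exists>s>0. \<forall>x. x \<noteq> 0 \<and> dist x 0 < s \<longrightarrow> dist ((F (z + x) n - F z n) / x) (D n) < r"
    using has_field_derivative_iff[of "\<lambda>w. F w n" "D n" z UNIV] DERIV_def[of "\<lambda>w. F w n" "D n" z]
    by (auto simp: LIM_def)
qed

text \<open>The Taylor remainder is uniform in the coordinate, so the coordinatewise difference
  quotients converge in the sup norm.\<close>

lemma has_cderiv_holomorphic:
  assumes hol: "\<And>n. (\<lambda>w. F w n) holomorphic_on ball z r"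
    and bd: "\<And>n w. w \<in> ball z r \<Longrightarrow> cmod (F w n) \<le> M" and r: "0 < r"
  shows "has_cderiv Sigma_space F (\<lambda>n. deriv (\<lambda>w. F w n) z) z"
proof -
  have bdr: "bounded (range (F w))" if "w \<in> ball z r" for w
    using bd[OF that] by (force simp: bounded_iff)
  have "0 \<le> M" using bd[of z 0] r norm_ge_zero order_trans by (metis centre_in_ball)
  have "bounded (range (\<lambda>n. deriv (\<lambda>w. F w n) z))"
  proof -
    have "cmod ((deriv ^^ 1) (\<lambda>w. F w n) z) \<le> fact 1 * M / (r/2)^1" for n
    proof (rule Cauchy_inequality)
      show "(\<lambda>w. F w n) holomorphic_on ball z (r/2)"
        using hol holomorphic_on_subset r by (metis subset_ball less_eq_real_def half_gt_zero_iff field_sum_of_halves add_increasing2)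
      have "cball z (r/2) \<subseteq> ball z r" using r by auto
      then show "continuous_on (cball z (r/2)) (\<lambda>w. F w n)"
        using hol holomorphic_on_imp_continuous_on continuous_on_subset by blast
      show "cmod (F x n) \<le> M" if "norm (z - x) = r/2" for x
        using that r by (intro bd) (auto simp: dist_norm)
    qed (use r in auto)
    then show ?thesis by (force simp: bounded_iff)
  qed
  moreover have "\<forall>\<^sub>F w in at z. \<forall>n. cmod ((F w n - F z n) / (w - z) - deriv (\<lambda>w. F w n) z) \<le> e"
    if "e > 0" for e
  proof -
    define d where "d = min (r/2) (e / (32 * M / r\<^sup>2 + 1))"
    have K: "32 * M / r\<^sup>2 \<ge> 0" using \<open>0 \<le> M\<close> by simp
    then have "d > 0" using r that unfolding d_def by (auto intro!: divide_pos_pos)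
    have "cmod ((F w n - F z n) / (w - z) - deriv (\<lambda>w. F w n) z) \<le> e"
      if "dist w z < d" "w \<noteq> z" for w n
    proof -
      have "cmod ((F w n - F z n) / (w - z) - deriv (\<lambda>w. F w n) z) \<le> 32 * M / r\<^sup>2 * cmod (w - z)"
        using that by (intro deriv_remainder_bound hol bd r) (auto simp: d_def dist_commute)
      also have "\<dots> \<le> (32 * M / r\<^sup>2 + 1) * (e / (32 * M / r\<^sup>2 + 1))"
        using that K by (intro mult_mono) (auto simp: d_def dist_norm)
      also have "\<dots> = e" using K by (metis add_nonneg_eq_0_iff nonzero_mult_div_cancel_left times_divide_eq_right zero_le_one zero_neq_one)
      finally show ?thesis .
    qed
    then show ?thesis using \<open>d > 0\<close> by (auto simp: eventually_at)
  qed
  ultimately show ?thesis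
    using has_cderiv_Sigma_iff[of "ball z r" z F] bdr r by simp
qed

section \<open>The Calderon space\<close>

lemma l1_add:
  fixes x y :: cseq
  assumes "summable (\<lambda>n. cmod (x n))" "summable (\<lambda>n. cmod (y n))"
  shows "summable (\<lambda>n. cmod (x n + y n))"
    and "(\<Sum>n. cmod (x n + y n)) \<le> (\<Sum>n. cmod (x n)) + (\<Sum>n. cmod (y n))"
proof -
  show s: "summable (\<lambda>n. cmod (x n + y n))"
    by (rule summable_comparison_test'[OF summable_add[OF assms], of 0]) (simp add: norm_triangle_ineq)
  show "(\<Sum>n. cmod (x n + y n)) \<le> (\<Sum>n. cmod (x n)) + (\<Sum>n. cmod (y n))"
    unfolding suminf_add[OF assms] by (intro suminf_le norm_triangle_ineq s summable_add assms)
qed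

lemma l1_diff:
  fixes x y :: cseq
  assumes "summable (\<lambda>n. cmod (x n))" "summable (\<lambda>n. cmod (y n))"
  shows "summable (\<lambda>n. cmod (x n - y n))"
    and "(\<Sum>n. cmod (x n - y n)) \<le> (\<Sum>n. cmod (x n)) + (\<Sum>n. cmod (y n))"
  using l1_add[of x "\<lambda>n. - y n"] assms by simp_all

lemma l1_cmult:
  fixes x :: cseq
  assumes "summable (\<lambda>n. cmod (x n))"
  shows "summable (\<lambda>n. cmod (c * x n))" "(\<Sum>n. cmod (c * x n)) = cmod c * (\<Sum>n. cmod (x n))"
  using assms by (simp_all add: norm_mult summable_mult suminf_mult)

lemma Complex_in_closed_strip [simp]: "Complex 0 t \<in> closed_strip" "Complex 1 t \<in> closed_strip"
  by (simp_all add: closed_strip_def)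

lemma filterlim_Complex:
  assumes "0 \<le> j" "j \<le> 1"
  shows "filterlim (Complex j) (at (Complex j t) within closed_strip) (at t)"
proof -
  have eq: "Complex j = (\<lambda>s. of_real j + \<i> * of_real s)" by (auto simp: Complex_eq)
  have "((\<lambda>s. of_real j + \<i> * of_real s) \<longlongrightarrow> of_real j + \<i> * of_real t) (at t)"
    by (intro tendsto_intros)
  then show ?thesis unfolding filterlim_at eq using assms
    by (auto simp: eventually_at_filter closed_strip_def)
qed

lemma tendsto_Complex:
  assumes "continuous_on closed_strip g" "0 \<le> j" "j \<le> 1"
  shows "((\<lambda>s. g (Complex j s)) \<longlongrightarrow> g (Complex j t)) (at t)"
proof -
  have "Complex j t \<in> closed_strip" using assms by (simp add: closed_strip_def)
  then have "(g \<longlongrightarrow> g (Complex j t)) (at (Complex j t) within closed_strip)"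
    using assms(1) by (simp add: continuous_on)
  from filterlim_compose[OF this filterlim_Complex[OF assms(2,3)]] show ?thesis .
qed

text \<open>Since \<open>\<ell>\<^sub>\<infinity> + \<ell>\<^sub>1 = \<ell>\<^sub>\<infinity>\<close> isometrically, membership in the Calderon space can be
  expressed coordinatewise, with \<open>calf\<close> short for Calderon function.\<close>

definition calf :: "(complex \<Rightarrow> cseq) \<Rightarrow> bool" where
  "calf F \<longleftrightarrow>
     (\<forall>z n. z \<notin> closed_strip \<longrightarrow> F z n = 0) \<and>
     (\<exists>M. \<forall>z\<in>closed_strip. \<forall>n. cmod (F z n) \<le> M) \<and>
     (\<forall>z\<in>closed_strip. \<forall>e>0. \<forall>\<^sub>F w in at z within closed_strip. \<forall>n. cmod (F w n - F z n) \<le> e) \<and>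
     (\<forall>n. (\<lambda>z. F z n) holomorphic_on open_strip) \<and>
     (\<forall>e>0. \<forall>\<^sub>F t in at_infinity. \<forall>n. cmod (F (Complex 0 t) n) \<le> e) \<and>
     (\<forall>t. summable (\<lambda>n. cmod (F (Complex 1 t) n))) \<and>
     (\<forall>t. ((\<lambda>s. \<Sum>n. cmod (F (Complex 1 s) n - F (Complex 1 t) n)) \<longlongrightarrow> 0) (at t)) \<and>
     ((\<lambda>t. \<Sum>n. cmod (F (Complex 1 t) n)) \<longlongrightarrow> 0) at_infinity"

lemma mem_calderon_iff:
  "F \<in> carr calderon \<longleftrightarrow>
     (\<forall>z. z \<notin> closed_strip \<longrightarrow> F z = (\<lambda>n. 0)) \<and>
     continuous_into Sigma_space closed_strip F \<and>
     (\<exists>M. \<forall>z\<in>closed_strip. nrm Sigma_space (F z) \<le> M) \<and>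
     (\<forall>z\<in>open_strip. \<exists>D. has_cderiv Sigma_space F D z) \<and>
     continuous_into linf UNIV (\<lambda>t::real. F (Complex 0 t)) \<and>
     ((\<lambda>t::real. nrm linf (F (Complex 0 t))) \<longlongrightarrow> 0) at_infinity \<and>
     continuous_into l1 UNIV (\<lambda>t::real. F (Complex 1 t)) \<and>
     ((\<lambda>t::real. nrm l1 (F (Complex 1 t))) \<longlongrightarrow> 0) at_infinity"
  unfolding calderon_def calderon_space_def Sigma_space_def[symmetric] Let_def by simp

lemma continuous_into_Sigma_iff:
  assumes "\<And>z. z \<in> S \<Longrightarrow> bounded (range (F z))"
  shows "continuous_into Sigma_space S F \<longleftrightarrow>
    (\<forall>z\<in>S. \<forall>e>0. \<forall>\<^sub>F w in at z within S. \<forall>n. cmod (F w n - F z n) \<le> e)"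
proof -
  have "((\<lambda>w. nrm Sigma_space (\<lambda>n. F w n - F z n)) \<longlongrightarrow> 0) (at z within S) \<longleftrightarrow>
        (\<forall>e>0. \<forall>\<^sub>F w in at z within S. \<forall>n. cmod (F w n - F z n) \<le> e)" if z: "z \<in> S" for z
  proof -
    have "bounded (range (\<lambda>n. F w n - F z n))" if "w \<in> S" for w
      using assms[OF that] assms[OF z] by (rule bounded_minus_comp)
    then have bd: "\<forall>\<^sub>F w in at z within S. bounded (range (\<lambda>n. F w n - F z n))"
      by (simp add: eventually_at_filter)
    have "((\<lambda>w. nrm Sigma_space (\<lambda>n. F w n - F z n)) \<longlongrightarrow> 0) (at z within S) \<longleftrightarrow>
          ((\<lambda>w. nrm linf (\<lambda>n. F w n - F z n)) \<longlongrightarrow> 0) (at z within S)"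
      by (rule filterlim_cong) (auto intro: eventually_mono[OF bd])
    then show ?thesis using linf_tendsto_0_iff[OF bd] by simp
  qed
  with assms show ?thesis by (simp add: continuous_into_def)
qed

lemma carr_calderon: "carr calderon = {F. calf F}"
proof (intro equalityI subsetI CollectI)
  fix F assume "F \<in> carr calderon"
  then have F: "\<forall>z. z \<notin> closed_strip \<longrightarrow> F z = (\<lambda>n. 0)"
     "continuous_into Sigma_space closed_strip F"
     "\<exists>M. \<forall>z\<in>closed_strip. nrm Sigma_space (F z) \<le> M"
     "\<forall>z\<in>open_strip. \<exists>D. has_cderiv Sigma_space F D z"
     "continuous_into linf UNIV (\<lambda>t::real. F (Complex 0 t))"
     "((\<lambda>t::real. nrm linf (F (Complex 0 t))) \<longlongrightarrow> 0) at_infinity"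
     "continuous_into l1 UNIV (\<lambda>t::real. F (Complex 1 t))"
     "((\<lambda>t::real. nrm l1 (F (Complex 1 t))) \<longlongrightarrow> 0) at_infinity"
    unfolding mem_calderon_iff by blast+
  have bd: "bounded (range (F z))" if "z \<in> closed_strip" for z
    using F(2) that by (auto simp: continuous_into_def)
  have "\<forall>\<^sub>F t in at_infinity. bounded (range (F (Complex 0 t)))"
    by (intro always_eventually allI bd) simp
  note inf = linf_tendsto_0_iff[OF this]
  have "(\<lambda>z. F z n) holomorphic_on open_strip" for n
    unfolding holomorphic_on_open[OF open_open_strip]
  proof safe
    fix z assume "z \<in> open_strip"
    with F(4) obtain D where "has_cderiv Sigma_space F D z" by blast
    from has_cderiv_coord[OF open_open_strip \<open>z \<in> open_strip\<close> _ this]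
    show "\<exists>f'. ((\<lambda>z. F z n) has_field_derivative f') (at z)"
      using bd open_strip_subset by blast
  qed
  moreover have "\<exists>M. \<forall>z\<in>closed_strip. \<forall>n. cmod (F z n) \<le> M"
  proof -
    obtain M where "\<And>z. z \<in> closed_strip \<Longrightarrow> nrm Sigma_space (F z) \<le> M" using F(3) by blast
    then have "cmod (F z n) \<le> M" if "z \<in> closed_strip" for z n
      using that cmod_le_nrm_linf[OF bd[OF that], of n] bd[OF that] by (metis nrm_Sigma_space order_trans)
    then show ?thesis by blast
  qed
  moreover have "\<forall>z\<in>closed_strip. \<forall>e>0. \<forall>\<^sub>F w in at z within closed_strip. \<forall>n. cmod (F w n - F z n) \<le> e"
    using F(2) continuous_into_Sigma_iff[of closed_strip F] bd by blast
  moreover have "\<forall>e>0. \<forall>\<^sub>F t in at_infinity. \<forall>n. cmod (F (Complex 0 t) n) \<le> e"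
    using inf F(6) by simp
  ultimately show "calf F"
    unfolding calf_def using F(1,7,8) by (simp add: continuous_into_def)
next
  fix F assume "F \<in> {F. calf F}"
  then have F: "\<forall>z n. z \<notin> closed_strip \<longrightarrow> F z n = 0"
     "\<exists>M. \<forall>z\<in>closed_strip. \<forall>n. cmod (F z n) \<le> M"
     "\<forall>z\<in>closed_strip. \<forall>e>0. \<forall>\<^sub>F w in at z within closed_strip. \<forall>n. cmod (F w n - F z n) \<le> e"
     "\<forall>n. (\<lambda>z. F z n) holomorphic_on open_strip"
     "\<forall>e>0. \<forall>\<^sub>F t in at_infinity. \<forall>n. cmod (F (Complex 0 t) n) \<le> e"
     "\<forall>t. summable (\<lambda>n. cmod (F (Complex 1 t) n))"
     "\<forall>t. ((\<lambda>s. \<Sum>n. cmod (F (Complex 1 s) n - F (Complex 1 t) n)) \<longlongrightarrow> 0) (at t)"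
     "((\<lambda>t. \<Sum>n. cmod (F (Complex 1 t) n)) \<longlongrightarrow> 0) at_infinity"
    unfolding calf_def by blast+
  obtain M where M: "\<And>z n. z \<in> closed_strip \<Longrightarrow> cmod (F z n) \<le> M" using F(2) by blast
  then have bd: "bounded (range (F z))" if "z \<in> closed_strip" for z
    using that by (force simp: bounded_iff)
  have "\<exists>D. has_cderiv Sigma_space F D z" if z: "z \<in> open_strip" for z
  proof -
    obtain r where r: "r > 0" "ball z r \<subseteq> open_strip"
      using open_open_strip z by (metis open_contains_ball)
    have "has_cderiv Sigma_space F (\<lambda>n. deriv (\<lambda>w. F w n) z) z"
    proof (rule has_cderiv_holomorphic)
      show "(\<lambda>w. F w n) holomorphic_on ball z r" for n
        using F(4) r holomorphic_on_subset by metis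
      show "cmod (F w n) \<le> M" if "w \<in> ball z r" for w n
        using M r that open_strip_subset by (meson subsetD)
    qed (rule r)
    then show ?thesis by blast
  qed
  moreover have "\<forall>\<^sub>F s in at t. \<forall>n. cmod (F (Complex 0 s) n - F (Complex 0 t) n) \<le> e" if "e > 0" for e t
  proof (rule eventually_compose_filterlim[where f = "Complex 0" and P = "\<lambda>w. \<forall>n. cmod (F w n - F (Complex 0 t) n) \<le> e"])
    show "\<forall>\<^sub>F w in at (Complex 0 t) within closed_strip. \<forall>n. cmod (F w n - F (Complex 0 t) n) \<le> e"
      using F(3) that by simp
  qed (rule filterlim_Complex; simp)
  then have "((\<lambda>s. nrm linf (\<lambda>n. F (Complex 0 s) n - F (Complex 0 t) n)) \<longlongrightarrow> 0) (at t)" for t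
    by (subst linf_tendsto_0_iff) (auto intro!: always_eventually bounded_minus_comp bd)
  moreover have "((\<lambda>t::real. nrm linf (F (Complex 0 t))) \<longlongrightarrow> 0) at_infinity"
    by (subst linf_tendsto_0_iff) (use F in \<open>auto intro!: always_eventually bd\<close>)
  moreover have "\<exists>M. \<forall>z\<in>closed_strip. nrm Sigma_space (F z) \<le> M"
    using M bd by (auto intro!: exI[of _ M] nrm_linf_leI)
  moreover have "continuous_into Sigma_space closed_strip F"
    using continuous_into_Sigma_iff[of closed_strip F] bd F(3) by blast
  moreover have "F z = (\<lambda>n. 0)" if "z \<notin> closed_strip" for z
    using F(1) that by blast
  moreover have "bounded (range (F (Complex 0 t)))" for t
    by (rule bd) simp
  ultimately show "F \<in> carr calderon"
    unfolding mem_calderon_iff using F(6-8) by (simp add: continuous_into_def)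
qed

section \<open>The norm of the Calderon space\<close>

abbreviation cN :: "(complex \<Rightarrow> cseq) \<Rightarrow> real" where "cN \<equiv> nrm calderon"

lemma cN_eq: "cN F = max (SUP t::real. nrm linf (F (Complex 0 t))) (SUP t::real. \<Sum>n. cmod (F (Complex 1 t) n))"
  unfolding calderon_def calderon_space_def Let_def by simp

lemma calfD:
  assumes "calf F"
  shows "z \<notin> closed_strip \<Longrightarrow> F z n = 0"
    "\<exists>M. \<forall>z n. cmod (F z n) \<le> M"
    "\<lbrakk>z \<in> closed_strip; e > 0\<rbrakk> \<Longrightarrow> \<forall>\<^sub>F w in at z within closed_strip. \<forall>n. cmod (F w n - F z n) \<le> e"
    "(\<lambda>z. F z n) holomorphic_on open_strip"
    "e > 0 \<Longrightarrow> \<forall>\<^sub>F t in at_infinity. \<forall>n. cmod (F (Complex 0 t) n) \<le> e"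
    "summable (\<lambda>n. cmod (F (Complex 1 t) n))"
    "((\<lambda>s. \<Sum>n. cmod (F (Complex 1 s) n - F (Complex 1 t) n)) \<longlongrightarrow> 0) (at t)"
    "((\<lambda>t. \<Sum>n. cmod (F (Complex 1 t) n)) \<longlongrightarrow> 0) at_infinity"
proof -
  obtain M where M: "\<And>z n. z \<in> closed_strip \<Longrightarrow> cmod (F z n) \<le> M" using assms unfolding calf_def by blast
  have "cmod (F z n) \<le> \<bar>M\<bar>" for z n
    using M[of z n] assms by (cases "z \<in> closed_strip") (auto simp: calf_def)
  then show "\<exists>M. \<forall>z n. cmod (F z n) \<le> M" by blast
qed (use assms in \<open>auto simp: calf_def\<close>)

lemma calf_bounded: "calf F \<Longrightarrow> bounded (range (F z))"
  using calfD(2)[of F] by (force simp: bounded_iff)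

lemma calf_continuous:
  assumes "calf F" shows "continuous_on closed_strip (\<lambda>z. F z n)"
  unfolding continuous_on
proof (intro ballI tendstoI)
  fix z e assume z: "z \<in> closed_strip" and "(e::real) > 0"
  then have "\<forall>\<^sub>F w in at z within closed_strip. \<forall>n. cmod (F w n - F z n) \<le> e/2"
    using assms calfD(3) half_gt_zero by blast
  then show "\<forall>\<^sub>F w in at z within closed_strip. dist (F w n) (F z n) < e"
  proof eventually_elim
    case (elim w)
    then have "cmod (F w n - F z n) \<le> e / 2" by blast
    with \<open>e > 0\<close> show ?case by (simp add: dist_norm)
  qed
qed

lemma bdd_above_side0:
  assumes "calf F" shows "bdd_above (range (\<lambda>t. nrm linf (F (Complex 0 t))))"
proof -
  obtain M where "\<And>z n. cmod (F z n) \<le> M" using calfD(2)[OF assms] by blast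
  then have "nrm linf (F (Complex 0 t)) \<le> M" for t by (rule nrm_linf_leI)
  then show ?thesis by (auto simp: bdd_above_def)
qed

text \<open>Boundedness in the sum space says nothing about \<open>l1\<close> norms on the line
  \<open>Re z = 1\<close>. The bound comes from compactness: the \<open>l1\<close> norm is
  continuous in \<open>t\<close> and tends to 0 at infinity.\<close>

lemma bdd_above_side1:
  assumes "calf F" shows "bdd_above (range (\<lambda>t. \<Sum>n. cmod (F (Complex 1 t) n)))"
proof -
  let ?f = "\<lambda>t. \<Sum>n. cmod (F (Complex 1 t) n)"
  note D = calfD[OF assms]
  have "(?f \<longlongrightarrow> ?f t) (at t)" for t
  proof (rule LIM_zero_cancel, rule Lim_null_comparison)
    show "\<forall>\<^sub>F s in at t. norm (?f s - ?f t) \<le> (\<Sum>n. cmod (F (Complex 1 s) n - F (Complex 1 t) n))"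
    proof (intro always_eventually allI)
      fix s
      have "?f s - ?f t = (\<Sum>n. cmod (F (Complex 1 s) n) - cmod (F (Complex 1 t) n))"
        by (intro suminf_diff D)
      also have "norm \<dots> \<le> (\<Sum>n. norm (cmod (F (Complex 1 s) n) - cmod (F (Complex 1 t) n)))"
        by (intro summable_norm summable_comparison_test'[OF l1_diff(1)[OF D(6)[of s] D(6)[of t]], of 0])
           (simp add: norm_triangle_ineq3)
      also have "\<dots> \<le> (\<Sum>n. cmod (F (Complex 1 s) n - F (Complex 1 t) n))"
        by (intro suminf_le summable_comparison_test'[OF l1_diff(1)[OF D(6)[of s] D(6)[of t]], of 0] l1_diff D)
           (simp_all add: norm_triangle_ineq3)
      finally show "norm (?f s - ?f t) \<le> (\<Sum>n. cmod (F (Complex 1 s) n - F (Complex 1 t) n))" .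
    qed
  qed (rule D(7))
  then have cont: "continuous_on UNIV ?f" by (auto simp: continuous_on)
  have "\<forall>\<^sub>F t in at_infinity. dist (?f t) 0 < 1" using D(8) by (rule tendstoD) simp
  then obtain R where R: "\<And>t. R \<le> norm t \<Longrightarrow> dist (?f t) 0 < 1" by (auto simp: eventually_at_infinity)
  have "compact (?f ` cball 0 R)"
    using cont by (intro compact_continuous_image) (auto intro: continuous_on_subset)
  then obtain K where K: "\<And>t. t \<in> cball 0 R \<Longrightarrow> norm (?f t) \<le> K"
    using compact_imp_bounded bounded_iff by (metis imageI)
  have "?f t \<le> max 1 K" for t
    using R[of t] K[of t] by (cases "norm t \<le> R") (auto simp: dist_real_def)
  then show ?thesis by (auto simp: bdd_above_def)
qed

lemma cN_side0: "calf F \<Longrightarrow> cmod (F (Complex 0 t) n) \<le> cN F"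
  unfolding cN_eq using cSUP_upper[OF UNIV_I bdd_above_side0[of F], of t]
    cmod_le_nrm_linf[OF calf_bounded[of F], of "Complex 0 t" n] by linarith

lemma cN_side1: "calf F \<Longrightarrow> (\<Sum>n. cmod (F (Complex 1 t) n)) \<le> cN F"
  unfolding cN_eq using cSUP_upper[OF UNIV_I bdd_above_side1[of F], of t] by linarith

lemma cN_leI:
  "\<lbrakk>\<And>t n. cmod (F (Complex 0 t) n) \<le> K; \<And>t. (\<Sum>n. cmod (F (Complex 1 t) n)) \<le> K\<rbrakk> \<Longrightarrow> cN F \<le> K"
  unfolding cN_eq by (intro max.boundedI cSUP_least nrm_linf_leI) auto

lemma cN_nonneg: "calf F \<Longrightarrow> 0 \<le> cN F"
  using cN_side0[of F 0 0] norm_ge_zero order_trans by blast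

section \<open>Sums, multipliers and coordinate restrictions\<close>

lemma calf_add:
  assumes "calf F" "calf G" shows "calf (F + G)"
proof -
  note D = calfD[OF assms(1)] calfD[OF assms(2)]
  have "\<exists>M. \<forall>z\<in>closed_strip. \<forall>n. cmod ((F + G) z n) \<le> M"
    using D(2,10) by (metis add_mono norm_triangle_le plus_fun_apply)
  moreover have "\<forall>\<^sub>F w in at z within closed_strip. \<forall>n. cmod ((F + G) w n - (F + G) z n) \<le> e"
    if "z \<in> closed_strip" "e > 0" for z e
    using D(3)[OF that(1) half_gt_zero[OF that(2)]] D(11)[OF that(1) half_gt_zero[OF that(2)]]
  proof eventually_elim
    case (elim w)
    show ?case
    proof
      fix n
      have "cmod (F w n - F z n) \<le> e/2" "cmod (G w n - G z n) \<le> e/2" using elim by blast+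
      then show "cmod ((F + G) w n - (F + G) z n) \<le> e" using norm_triangle_ineq[of "F w n - F z n" "G w n - G z n"]
        by (simp add: algebra_simps)
    qed
  qed
  moreover have "\<forall>\<^sub>F t in at_infinity. \<forall>n. cmod ((F + G) (Complex 0 t) n) \<le> e"
    if "e > 0" for e
    using D(5)[OF half_gt_zero[OF that]] D(13)[OF half_gt_zero[OF that]]
  proof eventually_elim
    case (elim w)
    show ?case
    proof
      fix n
      have "cmod (F (Complex 0 w) n) \<le> e/2" "cmod (G (Complex 0 w) n) \<le> e/2" using elim by blast+
      then show "cmod ((F + G) (Complex 0 w) n) \<le> e" using norm_triangle_ineq[of "F (Complex 0 w) n" "G (Complex 0 w) n"]
        by simp
    qed
  qed
  moreover have "((\<lambda>s. \<Sum>n. cmod ((F + G) (Complex 1 s) n - (F + G) (Complex 1 t) n)) \<longlongrightarrow> 0) (at t)" for t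
  proof (rule tendsto_sandwich[OF _ _ tendsto_const])
    show "((\<lambda>s. (\<Sum>n. cmod (F (Complex 1 s) n - F (Complex 1 t) n))
        + (\<Sum>n. cmod (G (Complex 1 s) n - G (Complex 1 t) n))) \<longlongrightarrow> 0) (at t)"
      using tendsto_add[OF D(7)[of t] D(15)[of t]] by simp
    have "(\<Sum>n. cmod ((F + G) (Complex 1 s) n - (F + G) (Complex 1 t) n))
        = (\<Sum>n. cmod ((F (Complex 1 s) n - F (Complex 1 t) n) + (G (Complex 1 s) n - G (Complex 1 t) n)))" for s
      by (simp add: algebra_simps)
    also have "\<dots> s \<le> (\<Sum>n. cmod (F (Complex 1 s) n - F (Complex 1 t) n))
        + (\<Sum>n. cmod (G (Complex 1 s) n - G (Complex 1 t) n))" for s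
      by (intro l1_add l1_diff D)
    finally show "\<forall>\<^sub>F s in at t. (\<Sum>n. cmod ((F + G) (Complex 1 s) n - (F + G) (Complex 1 t) n)) \<le>
      (\<Sum>n. cmod (F (Complex 1 s) n - F (Complex 1 t) n))
        + (\<Sum>n. cmod (G (Complex 1 s) n - G (Complex 1 t) n))"
      by simp
    have "summable (\<lambda>n. cmod ((F (Complex 1 s) n - F (Complex 1 t) n) + (G (Complex 1 s) n - G (Complex 1 t) n)))" for s
      by (intro l1_add l1_diff D)
    then show "\<forall>\<^sub>F s in at t. 0 \<le> (\<Sum>n. cmod ((F + G) (Complex 1 s) n - (F + G) (Complex 1 t) n))"
      by (intro always_eventually allI suminf_nonneg) (simp_all add: algebra_simps)
  qed
  moreover have "((\<lambda>t. \<Sum>n. cmod ((F + G) (Complex 1 t) n)) \<longlongrightarrow> 0) at_infinity"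
  proof (rule tendsto_sandwich[OF _ _ tendsto_const])
    show "((\<lambda>s. (\<Sum>n. cmod (F (Complex 1 s) n)) + (\<Sum>n. cmod (G (Complex 1 s) n))) \<longlongrightarrow> 0) at_infinity"
      using tendsto_add[OF D(8) D(16)] by simp
  qed (use l1_add[OF D(6) D(14)] in \<open>auto intro!: always_eventually suminf_nonneg\<close>)
  ultimately show ?thesis
    unfolding calf_def using D l1_add[OF D(6) D(14)]
    by (auto intro!: holomorphic_intros)
qed

definition mul :: "(complex \<Rightarrow> complex) \<Rightarrow> (complex \<Rightarrow> cseq) \<Rightarrow> complex \<Rightarrow> cseq" where
  "mul g F = (\<lambda>z n. g z * F z n)"

lemma mul_apply [simp]: "mul g F z n = g z * F z n"
  by (simp add: mul_def)

definition multiplier :: "(complex \<Rightarrow> complex) \<Rightarrow> bool" where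
  "multiplier g \<longleftrightarrow> continuous_on closed_strip g \<and> g holomorphic_on open_strip \<and>
     (\<exists>M. \<forall>z\<in>closed_strip. cmod (g z) \<le> M)"

lemma calf_mul:
  assumes "multiplier g" "calf F" shows "calf (mul g F)"
proof -
  note D = calfD[OF assms(2)]
  have g: "continuous_on closed_strip g" "g holomorphic_on open_strip"
    using assms by (auto simp: multiplier_def)
  obtain A where A: "\<And>z. z \<in> closed_strip \<Longrightarrow> cmod (g z) \<le> A"
    using assms by (auto simp: multiplier_def)
  obtain M where M: "\<And>z n. cmod (F z n) \<le> M" using D(2) by blast
  have "cmod (g (Complex 0 0)) \<le> A" "cmod (F 0 0) \<le> M" using A M by simp_all
  then have A0: "0 \<le> A" and M0: "0 \<le> M" using norm_ge_zero order_trans by blast+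
  have half: "a * (e / (2 * a)) = e / 2" if "a > 0" for a e :: real using that by simp
  have "cmod (mul g F z n) \<le> A * M" if "z \<in> closed_strip" for z n
    using A[OF that] M[of z n] A0 by (simp add: norm_mult mult_mono)
  then have "\<exists>M. \<forall>z\<in>closed_strip. \<forall>n. cmod (mul g F z n) \<le> M" by blast
  moreover have "\<forall>\<^sub>F w in at z within closed_strip. \<forall>n. cmod (mul g F w n - mul g F z n) \<le> e"
    if z: "z \<in> closed_strip" and e: "e > 0" for z e
  proof -
    have "e / (2 * (A + 1)) > 0" "e / (2 * (M + 1)) > 0" using e A0 M0 by auto
    note D(3)[OF z this(1)]
    moreover have "\<forall>\<^sub>F w in at z within closed_strip. dist (g w) (g z) < e / (2 * (M + 1))"
      using g(1) z \<open>e / (2 * (M + 1)) > 0\<close> by (auto simp: continuous_on dest: tendstoD)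
    moreover have "\<forall>\<^sub>F w in at z within closed_strip. w \<in> closed_strip"
      by (simp add: eventually_at_filter)
    ultimately show ?thesis
    proof eventually_elim
      case (elim w)
      show ?case
      proof
        fix n
        have F: "cmod (F w n - F z n) \<le> e / (2 * (A + 1))" using elim by blast
        have "mul g F w n - mul g F z n = g w * (F w n - F z n) + (g w - g z) * F z n"
          by (simp add: algebra_simps)
        then have "cmod (mul g F w n - mul g F z n) \<le> cmod (g w) * cmod (F w n - F z n) + cmod (g w - g z) * cmod (F z n)"
          by (metis norm_mult norm_triangle_ineq)
        also have "\<dots> \<le> (A + 1) * (e / (2 * (A + 1))) + e / (2 * (M + 1)) * (M + 1)"
          using F A[OF elim(3)] M[of z n] elim(2) A0 M0 e
          by (intro add_mono mult_mono) (auto simp: dist_norm intro: order_trans)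
        also have "\<dots> = e / 2 + e / 2" using half[of "A + 1" e] half[of "M + 1" e] A0 M0
          by (metis add_nonneg_pos mult.commute zero_less_one)
        also have "\<dots> = e" by simp
        finally show "cmod (mul g F w n - mul g F z n) \<le> e" .
      qed
    qed
  qed
  moreover have "\<forall>\<^sub>F t in at_infinity. \<forall>n. cmod (mul g F (Complex 0 t) n) \<le> e" if e: "e > 0" for e
  proof -
    have "e / (A + 1) > 0" using e A0 by auto
    from D(5)[OF this] show ?thesis
    proof eventually_elim
      case (elim t)
      show ?case
      proof
        fix n
        have "cmod (mul g F (Complex 0 t) n) \<le> (A + 1) * (e / (A + 1))"
          unfolding mul_apply norm_mult using A[of "Complex 0 t"] A0 elim by (intro mult_mono) auto
        also have "\<dots> = e" using A0 by simp
        finally show "cmod (mul g F (Complex 0 t) n) \<le> e" .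
      qed
    qed
  qed
  moreover have "((\<lambda>s. \<Sum>n. cmod (mul g F (Complex 1 s) n - mul g F (Complex 1 t) n)) \<longlongrightarrow> 0) (at t)" for t
  proof (rule tendsto_sandwich[OF _ _ tendsto_const])
    let ?b = "\<lambda>s. cmod (g (Complex 1 s)) * (\<Sum>n. cmod (F (Complex 1 s) n - F (Complex 1 t) n))
        + cmod (g (Complex 1 s) - g (Complex 1 t)) * (\<Sum>n. cmod (F (Complex 1 t) n))"
    have gt: "((\<lambda>s. g (Complex 1 s)) \<longlongrightarrow> g (Complex 1 t)) (at t)"
      by (rule tendsto_Complex) (use g in auto)
    have "(?b \<longlongrightarrow> cmod (g (Complex 1 t)) * 0 + cmod (g (Complex 1 t) - g (Complex 1 t)) * (\<Sum>n. cmod (F (Complex 1 t) n))) (at t)"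
      by (intro tendsto_intros gt D)
    then show "(?b \<longlongrightarrow> 0) (at t)" by simp
    have eq: "mul g F (Complex 1 s) n - mul g F (Complex 1 t) n =
        g (Complex 1 s) * (F (Complex 1 s) n - F (Complex 1 t) n) + (g (Complex 1 s) - g (Complex 1 t)) * F (Complex 1 t) n" for s n
      by (simp add: algebra_simps)
    have s: "summable (\<lambda>n. cmod (g (Complex 1 s) * (F (Complex 1 s) n - F (Complex 1 t) n)))"
       "summable (\<lambda>n. cmod ((g (Complex 1 s) - g (Complex 1 t)) * F (Complex 1 t) n))" for s
      by (intro l1_cmult l1_diff D)+
    have "(\<Sum>n. cmod (mul g F (Complex 1 s) n - mul g F (Complex 1 t) n)) \<le> ?b s" for s
      unfolding eq using l1_add(2)[OF s] l1_cmult[OF l1_diff(1)[OF D(6) D(6)]] l1_cmult[OF D(6)] by simp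
    then show "\<forall>\<^sub>F s in at t. (\<Sum>n. cmod (mul g F (Complex 1 s) n - mul g F (Complex 1 t) n)) \<le> ?b s"
      by simp
    show "\<forall>\<^sub>F s in at t. 0 \<le> (\<Sum>n. cmod (mul g F (Complex 1 s) n - mul g F (Complex 1 t) n))"
      unfolding eq by (intro always_eventually allI suminf_nonneg l1_add s) simp
  qed
  moreover have "((\<lambda>t. \<Sum>n. cmod (mul g F (Complex 1 t) n)) \<longlongrightarrow> 0) at_infinity"
  proof (rule tendsto_sandwich[OF _ _ tendsto_const])
    show "((\<lambda>t. A * (\<Sum>n. cmod (F (Complex 1 t) n))) \<longlongrightarrow> 0) at_infinity"
      using tendsto_mult_left[OF D(8), of A] by simp
    show "\<forall>\<^sub>F t in at_infinity. (\<Sum>n. cmod (mul g F (Complex 1 t) n)) \<le> A * (\<Sum>n. cmod (F (Complex 1 t) n))"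
      using A by (intro always_eventually) (auto simp: l1_cmult D suminf_nonneg intro!: mult_right_mono)
  qed (auto intro!: always_eventually suminf_nonneg l1_cmult D)
  ultimately show ?thesis
    unfolding calf_def using D g l1_cmult(1)[OF D(6)]
    by (auto intro!: holomorphic_intros)
qed

definition restr :: "nat set \<Rightarrow> (complex \<Rightarrow> cseq) \<Rightarrow> complex \<Rightarrow> cseq" where
  "restr A F = (\<lambda>z n. if n \<in> A then F z n else 0)"

lemma restr_apply [simp]: "restr A F z n = (if n \<in> A then F z n else 0)"
  by (simp add: restr_def)

lemma l1_restrict:
  fixes x :: cseq
  assumes "summable (\<lambda>n. cmod (x n))"
  shows "summable (\<lambda>n. cmod (if n \<in> A then x n else 0))"
    "(\<Sum>n. cmod (if n \<in> A then x n else 0)) \<le> (\<Sum>n. cmod (x n))"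
proof -
  show s: "summable (\<lambda>n. cmod (if n \<in> A then x n else 0))"
    by (rule summable_comparison_test'[OF assms, of 0]) simp
  show "(\<Sum>n. cmod (if n \<in> A then x n else 0)) \<le> (\<Sum>n. cmod (x n))"
    by (intro suminf_le s assms) simp
qed

lemma calf_restr:
  assumes "calf F" shows "calf (restr A F)"
proof -
  note D = calfD[OF assms]
  obtain M where M: "\<And>z n. cmod (F z n) \<le> M" using D(2) by blast
  have M0: "0 \<le> M" using M[of 0 0] norm_ge_zero order_trans by blast
  have eq: "restr A F w n - restr A F z n = (if n \<in> A then F w n - F z n else 0)" for w z n by simp
  have "cmod (restr A F z n) \<le> M" for z n
    using M M0 by simp
  then have "\<exists>M. \<forall>z\<in>closed_strip. \<forall>n. cmod (restr A F z n) \<le> M" by blast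
  moreover have "\<forall>\<^sub>F w in at z within closed_strip. \<forall>n. cmod (restr A F w n - restr A F z n) \<le> e"
    if z: "z \<in> closed_strip" and e: "e > 0" for z e
    using D(3)[OF z e] by eventually_elim (use e in auto)
  moreover have "\<forall>\<^sub>F t in at_infinity. \<forall>n. cmod (restr A F (Complex 0 t) n) \<le> e" if e: "e > 0" for e
    using D(5)[OF e] by eventually_elim (use e in auto)
  moreover have "((\<lambda>s. \<Sum>n. cmod (restr A F (Complex 1 s) n - restr A F (Complex 1 t) n)) \<longlongrightarrow> 0) (at t)" for t
    unfolding eq
    by (rule tendsto_sandwich[OF _ _ tendsto_const D(7)[of t]]; intro always_eventually allI suminf_nonneg l1_restrict l1_diff D) simp
  moreover have "((\<lambda>t. \<Sum>n. cmod (restr A F (Complex 1 t) n)) \<longlongrightarrow> 0) at_infinity"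
    unfolding restr_apply
    by (rule tendsto_sandwich[OF _ _ tendsto_const D(8)]; intro always_eventually allI suminf_nonneg l1_restrict D) simp
  moreover have "(\<lambda>z. restr A F z n) holomorphic_on open_strip" for n
    using D(4) by (cases "n \<in> A") auto
  ultimately show ?thesis
    unfolding calf_def using D(1) l1_restrict(1)[OF D(6)] by auto
qed

lemma cN_restr: assumes "calf F" shows "cN (restr A F) \<le> cN F"
proof (rule cN_leI)
  show "cmod (restr A F (Complex 0 t) n) \<le> cN F" for t n
    using cN_side0[OF assms] cN_nonneg[OF assms] by simp
  show "(\<Sum>n. cmod (restr A F (Complex 1 t) n)) \<le> cN F" for t
    using l1_restrict(2)[OF calfD(6)[OF assms]] cN_side1[OF assms] order_trans
    unfolding restr_apply by blast
qed

lemma cN_add: assumes "calf F" "calf G" shows "cN (F + G) \<le> cN F + cN G"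
proof (rule cN_leI)
  show "cmod ((F + G) (Complex 0 t) n) \<le> cN F + cN G" for t n
    using cN_side0[OF assms(1), of t n] cN_side0[OF assms(2), of t n] by (simp add: norm_triangle_le add_mono)
  show "(\<Sum>n. cmod ((F + G) (Complex 1 t) n)) \<le> cN F + cN G" for t
    using l1_add(2)[OF calfD(6)[OF assms(1)] calfD(6)[OF assms(2)], of t t] cN_side1[OF assms(1), of t]
      cN_side1[OF assms(2), of t] by simp
qed

text \<open>The two boundary lines enter separately, so that a multiplier which is large on one and
  small on the other can balance unequal boundary norms.\<close>

lemma cN_mul:
  assumes "calf F" "\<And>t. cmod (g (Complex 0 t)) \<le> a" "\<And>t. cmod (g (Complex 1 t)) \<le> b"
    "\<And>t n. a * cmod (F (Complex 0 t) n) \<le> K" "\<And>t. b * (\<Sum>n. cmod (F (Complex 1 t) n)) \<le> K"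
  shows "cN (mul g F) \<le> K"
proof (rule cN_leI)
  show "cmod (mul g F (Complex 0 t) n) \<le> K" for t n
    using mult_right_mono[OF assms(2)[of t], of "cmod (F (Complex 0 t) n)"] assms(4)[of t n]
    by (simp add: norm_mult)
  show "(\<Sum>n. cmod (mul g F (Complex 1 t) n)) \<le> K" for t
  proof -
    have "(\<Sum>n. cmod (mul g F (Complex 1 t) n)) = cmod (g (Complex 1 t)) * (\<Sum>n. cmod (F (Complex 1 t) n))"
      using l1_cmult(2)[OF calfD(6)[OF assms(1)]] by simp
    also have "\<dots> \<le> b * (\<Sum>n. cmod (F (Complex 1 t) n))"
      using assms(3) by (intro mult_right_mono suminf_nonneg calfD(6)[OF assms(1)]) auto
    finally show ?thesis using assms(5)[of t] by linarith
  qed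
qed

lemma cN_mul_le:
  assumes "calf F" "\<And>t. cmod (g (Complex 0 t)) \<le> a" "\<And>t. cmod (g (Complex 1 t)) \<le> a"
  shows "cN (mul g F) \<le> a * cN F"
proof -
  have "0 \<le> a" using assms(2)[of 0] norm_ge_zero order_trans by blast
  then show ?thesis
    by (intro cN_mul[of F g a a] assms mult_left_mono cN_side0 cN_side1)
qed

section \<open>Functions with finitely many coordinates\<close>

lemma calf_single:
  assumes "\<And>z. z \<notin> closed_strip \<Longrightarrow> f z = 0" "continuous_on closed_strip f"
    "f holomorphic_on open_strip" "\<And>z. z \<in> closed_strip \<Longrightarrow> cmod (f z) \<le> M"
    "((\<lambda>t. f (Complex 0 t)) \<longlongrightarrow> 0) at_infinity" "((\<lambda>t. f (Complex 1 t)) \<longlongrightarrow> 0) at_infinity"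
  shows "calf (\<lambda>z n. if n = k then f z else 0)"
proof -
  have "cmod (f (Complex 0 0)) \<le> M" using assms(4) by simp
  then have M0: "0 \<le> M" using norm_ge_zero order_trans by blast
  have sm: "(\<lambda>n. cmod (if n = k then c else 0)) sums cmod c" for c :: complex
    using sums_single[of k "\<lambda>_. cmod c"] by (simp add: if_distrib cong: if_cong)
  have diff: "(if n = k then a else 0) - (if n = k then b else 0) = (if n = k then a - b else 0)"
    for n and a b :: complex by simp
  have "\<forall>\<^sub>F w in at z within closed_strip. \<forall>n. cmod ((if n = k then f w else 0) - (if n = k then f z else 0)) \<le> e"
    if "z \<in> closed_strip" "e > 0" for z e
  proof -
    have "\<forall>\<^sub>F w in at z within closed_strip. dist (f w) (f z) < e"
      using assms(2) that by (auto simp: continuous_on dest: tendstoD)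
    then show ?thesis by eventually_elim (use that in \<open>auto simp: dist_norm\<close>)
  qed
  moreover have "\<forall>\<^sub>F t in at_infinity. \<forall>n. cmod (if n = k then f (Complex 0 t) else 0) \<le> e" if "e > 0" for e
    using tendstoD[OF assms(5) that] by eventually_elim (use that in auto)
  moreover have "((\<lambda>s. cmod (f (Complex 1 s) - f (Complex 1 t))) \<longlongrightarrow> 0) (at t)" for t
  proof -
    have "((\<lambda>s. f (Complex 1 s)) \<longlongrightarrow> f (Complex 1 t)) (at t)"
      by (rule tendsto_Complex) (use assms in auto)
    then show ?thesis using tendsto_norm_zero LIM_zero by blast
  qed
  moreover have "((\<lambda>t. cmod (f (Complex 1 t))) \<longlongrightarrow> 0) at_infinity"
    using assms(6) tendsto_norm_zero by blast
  moreover have "\<exists>M. \<forall>z\<in>closed_strip. \<forall>n. cmod (if n = k then f z else 0) \<le> M"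
    using assms(4) M0 by (intro exI[of _ M]) auto
  moreover have "(\<lambda>z. if n = k then f z else 0) holomorphic_on open_strip" for n
    using assms(3) by (cases "n = k") auto
  ultimately show ?thesis
    unfolding calf_def diff sm[THEN sums_unique, symmetric] using assms(1) sm[THEN sums_summable] by auto
qed

lemma calf_0: "calf 0"
  using calf_single[of "\<lambda>_. 0" 0 0] by (simp add: zero_fun_def)

text \<open>With finitely many coordinates all uniformity in \<open>n\<close> is automatic. Both
  functions built by hand, the lift and the quotient by \<open>phi\<close>, are placed in the
  Calderon space this way.\<close>

lemma calf_finite:
  assumes "finite A" "\<And>z n. n \<notin> A \<Longrightarrow> F z n = 0"
    "\<And>z n. z \<notin> closed_strip \<Longrightarrow> F z n = 0" "\<And>n. n \<in> A \<Longrightarrow> continuous_on closed_strip (\<lambda>z. F z n)"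
    "\<And>n. n \<in> A \<Longrightarrow> (\<lambda>z. F z n) holomorphic_on open_strip"
    "\<And>n. n \<in> A \<Longrightarrow> \<exists>M. \<forall>z\<in>closed_strip. cmod (F z n) \<le> M"
    "\<And>n. n \<in> A \<Longrightarrow> ((\<lambda>t. F (Complex 0 t) n) \<longlongrightarrow> 0) at_infinity"
    "\<And>n. n \<in> A \<Longrightarrow> ((\<lambda>t. F (Complex 1 t) n) \<longlongrightarrow> 0) at_infinity"
  shows "calf F"
proof -
  have "calf (restr B F)" if "finite B" "B \<subseteq> A" for B
    using that
  proof (induction B)
    case empty
    have "restr {} F = 0" by (auto simp: fun_eq_iff)
    then show ?case using calf_0 by metis
  next
    case (insert k B)
    have "restr (insert k B) F = restr B F + (\<lambda>z n. if n = k then F z k else 0)"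
      using insert.hyps by (auto simp: fun_eq_iff)
    moreover have "calf (\<lambda>z n. if n = k then F z k else 0)"
    proof -
      have k: "k \<in> A" using insert.prems by simp
      obtain M where "\<And>z. z \<in> closed_strip \<Longrightarrow> cmod (F z k) \<le> M" using assms(6)[OF k] by blast
      then show ?thesis using k assms by (intro calf_single[of _ M]) auto
    qed
    moreover have "calf (restr B F)" using insert.IH insert.prems by (metis insert_subset)
    ultimately show ?case using calf_add by metis
  qed
  moreover have "restr A F = F" using assms(2) by (auto simp: fun_eq_iff)
  ultimately show ?thesis using assms(1) by (metis order_refl)
qed

section \<open>Taylor coefficients\<close>

definition sjet :: "nat \<Rightarrow> (complex \<Rightarrow> complex) \<Rightarrow> complex" where
  "sjet k f = (deriv ^^ k) f (1/2) / fact k"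

definition jet :: "nat \<Rightarrow> (complex \<Rightarrow> cseq) \<Rightarrow> cseq" where
  "jet k F = (\<lambda>n. sjet k (\<lambda>z. F z n))"

lemma sjet_0 [simp]: "sjet 0 f = f (1/2)"
  by (simp add: sjet_def)

lemma jet_0 [simp]: "jet 0 F = F (1/2)"
  by (simp add: jet_def)

lemma sjet_add:
  assumes "f holomorphic_on open_strip" "g holomorphic_on open_strip"
  shows "sjet k (\<lambda>z. f z + g z) = sjet k f + sjet k g"
  using higher_deriv_add[OF assms open_open_strip half_in_open_strip]
  by (simp add: sjet_def add_divide_distrib)

lemma sjet_const_0 [simp]: "sjet k (\<lambda>z. 0) = 0"
  by (induction k) (simp_all add: sjet_def)

lemma sjet_sum:
  assumes "finite B" "\<And>n. n \<in> B \<Longrightarrow> f n holomorphic_on open_strip"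
  shows "sjet k (\<lambda>z. \<Sum>n\<in>B. f n z) = (\<Sum>n\<in>B. sjet k (f n))"
  using assms
proof (induction B)
  case (insert a B)
  then have "sjet k (\<lambda>z. f a z + (\<Sum>n\<in>B. f n z)) = sjet k (f a) + sjet k (\<lambda>z. \<Sum>n\<in>B. f n z)"
    by (intro sjet_add holomorphic_intros) auto
  with insert show ?case by simp
qed simp

lemma sjet_mult:
  assumes "f holomorphic_on open_strip" "g holomorphic_on open_strip"
  shows "sjet k (\<lambda>z. f z * g z) = (\<Sum>i=0..k. sjet i f * sjet (k - i) g)"
proof -
  have "sjet k (\<lambda>z. f z * g z) =
      (\<Sum>i=0..k. of_nat (k choose i) * (deriv ^^ i) f (1/2) * (deriv ^^ (k - i)) g (1/2)) / fact k"
    using higher_deriv_mult[OF assms open_open_strip half_in_open_strip] by (simp add: sjet_def)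
  also have "\<dots> = (\<Sum>i=0..k. sjet i f * sjet (k - i) g)"
    unfolding sum_divide_distrib
  proof (rule sum.cong)
    fix i assume "i \<in> {0..k}"
    then have "of_nat (k choose i) = (fact k / (fact i * fact (k - i)) :: complex)"
      by (intro binomial_fact) simp
    then show "of_nat (k choose i) * (deriv ^^ i) f (1/2) * (deriv ^^ (k - i)) g (1/2) / fact k
       = sjet i f * sjet (k - i) g"
      by (simp add: sjet_def)
  qed simp
  finally show ?thesis .
qed

lemma sjet_1_2:
  assumes "\<And>z. z \<in> open_strip \<Longrightarrow> (g has_field_derivative g1 z) (at z)"
    and "(g1 has_field_derivative g2) (at (1/2))"
  shows "sjet (Suc 0) g = g1 (1/2)" "sjet (Suc (Suc 0)) g = g2 / 2" "sjet 2 g = g2 / 2"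
proof -
  have d: "deriv g z = g1 z" if "z \<in> open_strip" for z using assms(1)[OF that] by (rule DERIV_imp_deriv)
  then show "sjet (Suc 0) g = g1 (1/2)" by (simp add: sjet_def)
  have "deriv (deriv g) (1/2) = deriv g1 (1/2)"
    using d eventually_nhds_in_open[OF open_open_strip half_in_open_strip]
    by (intro deriv_cong_ev) (auto elim: eventually_mono)
  then show "sjet (Suc (Suc 0)) g = g2 / 2" using DERIV_imp_deriv[OF assms(2)] by (simp add: sjet_def)
  then show "sjet 2 g = g2 / 2" by (simp add: numeral_2_eq_2)
qed

lemma jet_add:
  assumes "calf F" "calf G" shows "jet k (F + G) = jet k F + jet k G"
  using sjet_add[OF calfD(4)[OF assms(1)] calfD(4)[OF assms(2)]] by (simp add: jet_def fun_eq_iff)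

lemma jet_mul:
  assumes "multiplier g" "calf F"
  shows "jet k (mul g F) n = (\<Sum>i=0..k. sjet i g * jet (k - i) F n)"
  using sjet_mult[OF _ calfD(4)[OF assms(2)], of g k n] assms(1) by (simp add: jet_def multiplier_def)

lemma jet_restr: "jet k (restr A F) n = (if n \<in> A then jet k F n else 0)"
  by (simp add: jet_def)

lemma multiplier_const [simp]: "multiplier (\<lambda>z. c)"
  by (auto simp: multiplier_def)

lemma sjet_const: "k > 0 \<Longrightarrow> sjet k (\<lambda>z. c) = 0"
proof (induction k)
  case (Suc k)
  have "(deriv ^^ Suc k) (\<lambda>z. c) = (deriv ^^ k) (\<lambda>z. 0)" by (simp add: funpow_swap1)
  also have "\<dots> = (\<lambda>z. 0)" by (induction k) simp_all
  finally show ?case by (simp add: sjet_def)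
qed simp

lemma jet_cmult:
  assumes "calf F" shows "jet k (mul (\<lambda>z. c) F) n = c * jet k F n"
proof -
  have "jet k (mul (\<lambda>z. c) F) n = (\<Sum>i=0..k. sjet i (\<lambda>z. c) * jet (k - i) F n)"
    by (rule jet_mul) (use assms in auto)
  also have "\<dots> = (\<Sum>i\<in>{0}. sjet i (\<lambda>z. c) * jet (k - i) F n)"
    by (intro sum.mono_neutral_right) (auto simp: sjet_const)
  finally show ?thesis by simp
qed

section \<open>Norm derivatives and coordinatewise Taylor coefficients\<close>

lemma cderiv_Sigma_eq:
  assumes "open U" "z \<in> U" "\<And>w. w \<in> U \<Longrightarrow> bounded (range (F w))" "has_cderiv Sigma_space F D z"
  shows "cderiv Sigma_space F z = D"
  unfolding cderiv_def
proof (rule the_equality)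
  fix D' assume "has_cderiv Sigma_space F D' z"
  then have "((\<lambda>w. F w n) has_field_derivative D' n) (at z)" for n
    using has_cderiv_coord[of U z F D' n] assms(1-3) by metis
  moreover have "((\<lambda>w. F w n) has_field_derivative D n) (at z)" for n
    using has_cderiv_coord[of U z F D n] assms by metis
  ultimately show "D' = D" using DERIV_unique by blast
qed (rule assms(4))

lemma cderiv_calf:
  assumes "calf F" "z \<in> open_strip"
  shows "cderiv Sigma_space F z = (\<lambda>n. deriv (\<lambda>w. F w n) z)"
proof -
  obtain D where D: "has_cderiv Sigma_space F D z"
    using assms carr_calderon mem_calderon_iff by (metis mem_Collect_eq)
  have "cderiv Sigma_space F z = D"
    by (rule cderiv_Sigma_eq[OF open_open_strip assms(2) calf_bounded[OF assms(1)] D])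
  moreover have "D = (\<lambda>n. deriv (\<lambda>w. F w n) z)"
    using has_cderiv_coord[OF open_open_strip assms(2) calf_bounded[OF assms(1)] D]
    by (auto intro: DERIV_imp_deriv[symmetric])
  ultimately show ?thesis by simp
qed

text \<open>The first derivative is handled only near \<open>1/2\<close>: on the ball of radius
  \<open>1/8\<close> Cauchy's inequality bounds all its coordinates by \<open>8 * M\<close>, so
  \<open>has_cderiv_holomorphic\<close> applies a second time.\<close>

lemma cderiv_cderiv_calf:
  assumes "calf F"
  shows "cderiv Sigma_space (cderiv Sigma_space F) (1/2) = (\<lambda>n. deriv (deriv (\<lambda>w. F w n)) (1/2))"
proof -
  let ?G = "cderiv Sigma_space F"
  let ?U = "ball (1/2) (1/8) :: complex set"
  obtain M where M: "\<And>z n. cmod (F z n) \<le> M" using calfD(2)[OF assms] by blast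
  have sub: "cball w (1/8) \<subseteq> open_strip" if "w \<in> ?U" for w
  proof -
    have "cball w (1/8) \<subseteq> cball (1/2) (1/4)"
    proof
      fix v assume "v \<in> cball w (1/8)"
      then show "v \<in> cball (1/2) (1/4)" using that dist_triangle[of "1/2" v w] by auto
    qed
    then show ?thesis using cball_half_subset by blast
  qed
  have G: "?G w n = deriv (\<lambda>w. F w n) w" if "w \<in> ?U" for w n
  proof -
    have "w \<in> open_strip" using sub[OF that] by auto
    then show ?thesis using cderiv_calf[OF assms] by simp
  qed
  have hol: "(\<lambda>w. F w n) holomorphic_on open_strip" for n using calfD(4)[OF assms] .
  have U: "?U \<subseteq> open_strip" using cball_half_subset by (auto simp: subset_iff)
  have bd: "cmod (?G w n) \<le> 8 * M" if "w \<in> ?U" for w n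
  proof -
    have "cmod ((deriv ^^ 1) (\<lambda>w. F w n) w) \<le> fact 1 * M / (1/8)^1"
    proof (rule Cauchy_inequality)
      show "(\<lambda>w. F w n) holomorphic_on ball w (1/8)"
        using sub[OF that] ball_subset_cball hol holomorphic_on_subset by blast
      show "continuous_on (cball w (1/8)) (\<lambda>w. F w n)"
        using sub[OF that] hol holomorphic_on_imp_continuous_on continuous_on_subset by blast
    qed (use M in auto)
    then show ?thesis using G[OF that] by simp
  qed
  have "has_cderiv Sigma_space ?G (\<lambda>n. deriv (\<lambda>w. ?G w n) (1/2)) (1/2)"
  proof (rule has_cderiv_holomorphic[where r = "1/8" and M = "8 * M"])
    show "(\<lambda>w. ?G w n) holomorphic_on ?U" for n
    proof (rule holomorphic_transform)
      show "deriv (\<lambda>w. F w n) holomorphic_on ?U"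
        using holomorphic_deriv[OF hol open_open_strip] U holomorphic_on_subset by blast
    qed (simp add: G)
  qed (use bd in auto)
  moreover have "bounded (range (?G w))" if "w \<in> ?U" for w
    using bd[OF that] by (force simp: bounded_iff)
  ultimately have "cderiv Sigma_space ?G (1/2) = (\<lambda>n. deriv (\<lambda>w. ?G w n) (1/2))"
    by (intro cderiv_Sigma_eq[of ?U]) auto
  moreover have "deriv (\<lambda>w. ?G w n) (1/2) = deriv (deriv (\<lambda>w. F w n)) (1/2)" for n
  proof (rule deriv_cong_ev)
    have "\<forall>\<^sub>F w in nhds (1/2). w \<in> ?U" by (intro eventually_nhds_in_open) auto
    then show "\<forall>\<^sub>F w in nhds (1/2). ?G w n = deriv (\<lambda>w. F w n) w"
      by eventually_elim (simp add: G)
  qed simp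
  ultimately show ?thesis by simp
qed

lemma Delta_eq_jet:
  assumes "calf F"
  shows "\<Delta> 0 F = jet 0 F" "\<Delta> 1 F = jet 1 F" "\<Delta> 2 F = jet 2 F"
  using cderiv_calf[OF assms half_in_open_strip] cderiv_cderiv_calf[OF assms]
  by (simp_all add: \<Delta>_def jet_def sjet_def numeral_2_eq_2)

section \<open>The three lines theorem\<close>

text \<open>The factor \<open>exp (e * (z\<^sup>2 - 1))\<close> has modulus at most
  \<open>exp (- e * (Im z)\<^sup>2)\<close> on the strip. It makes the horizontal edges of a tall
  rectangle negligible, so the maximum modulus principle applies there; then \<open>e\<close> tends
  to 0.\<close>

lemma three_lines:
  assumes cont: "continuous_on closed_strip f" and hol: "f holomorphic_on open_strip"
    and bd: "\<And>z. z \<in> closed_strip \<Longrightarrow> cmod (f z) \<le> M"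
    and K: "\<And>t. cmod (f (Complex 0 t)) \<le> K" "\<And>t. cmod (f (Complex 1 t)) \<le> K"
    and z: "z \<in> closed_strip"
  shows "cmod (f z) \<le> K"
proof -
  have M0: "0 \<le> M" using bd[OF z] norm_ge_zero order_trans by blast
  have K0: "0 \<le> K" using K(1)[of 0] norm_ge_zero order_trans by blast
  define h where "h = (\<lambda>e z. f z * exp (of_real e * (z\<^sup>2 - 1)))"
  have nexp: "cmod (exp (of_real e * (w\<^sup>2 - 1))) = exp (e * ((Re w)\<^sup>2 - (Im w)\<^sup>2 - 1))" for e w
    by (simp add: norm_exp_eq_Re power2_eq_square)
  have nexp_le: "cmod (exp (of_real e * (w\<^sup>2 - 1))) \<le> exp (- e * (Im w)\<^sup>2)"
    if "w \<in> closed_strip" "e > 0" for e w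
  proof -
    have "(Re w)\<^sup>2 \<le> 1" using that by (simp add: closed_strip_def power_le_one)
    then have "e * ((Re w)\<^sup>2 - (Im w)\<^sup>2 - 1) \<le> e * (- (Im w)\<^sup>2)" using that by (intro mult_left_mono) auto
    then show ?thesis unfolding nexp by simp
  qed
  have h: "cmod (h e z) \<le> K" if e: "e > 0" for e
  proof (rule field_le_epsilon)
    fix d :: real assume d: "d > 0"
    have "((\<lambda>R. M * exp (- e * R\<^sup>2)) \<longlongrightarrow> 0) at_top" using e by real_asymp
    then have "\<forall>\<^sub>F R in at_top. dist (M * exp (- e * R\<^sup>2)) 0 < d" using d by (rule tendstoD)
    then have "\<forall>\<^sub>F R in at_top. R > \<bar>Im z\<bar> \<and> M * exp (- e * R\<^sup>2) < d"
      using eventually_gt_at_top[of "\<bar>Im z\<bar>"] by eventually_elim (simp add: dist_real_def)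
    then obtain R where R: "R > \<bar>Im z\<bar>" "M * exp (- e * R\<^sup>2) < d"
      using eventually_happens[of _ "at_top :: real filter"] by auto
    define S where "S = cbox (Complex 0 (- R)) (Complex 1 R)"
    have S: "S \<subseteq> closed_strip" by (auto simp: S_def in_cbox_complex_iff closed_strip_def)
    show "cmod (h e z) \<le> K + d"
    proof (rule maximum_modulus_frontier[of "h e" S])
      have "interior S \<subseteq> open_strip"
        unfolding S_def interior_cbox by (auto simp: in_box_complex_iff open_strip_def)
      then show "h e holomorphic_on interior S"
        unfolding h_def by (intro holomorphic_intros holomorphic_on_subset[OF hol])
      have "closure S \<subseteq> closed_strip" using S by (simp add: S_def)
      then show "continuous_on (closure S) (h e)"
        unfolding h_def by (intro continuous_intros continuous_on_subset[OF cont])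
      show "bounded S" by (simp add: S_def)
      show "z \<in> S" using z R by (auto simp: S_def in_cbox_complex_iff closed_strip_def)
      fix w assume w: "w \<in> frontier S"
      then have "w \<in> S" by (simp add: S_def frontier_cbox)
      then have ws: "w \<in> closed_strip" using S by blast
      consider "Re w = 0" | "Re w = 1" | "\<bar>Im w\<bar> = R"
        using w by (force simp: S_def frontier_cbox in_cbox_complex_iff in_box_complex_iff)
      then show "cmod (h e w) \<le> K + d"
      proof cases
        case 3
        have "cmod (h e w) \<le> M * exp (- e * (Im w)\<^sup>2)"
          unfolding h_def norm_mult by (intro mult_mono bd ws nexp_le e M0) auto
        also have "(Im w)\<^sup>2 = R\<^sup>2" using 3 by auto
        finally show ?thesis using R K0 by simp
      next
        case 1
        then have "w = Complex 0 (Im w)" by (simp add: complex_eq_iff)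
        then have "cmod (f w) \<le> K" using K(1) by metis
        then have "cmod (h e w) \<le> K * exp (- e * (Im w)\<^sup>2)"
          unfolding h_def norm_mult by (intro mult_mono ws nexp_le e K0) auto
        also have "\<dots> \<le> K * 1" using K0 e by (intro mult_left_mono) auto
        finally show ?thesis using d by simp
      next
        case 2
        then have "w = Complex 1 (Im w)" by (simp add: complex_eq_iff)
        then have "cmod (f w) \<le> K" using K(2) by metis
        then have "cmod (h e w) \<le> K * exp (- e * (Im w)\<^sup>2)"
          unfolding h_def norm_mult by (intro mult_mono ws nexp_le e K0) auto
        also have "\<dots> \<le> K * 1" using K0 e by (intro mult_left_mono) auto
        finally show ?thesis using d by simp
      qed
    qed
  qed
  have "((\<lambda>e. cmod (h e z)) \<longlongrightarrow> cmod (f z * exp (of_real 0 * (z\<^sup>2 - 1)))) (at_right 0)"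
    unfolding h_def by (intro tendsto_intros)
  then have "((\<lambda>e. cmod (h e z)) \<longlongrightarrow> cmod (f z)) (at_right 0)" by simp
  then show ?thesis
    by (rule tendsto_upperbound) (use h in \<open>auto simp: eventually_at_right_less eventually_at_filter\<close>)
qed

text \<open>Testing against the extremal function of \<open>\<ell>\<^sub>2\<close> in the dual couple
  \<open>(\<ell>\<^sub>1, \<ell>\<^sub>\<infinity>)\<close>.\<close>

lemma jet_l2_bound:
  assumes G: "calf G" and A: "finite A" and low: "\<And>i n. i < k \<Longrightarrow> jet i G n = 0"
  shows "sqrt (\<Sum>n\<in>A. (cmod (jet k G n))\<^sup>2) \<le> 4 ^ k * cN G"
proof -
  define x where "x = jet k G"
  define s where "s = sqrt (\<Sum>n\<in>A. (cmod (x n))\<^sup>2)"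
  define B where "B = {n \<in> A. x n \<noteq> 0}"
  define r where "r = (\<lambda>n. cmod (x n) / s)"
  \<comment> \<open>\<open>y\<close> has modulus \<open>r n\<close> to the power
    \<open>2 - 2 * Re z\<close>. On \<open>Re z = 0\<close> these moduli are
    \<open>(r n)\<^sup>2\<close> and sum to 1, on \<open>Re z = 1\<close> they equal 1, and at
    \<open>1/2\<close> one gets the functional norming \<open>x\<close> in
    \<open>\<ell>\<^sub>2\<close>.\<close>
  define y where "y = (\<lambda>n (z :: complex). cnj (x n) / of_real (cmod (x n)) * exp ((2 - 2 * z) * of_real (ln (r n))))"
  define H where "H = (\<lambda>z. \<Sum>n\<in>B. y n z * G z n)"
  have finB: "finite B" using A by (simp add: B_def)
  have sB: "(\<Sum>n\<in>B. (cmod (x n))\<^sup>2) = (\<Sum>n\<in>A. (cmod (x n))\<^sup>2)"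
    by (rule sum.mono_neutral_left) (use A in \<open>auto simp: B_def\<close>)
  show ?thesis
  proof (cases "s = 0")
    case True
    then show ?thesis using cN_nonneg[OF G] by (simp add: s_def x_def)
  next
    case False
    have s0: "s > 0" using False by (simp add: s_def sum_nonneg less_le)
    have s2: "(\<Sum>n\<in>B. (cmod (x n))\<^sup>2) = s\<^sup>2" unfolding sB by (simp add: s_def sum_nonneg)
    have r0: "r n > 0" if "n \<in> B" for n using that s0 by (simp add: r_def B_def)
    have r1: "r n \<le> 1" if "n \<in> B" for n
    proof -
      have "(cmod (x n))\<^sup>2 \<le> (\<Sum>n\<in>B. (cmod (x n))\<^sup>2)" using that finB by (intro member_le_sum) auto
      then have "cmod (x n) \<le> s" unfolding s2 using s0 by (simp add: power2_le_iff_abs_le)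
      then show ?thesis using s0 by (simp add: r_def)
    qed
    have ny: "cmod (y n z) = exp ((2 - 2 * Re z) * ln (r n))" if "n \<in> B" for n z
      using that by (simp add: y_def norm_mult norm_divide B_def norm_exp_eq_Re)
    have ny1: "cmod (y n z) \<le> 1" if "n \<in> B" "z \<in> closed_strip" for n z
    proof -
      have "ln (r n) \<le> 0" using r0[OF that(1)] r1[OF that(1)] by simp
      then show ?thesis unfolding ny[OF that(1)] using that(2) by (simp add: closed_strip_def mult_nonneg_nonpos)
    qed
    obtain M where M: "\<And>z n. cmod (G z n) \<le> M" using calfD(2)[OF G] by blast
    have holy: "y n holomorphic_on open_strip" for n unfolding y_def by (intro holomorphic_intros)
    have holH: "H holomorphic_on open_strip"
      unfolding H_def by (intro holomorphic_intros calfD(4)[OF G] holy)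
    have le: "cmod (H z) \<le> cN G" if "z \<in> closed_strip" for z
    proof (rule three_lines[where f = H and M = "\<Sum>n\<in>B. M"])
      show "continuous_on closed_strip H"
        unfolding H_def y_def by (intro continuous_intros calf_continuous[OF G])
      show "cmod (H z) \<le> (\<Sum>n\<in>B. M)" if "z \<in> closed_strip" for z
      proof -
        have "cmod (y n z * G z n) \<le> M" if "n \<in> B" for n
          using mult_mono[OF ny1[OF that \<open>z \<in> closed_strip\<close>] M[of z n]] by (simp add: norm_mult)
        then show ?thesis unfolding H_def by (intro sum_norm_le)
      qed
      show "cmod (H (Complex 0 t)) \<le> cN G" for t
      proof -
        have "cmod (H (Complex 0 t)) \<le> (\<Sum>n\<in>B. (r n)\<^sup>2 * cN G)"
          unfolding H_def
        proof (rule sum_norm_le)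
          fix n assume n: "n \<in> B"
          have "cmod (y n (Complex 0 t)) = (r n)\<^sup>2"
            using ny[OF n] r0[OF n] by (simp add: exp_double power2_eq_square)
          then show "cmod (y n (Complex 0 t) * G (Complex 0 t) n) \<le> (r n)\<^sup>2 * cN G"
            using cN_side0[OF G, of t n] by (simp add: norm_mult mult_left_mono)
        qed
        also have "\<dots> = (\<Sum>n\<in>B. (cmod (x n))\<^sup>2) / s\<^sup>2 * cN G"
          by (simp add: r_def power_divide sum_distrib_right sum_divide_distrib)
        also have "\<dots> = cN G" unfolding s2 using s0 by simp
        finally show ?thesis .
      qed
      show "cmod (H (Complex 1 t)) \<le> cN G" for t
      proof -
        have "cmod (H (Complex 1 t)) \<le> (\<Sum>n\<in>B. cmod (G (Complex 1 t) n))"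
          unfolding H_def
          by (rule sum_norm_le) (simp add: norm_mult ny)
        also have "\<dots> \<le> (\<Sum>n. cmod (G (Complex 1 t) n))"
          by (intro sum_le_suminf calfD(6)[OF G] finB) auto
        also have "\<dots> \<le> cN G" by (rule cN_side1[OF G])
        finally show ?thesis .
      qed
    qed (use holH that in auto)
    \<comment> \<open>The radius \<open>1/4\<close> keeps the disc inside the strip and is the
      origin of \<open>4 ^ k\<close>.\<close>
    have "cmod ((deriv ^^ k) H (1/2)) \<le> fact k * cN G / (1/4)^k"
    proof (rule Cauchy_inequality)
      show "H holomorphic_on ball (1/2) (1/4)"
        using cball_half_subset ball_subset_cball holH holomorphic_on_subset by (metis subset_trans)
      show "continuous_on (cball (1/2) (1/4)) H"
        using cball_half_subset holH holomorphic_on_imp_continuous_on continuous_on_subset by blast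
      show "cmod (H w) \<le> cN G" if "cmod (1/2 - w) = 1/4" for w
        using that cball_half_subset open_strip_subset by (intro le) (auto simp: dist_norm subset_iff)
    qed simp
    then have "cmod (sjet k H) \<le> 4 ^ k * cN G"
      by (simp add: sjet_def norm_divide field_simps)
    \<comment> \<open>Since the lower jets of \<open>G\<close> vanish, Leibniz' rule leaves
      \<open>y n (1/2) * x n\<close> only, and these add up to the \<open>\<ell>\<^sub>2\<close>
      norm.\<close>
    moreover have "sjet k H = s"
    proof -
      have "sjet k H = (\<Sum>n\<in>B. sjet k (\<lambda>z. y n z * G z n))"
        unfolding H_def by (intro sjet_sum finB holomorphic_intros holy calfD(4)[OF G])
      also have "\<dots> = (\<Sum>n\<in>B. complex_of_real ((cmod (x n))\<^sup>2 / s))"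
      proof (rule sum.cong)
        fix n assume n: "n \<in> B"
        have "sjet k (\<lambda>z. y n z * G z n) = (\<Sum>i=0..k. sjet i (y n) * jet (k - i) G n)"
          unfolding jet_def by (intro sjet_mult holy calfD(4)[OF G])
        also have "\<dots> = (\<Sum>i\<in>{0}. sjet i (y n) * jet (k - i) G n)"
          by (intro sum.mono_neutral_right) (auto simp: low)
        also have "\<dots> = y n (1/2) * x n" by (simp add: x_def)
        also have "y n (1/2) = cnj (x n) / of_real (cmod (x n)) * of_real (r n)"
          using r0[OF n] by (simp add: y_def exp_of_real)
        also have "\<dots> * x n = (x n * cnj (x n)) / of_real (cmod (x n)) / of_real s * of_real (cmod (x n))" by (simp add: r_def)
        also have "\<dots> = (cmod (x n))\<^sup>2 / s"
          using n by (simp add: B_def complex_norm_square[symmetric])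
        finally show "sjet k (\<lambda>z. y n z * G z n) = complex_of_real ((cmod (x n))\<^sup>2 / s)" by simp
      qed simp
      also have "\<dots> = of_real ((\<Sum>n\<in>B. (cmod (x n))\<^sup>2) / s)" by (simp add: sum_divide_distrib)
      also have "\<dots> = s" unfolding s2 using s0 by (simp add: power2_eq_square)
      finally show ?thesis .
    qed
    ultimately show ?thesis using s0 by (simp add: s_def x_def)
  qed
qed

section \<open>Quotient norms\<close>

text \<open>The norms of \<open>Z\<^sub>2\<close> and \<open>Z\<^sub>3\<close> are \<open>qn 2\<close> and \<open>qn 3\<close>, evaluated on representatives.\<close>

definition jeq :: "nat \<Rightarrow> (complex \<Rightarrow> cseq) \<Rightarrow> (complex \<Rightarrow> cseq) \<Rightarrow> bool" where
  "jeq r F G \<longleftrightarrow> (\<forall>k<r. jet k F = jet k G)"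

definition qn :: "nat \<Rightarrow> (complex \<Rightarrow> cseq) \<Rightarrow> real" where
  "qn r F = (INF G\<in>{G. calf G \<and> jeq r G F}. cN G)"

lemma jeq_refl [simp]: "jeq r F F" by (simp add: jeq_def)
lemma jeq_sym: "jeq r F G \<Longrightarrow> jeq r G F" by (simp add: jeq_def)
lemma jeq_mono: "jeq r F G \<Longrightarrow> s \<le> r \<Longrightarrow> jeq s F G" by (simp add: jeq_def)

lemma jeq_add:
  "\<lbrakk>calf F; calf G; calf F'; calf G'; jeq r F F'; jeq r G G'\<rbrakk> \<Longrightarrow> jeq r (F + G) (F' + G')"
  by (simp add: jeq_def jet_add)

lemma jeq_mul:
  assumes "multiplier g" "calf F" "calf G" "jeq r F G" shows "jeq r (mul g F) (mul g G)"
  unfolding jeq_def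
proof (intro allI impI ext)
  fix k n assume "k < r"
  then show "jet k (mul g F) n = jet k (mul g G) n"
    using assms by (simp add: jet_mul jeq_def)
qed

lemma calf_cmult: "calf F \<Longrightarrow> calf (mul (\<lambda>z. c) F)"
  by (rule calf_mul) auto

lemma calf_uminus: "calf F \<Longrightarrow> calf (- F)"
  using calf_cmult[of F "-1"] by (simp add: mul_def fun_Compl_def)

lemma calf_diff: "calf F \<Longrightarrow> calf G \<Longrightarrow> calf (F - G)"
  using calf_add[of F "- G"] calf_uminus[of G] by simp

lemma uminus_eq_mul: "- F = mul (\<lambda>z. - 1) F"
  by (simp add: fun_eq_iff)

lemma jet_uminus: "calf F \<Longrightarrow> jet k (- F) = - jet k F"
  using jet_cmult[of F k "-1"] by (simp add: uminus_eq_mul fun_eq_iff)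

lemma jet_diff: "calf F \<Longrightarrow> calf G \<Longrightarrow> jet k (F - G) = jet k F - jet k G"
  using jet_add[of F "- G" k] calf_uminus[of G] jet_uminus[of G k] by simp

lemma calf_sum: "(\<And>i. i \<in> I \<Longrightarrow> calf (F i)) \<Longrightarrow> calf (\<Sum>i\<in>I. F i)"
  by (induction I rule: infinite_finite_induct) (auto simp: calf_0 intro: calf_add)

lemma cN_0 [simp]: "cN 0 = 0"
proof (rule antisym)
  show "cN 0 \<le> 0" by (rule cN_leI) auto
qed (rule cN_nonneg[OF calf_0])

lemma cN_cmult: "calf F \<Longrightarrow> cN (mul (\<lambda>z. c) F) \<le> cmod c * cN F"
  by (rule cN_mul_le) auto

lemma bdd_below_qn: "bdd_below (cN ` {G. calf G \<and> jeq r G F})"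
  by (auto simp: bdd_below_def intro: cN_nonneg)

lemma qn_leI: "calf G \<Longrightarrow> jeq r G F \<Longrightarrow> qn r F \<le> cN G"
  unfolding qn_def by (rule cINF_lower[OF bdd_below_qn]) simp

lemma qn_le_cN: "calf F \<Longrightarrow> qn r F \<le> cN F"
  by (rule qn_leI) auto

lemma qn_geI: "calf F \<Longrightarrow> (\<And>G. calf G \<Longrightarrow> jeq r G F \<Longrightarrow> K \<le> cN G) \<Longrightarrow> K \<le> qn r F"
  unfolding qn_def by (rule cINF_greatest) auto

lemma qn_nonneg: "calf F \<Longrightarrow> 0 \<le> qn r F"
  by (rule qn_geI) (auto intro: cN_nonneg)

lemma qn_obtain:
  assumes "calf F" "qn r F < K"
  obtains G where "calf G" "jeq r G F" "cN G < K"
  using assms cINF_less_iff[OF _ bdd_below_qn, of r F K] unfolding qn_def by fastforce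

lemma qn_cong: "jeq r F G \<Longrightarrow> qn r F = qn r G"
  unfolding qn_def by (rule arg_cong[where f = "\<lambda>S. Inf (cN ` S)"]) (auto simp: jeq_def)

lemma qn_add:
  assumes "calf F" "calf G" shows "qn r (F + G) \<le> qn r F + qn r G"
proof (rule field_le_epsilon)
  fix e :: real assume "e > 0"
  then have "qn r F < qn r F + e/2" "qn r G < qn r G + e/2" by auto
  then obtain F' G' where FG: "calf F'" "jeq r F' F" "cN F' < qn r F + e/2"
     "calf G'" "jeq r G' G" "cN G' < qn r G + e/2"
    using assms by (metis qn_obtain)
  have "qn r (F + G) \<le> cN (F' + G')"
    using FG assms by (intro qn_leI calf_add jeq_add)
  also have "\<dots> \<le> cN F' + cN G'" using FG by (intro cN_add)
  finally show "qn r (F + G) \<le> qn r F + qn r G + e" using FG by simp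
qed

lemma qn_cmult:
  assumes "calf F" shows "qn r (mul (\<lambda>z. c) F) \<le> cmod c * qn r F"
proof (rule field_le_epsilon)
  fix e :: real assume "e > 0"
  then have "e / (cmod c + 1) > 0" by (intro divide_pos_pos add_nonneg_pos) auto
  then have "qn r F < qn r F + e / (cmod c + 1)" by simp
  then obtain G where G: "calf G" "jeq r G F" "cN G < qn r F + e / (cmod c + 1)"
    using assms by (metis qn_obtain)
  have "qn r (mul (\<lambda>z. c) F) \<le> cN (mul (\<lambda>z. c) G)"
    using G assms by (intro qn_leI calf_cmult jeq_mul) auto
  also have "\<dots> \<le> cmod c * cN G" by (rule cN_cmult) (rule G)
  also have "\<dots> \<le> cmod c * (qn r F + e / (cmod c + 1))" using G by (intro mult_left_mono) auto
  also have "\<dots> = cmod c * qn r F + cmod c / (cmod c + 1) * e" by (simp add: algebra_simps)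
  also have "\<dots> \<le> cmod c * qn r F + 1 * e"
    using \<open>e > 0\<close> by (intro add_left_mono mult_right_mono) (auto simp: divide_le_eq_1 add_nonneg_pos)
  finally show "qn r (mul (\<lambda>z. c) F) \<le> cmod c * qn r F + e" by simp
qed

lemma qn_uminus: "calf F \<Longrightarrow> qn r (- F) = qn r F"
  using qn_cmult[of F r "-1"] qn_cmult[of "- F" r "-1"] calf_uminus[of F]
  by (simp add: uminus_eq_mul[symmetric])

lemma qn_diff: "calf F \<Longrightarrow> calf G \<Longrightarrow> qn r (F - G) \<le> qn r F + qn r G"
  using qn_add[of F "- G" r] calf_uminus[of G] qn_uminus[of G r] by simp

lemma qn_triangle: "calf F \<Longrightarrow> calf G \<Longrightarrow> qn r F \<le> qn r (F - G) + qn r G"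
  using qn_add[of "F - G" G r] calf_diff[of F G] by simp

lemma qn_mono:
  assumes "calf F" "r \<le> s" shows "qn r F \<le> qn s F"
  by (rule qn_geI[OF assms(1)]) (use assms(2) in \<open>auto intro: qn_leI jeq_mono\<close>)

lemma qn_sum: "(\<And>i. i \<in> I \<Longrightarrow> calf (F i)) \<Longrightarrow> qn r (\<Sum>i\<in>I. F i) \<le> (\<Sum>i\<in>I. qn r (F i))"
proof (induction I rule: infinite_finite_induct)
  case (insert x I)
  then have "qn r (F x + (\<Sum>i\<in>I. F i)) \<le> qn r (F x) + qn r (\<Sum>i\<in>I. F i)"
    by (intro qn_add calf_sum) auto
  with insert show ?case by (simp del: plus_fun_apply)
qed (use qn_le_cN[OF calf_0] qn_nonneg[OF calf_0] in \<open>auto intro: antisym\<close>)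

section \<open>Multipliers\<close>

text \<open>The Moebius function \<open>phi\<close> vanishes only at \<open>1/2\<close>, is bounded by 1 on the strip and bounded
  away from 0 on its boundary, so that multiplication by \<open>phi\<close> can be undone.\<close>

definition phi :: "complex \<Rightarrow> complex" where "phi z = (z - 1/2) / (z + 1)"

text \<open>The modulus is \<open>exp (- L / 2)\<close> on \<open>Re z = 0\<close> and
  \<open>exp (L / 2)\<close> on \<open>Re z = 1\<close>, so \<open>L\<close> trades one boundary
  norm against the other, while the value 1 at \<open>1/2\<close> leaves the leading Taylor
  coefficient alone.\<close>

definition ex :: "real \<Rightarrow> complex \<Rightarrow> complex" where "ex L z = exp (of_real L * (z - 1/2))"

lemma closed_strip_plus1: "z \<in> closed_strip \<Longrightarrow> z + 1 \<noteq> 0"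
  by (auto simp: closed_strip_def complex_eq_iff)

lemma phi_half [simp]: "phi (1/2) = 0" by (simp add: phi_def)

lemma ex_half [simp]: "ex L (1/2) = 1" by (simp add: ex_def)

lemma cmod_phi_le:
  assumes "z \<in> closed_strip" shows "cmod (phi z) \<le> 1"
proof -
  have "(Re z - 1/2)\<^sup>2 \<le> (Re z + 1)\<^sup>2"
    using assms by (intro abs_le_square_iff[THEN iffD1]) (auto simp: closed_strip_def abs_le_iff)
  then have "cmod (z - 1/2) \<le> cmod (z + 1)" by (simp add: cmod_def)
  then show ?thesis using closed_strip_plus1[OF assms] by (simp add: phi_def norm_divide)
qed

lemma multiplier_phi [simp]: "multiplier phi"
proof -
  have "continuous_on closed_strip phi" "phi holomorphic_on closed_strip"
    unfolding phi_def using closed_strip_plus1 by (auto intro!: continuous_intros holomorphic_intros)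
  then show ?thesis unfolding multiplier_def
    using cmod_phi_le holomorphic_on_subset[OF _ open_strip_subset] by blast
qed

lemma cmod_ex: "cmod (ex L z) = exp (L * (Re z - 1/2))"
  by (simp add: ex_def norm_exp_eq_Re)

lemma multiplier_ex [simp]: "multiplier (ex L)"
proof -
  have "cmod (ex L z) \<le> exp \<bar>L\<bar>" if "z \<in> closed_strip" for z
  proof -
    have "\<bar>Re z - 1/2\<bar> \<le> 1" using that by (auto simp: closed_strip_def)
    then have "\<bar>L * (Re z - 1/2)\<bar> \<le> \<bar>L\<bar> * 1" unfolding abs_mult by (intro mult_left_mono) auto
    then show ?thesis by (simp add: cmod_ex)
  qed
  moreover have "continuous_on closed_strip (ex L)" "ex L holomorphic_on open_strip"
    unfolding ex_def by (auto intro!: continuous_intros holomorphic_intros)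
  ultimately show ?thesis by (auto simp: multiplier_def)
qed

lemma sjet_phi [simp]: "sjet (Suc 0) phi = 2/3" "sjet (Suc (Suc 0)) phi = - 4/9"
proof -
  have 1: "(phi has_field_derivative (3/2) / (z + 1)\<^sup>2) (at z)" if "z \<in> open_strip" for z
  proof -
    have "z + 1 \<noteq> 0" using closed_strip_plus1[of z] that open_strip_subset by blast
    then have "(phi has_field_derivative ((1 - 0) * (z + 1) - (z - 1/2) * (1 + 0)) / ((z + 1) * (z + 1))) (at z)"
      unfolding phi_def by (intro derivative_intros)
    then show ?thesis by (simp add: power2_eq_square)
  qed
  have 2: "((\<lambda>z. (3/2) / (z + 1)\<^sup>2) has_field_derivative (- 8/9)) (at (1/2 :: complex))"
    by (auto intro!: derivative_eq_intros simp: field_simps power2_eq_square)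
  show "sjet (Suc 0) phi = 2/3" "sjet (Suc (Suc 0)) phi = - 4/9"
    using sjet_1_2[OF 1 2] by (simp_all add: power2_eq_square)
qed

lemma sjet_ex [simp]: "sjet (Suc 0) (ex L) = L" "sjet (Suc (Suc 0)) (ex L) = (of_real L)\<^sup>2 / 2"
proof -
  have 1: "(ex L has_field_derivative of_real L * ex L z) (at z)" if "z \<in> open_strip" for z
    unfolding ex_def by (auto intro!: derivative_eq_intros)
  have 2: "((\<lambda>z. of_real L * ex L z) has_field_derivative (of_real L)\<^sup>2) (at (1/2))"
    unfolding ex_def by (auto intro!: derivative_eq_intros simp: power2_eq_square)
  show "sjet (Suc 0) (ex L) = L" "sjet (Suc (Suc 0)) (ex L) = (of_real L)\<^sup>2 / 2"
    using sjet_1_2[OF 1 2] by simp_all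
qed

lemma jet_mul_012:
  assumes "multiplier g" "calf F"
  shows "jet 0 (mul g F) n = g (1/2) * jet 0 F n"
    "jet (Suc 0) (mul g F) n = g (1/2) * jet (Suc 0) F n + sjet (Suc 0) g * jet 0 F n"
    "jet (Suc (Suc 0)) (mul g F) n = g (1/2) * jet (Suc (Suc 0)) F n
       + sjet (Suc 0) g * jet (Suc 0) F n + sjet (Suc (Suc 0)) g * jet 0 F n"
  using jet_mul[OF assms, of "Suc 0" n] jet_mul[OF assms, of "Suc (Suc 0)" n]
  by (simp_all add: sum.atLeast0_atMost_Suc)

lemma jeq_3_iff: "jeq 3 F G \<longleftrightarrow> (\<forall>n. jet 0 F n = jet 0 G n \<and> jet (Suc 0) F n = jet (Suc 0) G n
    \<and> jet (Suc (Suc 0)) F n = jet (Suc (Suc 0)) G n)"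
  by (auto simp: jeq_def numeral_3_eq_3 less_Suc_eq fun_eq_iff)

lemma jeq_2_iff: "jeq 2 F G \<longleftrightarrow> (\<forall>n. jet 0 F n = jet 0 G n \<and> jet (Suc 0) F n = jet (Suc 0) G n)"
  by (auto simp: jeq_def numeral_2_eq_2 less_Suc_eq fun_eq_iff)

lemma cN_phi: "calf F \<Longrightarrow> cN (mul phi F) \<le> cN F"
  using cN_mul_le[of F phi 1] cmod_phi_le by simp

text \<open>The expansion of \<open>exp (L (z - 1/2))\<close> in powers of \<open>phi\<close> up to order 2.\<close>

lemma jeq_ex:
  assumes "calf G"
  shows "jeq 3 (mul (ex L) G) (G + mul (\<lambda>z. of_real (3/2 * L)) (mul phi G) +
     mul (\<lambda>z. of_real (9/8 * L\<^sup>2 + 3/2 * L)) (mul phi (mul phi G)))"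
  \<comment> \<open>With \<open>w = z - 1/2\<close> one has \<open>phi = 2/3 w - 4/9 w^2\<close> and
    \<open>phi^2 = 4/9 w^2\<close> up to third order. Comparison with
    \<open>1 + L w + L^2 w^2 / 2\<close> gives \<open>3/2 * L\<close> first, and then
    \<open>9/8 * L\<^sup>2 + 3/2 * L\<close>, the last summand compensating the
    \<open>- 4/9\<close>.\<close>
  unfolding jeq_3_iff using assms
  by (simp add: jet_add calf_add calf_mul jet_mul_012 jet_cmult algebra_simps power2_eq_square del: jet_0)

lemma jeq_phi3: "calf F \<Longrightarrow> jeq 3 (mul phi (mul phi (mul phi F))) 0"
  unfolding jeq_3_iff by (simp add: jet_mul_012 calf_mul del: jet_0) (simp add: jet_def)

section \<open>The canonical lift\<close>

text \<open>Meant for finitely supported sequences; over an infinite support the sum has the default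
  value 0.\<close>

definition l2n :: "cseq \<Rightarrow> real" where
  "l2n x = sqrt (\<Sum>n | x n \<noteq> 0. (cmod (x n))\<^sup>2)"

lemma l2n_nonneg: "0 \<le> l2n x" by (simp add: l2n_def sum_nonneg)

lemma l2n_eq: "finite A \<Longrightarrow> (\<And>n. n \<notin> A \<Longrightarrow> x n = 0) \<Longrightarrow> l2n x = sqrt (\<Sum>n\<in>A. (cmod (x n))\<^sup>2)"
  unfolding l2n_def by (rule arg_cong[where f = sqrt], rule sum.mono_neutral_left) auto

text \<open>The classical extremal function of complex interpolation: \<open>x\<close> times the
  power \<open>2 * z - 1\<close> of its normalised modulus. The Gaussian factor equals 1 at
  \<open>1/2\<close> and supplies the decay at infinity required on the boundary lines.\<close>

definition lift :: "cseq \<Rightarrow> complex \<Rightarrow> cseq" where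
  "lift x = (\<lambda>z n. if z \<in> closed_strip \<and> x n \<noteq> 0 then
     x n * exp ((2 * z - 1) * of_real (ln (cmod (x n) / l2n x))) * exp ((z - 1/2)\<^sup>2) else 0)"

lemma exp_neg_sq_tendsto: "((\<lambda>t::real. c * exp (- t\<^sup>2)) \<longlongrightarrow> 0) at_infinity"
  unfolding at_infinity_eq_at_top_bot by (intro filterlim_sup; real_asymp)

lemma lift_half: "lift x (1/2) = x"
  by (auto simp: lift_def fun_eq_iff closed_strip_def)

lemma lift_eq_0: "x n = 0 \<Longrightarrow> lift x z n = 0" by (simp add: lift_def)

text \<open>Without the Gaussian factor the moduli are \<open>l2n x\<close> on
  \<open>Re z = 0\<close> and \<open>(cmod (x n))\<^sup>2 / l2n x\<close> on
  \<open>Re z = 1\<close>, and the latter sum to \<open>l2n x\<close>. The Gaussian factor costs at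
  most \<open>exp (1/4)\<close>, which is estimated by 2.\<close>

lemma
  assumes fin: "finite {n. x n \<noteq> 0}"
  shows calf_lift: "calf (lift x)" and cN_lift: "cN (lift x) \<le> 2 * l2n x"
proof -
  define s where "s = l2n x"
  define r where "r = (\<lambda>n. cmod (x n) / s)"
  have s0: "s > 0" if "x n \<noteq> 0" for n
  proof -
    have "0 < (\<Sum>n | x n \<noteq> 0. (cmod (x n))\<^sup>2)" using that fin by (intro sum_pos2[of _ n]) auto
    then show ?thesis by (simp add: s_def l2n_def)
  qed
  have r0: "r n > 0" if "x n \<noteq> 0" for n using that s0[OF that] by (simp add: r_def)
  have eq: "lift x z n = x n * exp ((2 * z - 1) * of_real (ln (r n))) * exp ((z - 1/2)\<^sup>2)"
    if "z \<in> closed_strip" "x n \<noteq> 0" for z n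
    using that by (simp add: lift_def r_def s_def)
  have nrm: "cmod (lift x z n) = cmod (x n) * exp ((2 * Re z - 1) * ln (r n)) * exp ((Re z - 1/2)\<^sup>2 - (Im z)\<^sup>2)"
    if "z \<in> closed_strip" "x n \<noteq> 0" for z n
    unfolding eq[OF that] by (simp add: norm_mult norm_exp_eq_Re power2_eq_square)
  have e2: "exp ((1/2)\<^sup>2 - (Im z)\<^sup>2) \<le> 2 * exp (- (Im z)\<^sup>2)" for z
  proof -
    have "exp (1/4::real) \<le> 1 + 1/4 + (1/4)\<^sup>2" by (intro exp_bound) auto
    then have "exp (1/4::real) \<le> 2" by (simp add: power2_eq_square)
    moreover have "exp ((1/2)\<^sup>2 - (Im z)\<^sup>2) = exp (1/4) * exp (- (Im z)\<^sup>2)"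
      by (simp add: exp_add[symmetric] power2_eq_square)
    ultimately show ?thesis by simp
  qed
  have n0: "cmod (lift x (Complex 0 t) n) \<le> s * (2 * exp (- t\<^sup>2))" if "x n \<noteq> 0" for t n
  proof -
    have "cmod (lift x (Complex 0 t) n) = cmod (x n) * exp (- ln (r n)) * exp ((1/2)\<^sup>2 - t\<^sup>2)"
      using nrm[of "Complex 0 t" n] that by simp
    also have "cmod (x n) * exp (- ln (r n)) = s"
      using r0[OF that] s0[OF that] that by (simp add: exp_minus r_def)
    finally show ?thesis using e2[of "Complex 0 t"] s0[OF that] by simp
  qed
  have n1: "cmod (lift x (Complex 1 t) n) \<le> (cmod (x n))\<^sup>2 / s * (2 * exp (- t\<^sup>2))" if "x n \<noteq> 0" for t n
  proof -
    have "cmod (lift x (Complex 1 t) n) = cmod (x n) * exp (ln (r n)) * exp ((1/2)\<^sup>2 - t\<^sup>2)"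
      using nrm[of "Complex 1 t" n] that by simp
    also have "cmod (x n) * exp (ln (r n)) = (cmod (x n))\<^sup>2 / s"
      using r0[OF that] s0[OF that] that by (simp add: r_def power2_eq_square)
    finally show ?thesis using e2[of "Complex 1 t"] s0[OF that] by (simp add: divide_right_mono mult_left_mono)
  qed
  have zero: "lift x z n = 0" if "x n = 0" for z n using that by (rule lift_eq_0)
  show c: "calf (lift x)"
  proof (rule calf_finite[OF fin])
    fix n assume n: "n \<in> {n. x n \<noteq> 0}"
    then have n': "x n \<noteq> 0" by simp
    have ceq: "\<And>z. z \<in> closed_strip \<Longrightarrow> lift x z n = x n * exp ((2 * z - 1) * of_real (ln (r n))) * exp ((z - 1/2)\<^sup>2)"
      using eq n' by blast
    show "continuous_on closed_strip (\<lambda>z. lift x z n)"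
      by (subst continuous_on_cong[OF refl ceq]) (auto intro!: continuous_intros)
    show "(\<lambda>z. lift x z n) holomorphic_on open_strip"
      using open_strip_subset ceq
      by (subst holomorphic_cong[OF refl, of _ _ "\<lambda>z. x n * exp ((2 * z - 1) * of_real (ln (r n))) * exp ((z - 1/2)\<^sup>2)"])
         (auto intro!: holomorphic_intros)
    have "cmod (lift x z n) \<le> cmod (x n) * exp \<bar>ln (r n)\<bar> * exp 1" if "z \<in> closed_strip" for z
      unfolding nrm[OF that n']
    proof (intro mult_mono mult_left_mono)
      have "\<bar>2 * Re z - 1\<bar> \<le> 1" using that by (auto simp: closed_strip_def)
      then have "\<bar>(2 * Re z - 1) * ln (r n)\<bar> \<le> 1 * \<bar>ln (r n)\<bar>" unfolding abs_mult by (intro mult_right_mono) auto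
      then show "exp ((2 * Re z - 1) * ln (r n)) \<le> exp \<bar>ln (r n)\<bar>" by simp
      have "\<bar>Re z - 1/2\<bar> \<le> 1" using that by (auto simp: closed_strip_def)
      then have "(Re z - 1/2)\<^sup>2 \<le> 1" by (simp add: abs_square_le_1)
      then have "(Re z - 1/2)\<^sup>2 - (Im z)\<^sup>2 \<le> 1" using zero_le_power2[of "Im z"] by linarith
      then show "exp ((Re z - 1/2)\<^sup>2 - (Im z)\<^sup>2) \<le> exp 1" by simp
    qed auto
    then show "\<exists>M. \<forall>z\<in>closed_strip. cmod (lift x z n) \<le> M" by blast
    show "((\<lambda>t. lift x (Complex 0 t) n) \<longlongrightarrow> 0) at_infinity"
      by (rule Lim_null_comparison[OF _ exp_neg_sq_tendsto[of "s * 2"]])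
         (use n0[OF n'] in \<open>auto intro!: always_eventually simp: mult.assoc\<close>)
    show "((\<lambda>t. lift x (Complex 1 t) n) \<longlongrightarrow> 0) at_infinity"
      by (rule Lim_null_comparison[OF _ exp_neg_sq_tendsto[of "(cmod (x n))\<^sup>2 / s * 2"]])
         (use n1[OF n'] in \<open>auto intro!: always_eventually simp: mult.assoc\<close>)
  qed (auto simp: lift_def)
  have ex1: "2 * exp (- t\<^sup>2) \<le> 2" for t :: real by simp
  have s_nn: "0 \<le> s" by (simp add: s_def l2n_nonneg)
  show "cN (lift x) \<le> 2 * l2n x"
  proof (rule cN_leI)
    show "cmod (lift x (Complex 0 t) n) \<le> 2 * l2n x" for t n
    proof (cases "x n = 0")
      case False
      have "s * (2 * exp (- t\<^sup>2)) \<le> s * 2" by (intro mult_left_mono ex1 s_nn)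
      then show ?thesis using n0[OF False, of t] by (simp add: s_def)
    qed (simp add: zero l2n_nonneg)
    show "(\<Sum>n. cmod (lift x (Complex 1 t) n)) \<le> 2 * l2n x" for t
    proof -
      have "(\<Sum>n. cmod (lift x (Complex 1 t) n)) = (\<Sum>n | x n \<noteq> 0. cmod (lift x (Complex 1 t) n))"
        by (rule suminf_finite[OF fin]) (simp add: zero)
      also have "\<dots> \<le> (\<Sum>n | x n \<noteq> 0. (cmod (x n))\<^sup>2 / s * 2)"
      proof (rule sum_mono)
        fix n assume "n \<in> {n. x n \<noteq> 0}"
        then have n: "x n \<noteq> 0" by simp
        have "(cmod (x n))\<^sup>2 / s * (2 * exp (- t\<^sup>2)) \<le> (cmod (x n))\<^sup>2 / s * 2"
          using s_nn by (intro mult_left_mono ex1) auto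
        then show "cmod (lift x (Complex 1 t) n) \<le> (cmod (x n))\<^sup>2 / s * 2" using n1[OF n, of t] by linarith
      qed
      also have "\<dots> = (\<Sum>n | x n \<noteq> 0. (cmod (x n))\<^sup>2) / s * 2"
        by (simp only: sum_distrib_right[symmetric] sum_divide_distrib[symmetric])
      also have "(\<Sum>n | x n \<noteq> 0. (cmod (x n))\<^sup>2) = s\<^sup>2" by (simp add: s_def l2n_def sum_nonneg)
      also have "s\<^sup>2 / s * 2 = 2 * l2n x" by (simp add: s_def power2_eq_square)
      finally show ?thesis .
    qed
  qed
qed

section \<open>Division by phi\<close>

lemma phi_lower:
  assumes "cmod (z - 1/2) \<ge> c" "c > 0" "z \<in> closed_strip"
  shows "1 / cmod (phi z) \<le> 1 + 3 / (2 * c)"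
proof -
  have "cmod (z + 1) \<le> cmod (z - 1/2) + cmod (3/2)" using norm_triangle_ineq[of "z - 1/2" "3/2"] by (simp add: add.commute)
  also have "cmod (3/2) \<le> 3 / (2 * c) * cmod (z - 1/2)"
    using mult_left_mono[OF assms(1), of "3 / (2 * c)"] assms(2) by simp
  finally have "cmod (z + 1) \<le> (1 + 3 / (2 * c)) * cmod (z - 1/2)" by (simp add: algebra_simps)
  moreover have "cmod (z - 1/2) > 0" using assms by linarith
  ultimately show ?thesis by (simp add: phi_def norm_divide divide_le_eq)
qed

text \<open>The boundary lines have distance \<open>1/2\<close> from the zero of \<open>phi\<close>,
  and \<open>1 + 3 / (2 * c)\<close> is 4 for \<open>c = 1/2\<close>.\<close>

lemma phi_lower_boundary: "1 / cmod (phi (Complex 0 t)) \<le> 4" "1 / cmod (phi (Complex 1 t)) \<le> 4"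
proof -
  have "cmod (Complex 0 t - 1/2) \<ge> 1/2" "cmod (Complex 1 t - 1/2) \<ge> 1/2"
    using abs_Re_le_cmod[of "Complex 0 t - 1/2"] abs_Re_le_cmod[of "Complex 1 t - 1/2"] by simp_all
  then show "1 / cmod (phi (Complex 0 t)) \<le> 4" "1 / cmod (phi (Complex 1 t)) \<le> 4"
    using phi_lower[of "1/2" "Complex 0 t"] phi_lower[of "1/2" "Complex 1 t"] by simp_all
qed

text \<open>The zero of \<open>F\<close> at \<open>1/2\<close> makes the singularity of
  \<open>F / phi\<close> removable, and the norm of the quotient is read off on the boundary, where
  \<open>1 / cmod (phi z)\<close> is at most 4. Finite support reduces membership in the Calderon
  space to scalar conditions.\<close>

lemma phi_division:
  assumes F: "calf F" and fin: "finite A" "\<And>z n. n \<notin> A \<Longrightarrow> F z n = 0" and F0: "F (1/2) = 0"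
  obtains G where "calf G" "F = mul phi G" "cN G \<le> 4 * cN F" "\<And>z n. n \<notin> A \<Longrightarrow> G z n = 0"
proof -
  \<comment> \<open>The factor \<open>z + 1\<close> is the denominator of \<open>phi\<close>; at
    \<open>1/2\<close> the difference quotient is replaced by the derivative.\<close>
  define G where "G = (\<lambda>z n. if z \<notin> closed_strip \<or> n \<notin> A then 0
     else (if z = 1/2 then deriv (\<lambda>z. F z n) (1/2) else (F z n - F (1/2) n) / (z - 1/2)) * (z + 1))"
  have out: "G z n = F z n / phi z" if "z \<noteq> 1/2" for z n
    using that fin(2) calfD(1)[OF F] F0 by (auto simp: G_def phi_def)
  have FG: "F = mul phi G"
  proof (intro ext)
    fix z n
    show "F z n = mul phi G z n"
    proof (cases "z = 1/2 \<or> z \<notin> closed_strip")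
      case True
      then show ?thesis
      proof
        assume "z = 1/2"
        then show ?thesis using F0 by (simp only: mul_apply phi_half) simp
      qed (use calfD(1)[OF F] in \<open>simp add: G_def\<close>)
    next
      case False
      then have "phi z \<noteq> 0" using closed_strip_plus1[of z] by (auto simp: phi_def)
      then show ?thesis using out[of z n] False by simp
    qed
  qed
  have half: "Complex 0 t \<noteq> 1/2" "Complex 1 t \<noteq> 1/2" for t by (simp_all add: complex_eq_iff)
  have bnd: "cmod (G z n) \<le> 4 * cmod (F z n)" if "z = Complex 0 t \<or> z = Complex 1 t" for z t n
  proof -
    have "cmod (G z n) = 1 / cmod (phi z) * cmod (F z n)"
      using that half[of t] by (auto simp: out norm_divide)
    also have "\<dots> \<le> 4 * cmod (F z n)"
      using phi_lower_boundary[of t] that by (intro mult_right_mono) auto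
    finally show ?thesis .
  qed
  have calfG: "calf G"
  proof (rule calf_finite[OF fin(1)])
    fix n assume n: "n \<in> A"
    let ?f = "\<lambda>z. F z n"
    let ?q = "\<lambda>z. if z = 1/2 then deriv ?f (1/2) else (?f z - ?f (1/2)) / (z - 1/2)"
    have q: "?q holomorphic_on open_strip"
      by (rule pole_lemma_open[OF calfD(4)[OF F] open_open_strip])
    have Geq: "G z n = ?q z * (z + 1)" if "z \<in> closed_strip" for z using n that by (simp add: G_def)
    show hol: "(\<lambda>z. G z n) holomorphic_on open_strip"
      by (rule holomorphic_transform[of "\<lambda>z. ?q z * (z + 1)"])
         (use q open_strip_subset Geq in \<open>auto intro!: holomorphic_intros\<close>)
    let ?B = "cball (1/2) (1/4) :: complex set"
    have B: "?B \<subseteq> open_strip" by (rule cball_half_subset)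
    have cont1: "continuous_on ?B (\<lambda>z. G z n)"
      using hol B holomorphic_on_imp_continuous_on continuous_on_subset by blast
    have nz: "z - 1/2 \<noteq> 0" if "z \<in> closed_strip - ball (1/2) (1/4)" for z :: complex
    proof
      assume "z - 1/2 = 0"
      then have z: "z = 1/2" by (simp only: right_minus_eq)
      show False using that unfolding z by auto
    qed
    have cont2: "continuous_on (closed_strip - ball (1/2) (1/4)) (\<lambda>z. G z n)"
    proof (rule continuous_on_eq)
      show "continuous_on (closed_strip - ball (1/2) (1/4)) (\<lambda>z. (F z n - F (1/2) n) / (z - 1/2) * (z + 1))"
        by (intro continuous_intros continuous_on_subset[OF calf_continuous[OF F]] ballI nz) auto
      fix z assume z: "z \<in> closed_strip - ball (1/2) (1/4)"
      then have "z \<noteq> 1/2" using nz[OF z] by (simp only: right_minus_eq not_False_eq_True)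
      then show "(F z n - F (1/2) n) / (z - 1/2) * (z + 1) = G z n" using Geq[of z] z by simp
    qed
    \<comment> \<open>Continuity is glued from two closed pieces: a disc around \<open>1/2\<close>,
      where \<open>G\<close> is holomorphic, and the rest of the strip, where the quotient formula
      has no singularity.\<close>
    have "closed_strip = ?B \<union> (closed_strip - ball (1/2) (1/4))"
      using B open_strip_subset ball_subset_cball by blast
    moreover have "closed (closed_strip - ball (1/2) (1/4))"
      by (intro closed_Diff closed_closed_strip open_ball)
    ultimately show "continuous_on closed_strip (\<lambda>z. G z n)"
      using continuous_on_closed_Un[OF closed_cball _ cont1 cont2] by metis
    obtain M where M: "\<And>z n. cmod (F z n) \<le> M" using calfD(2)[OF F] by blast
    have "compact ((\<lambda>z. G z n) ` ?B)" by (intro compact_continuous_image cont1 compact_cball)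
    then obtain K where K: "\<And>z. z \<in> ?B \<Longrightarrow> cmod (G z n) \<le> K"
      using compact_imp_bounded bounded_iff by (metis imageI)
    have "cmod (G z n) \<le> max K (7 * M)" if z: "z \<in> closed_strip" for z
    proof (cases "z \<in> ?B")
      case False
      then have "cmod (z - 1/2) \<ge> 1/4" by (simp add: dist_norm norm_minus_commute)
      then have "1 / cmod (phi z) \<le> 7" using phi_lower[of "1/4" z] z by simp
      moreover have "z \<noteq> 1/2"
      proof
        assume z: "z = 1/2"
        show False using False unfolding z by simp
      qed
      then have "G z n = F z n / phi z" by (rule out)
      ultimately have "cmod (G z n) \<le> 7 * M"
        using mult_mono[of "1 / cmod (phi z)" 7 "cmod (F z n)" M] M[of z n] by (simp add: norm_divide)
      then show ?thesis by simp
    qed (use K in \<open>simp add: le_max_iff_disj\<close>)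
    then show "\<exists>M. \<forall>z\<in>closed_strip. cmod (G z n) \<le> M" by blast
    have "((\<lambda>t. 4 * cmod (F (Complex 0 t) n)) \<longlongrightarrow> 0) at_infinity"
    proof -
      have "((\<lambda>t. F (Complex 0 t) n) \<longlongrightarrow> 0) at_infinity"
      proof (rule tendstoI)
        fix e :: real assume "e > 0"
        from calfD(5)[OF F half_gt_zero[OF this]]
        show "\<forall>\<^sub>F t in at_infinity. dist (F (Complex 0 t) n) 0 < e"
        proof eventually_elim
          case (elim t)
          then have "cmod (F (Complex 0 t) n) \<le> e / 2" by blast
          with \<open>e > 0\<close> show ?case by simp
        qed
      qed
      from tendsto_mult_left[OF tendsto_norm_zero[OF this], of 4] show ?thesis by simp
    qed
    then show "((\<lambda>t. G (Complex 0 t) n) \<longlongrightarrow> 0) at_infinity"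
      by (rule Lim_null_comparison[rotated]) (use bnd in \<open>auto intro!: always_eventually\<close>)
    have "((\<lambda>t. 4 * (\<Sum>n. cmod (F (Complex 1 t) n))) \<longlongrightarrow> 0) at_infinity"
      using tendsto_mult_left[OF calfD(8)[OF F], of 4] by simp
    then show "((\<lambda>t. G (Complex 1 t) n) \<longlongrightarrow> 0) at_infinity"
    proof (rule Lim_null_comparison[rotated], intro always_eventually allI)
      fix t
      have "cmod (F (Complex 1 t) n) \<le> (\<Sum>n. cmod (F (Complex 1 t) n))"
        using sum_le_suminf[OF calfD(6)[OF F], of "{n}" t] by simp
      then show "cmod (G (Complex 1 t) n) \<le> 4 * (\<Sum>n. cmod (F (Complex 1 t) n))"
        using bnd[of "Complex 1 t" t n] by simp
    qed
  qed (auto simp: G_def)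
  have "cN G \<le> 4 * cN F"
  proof (rule cN_leI)
    show "cmod (G (Complex 0 t) n) \<le> 4 * cN F" for t n
      using bnd[of "Complex 0 t" t n] cN_side0[OF F, of t n] by simp
    show "(\<Sum>n. cmod (G (Complex 1 t) n)) \<le> 4 * cN F" for t
    proof -
      have "(\<Sum>n. cmod (G (Complex 1 t) n)) \<le> (\<Sum>n. 4 * cmod (F (Complex 1 t) n))"
        using bnd[of "Complex 1 t" t] by (intro suminf_le summable_mult calfD(6) F calfG) auto
      also have "\<dots> = 4 * (\<Sum>n. cmod (F (Complex 1 t) n))" by (rule suminf_mult[OF calfD(6)[OF F]])
      finally show ?thesis using cN_side1[OF F, of t] by linarith
    qed
  qed
  with calfG FG show ?thesis by (intro that[of G]) (auto simp: G_def)
qed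

section \<open>Tails\<close>

text \<open>For large \<open>t\<close> the whole \<open>l1\<close> norm is small. On the remaining
  compact interval each \<open>t\<close> has a small tail, continuity into \<open>l1\<close> extends
  this to a neighbourhood, and finitely many neighbourhoods suffice.\<close>

lemma uniform_l1_tail:
  assumes F: "calf F" and d: "d > 0"
  shows "\<exists>N. \<forall>M\<ge>N. \<forall>t. (\<Sum>n. cmod (restr {M..} F (Complex 1 t) n)) \<le> d"
proof -
  note D = calfD[OF F]
  let ?f = "\<lambda>t. F (Complex 1 t)"
  let ?tail = "\<lambda>M t. \<Sum>n. cmod (restr {M..} F (Complex 1 t) n)"
  have tail_mono: "?tail M t \<le> ?tail M' t" if "M' \<le> M" for M M' t
    using that by (intro suminf_le calfD(6) calf_restr F) auto
  have "\<forall>\<^sub>F t in at_infinity. dist (\<Sum>n. cmod (?f t n)) 0 < d" using D(8) d by (rule tendstoD)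
  then obtain R where R: "\<And>t. R \<le> norm t \<Longrightarrow> dist (\<Sum>n. cmod (?f t n)) 0 < d" by (auto simp: eventually_at_infinity)
  have far: "?tail M t \<le> d" if "R \<le> norm t" for M t
    using l1_restrict(2)[OF D(6)[of t], of "{M..}"] R[OF that] by (simp add: dist_real_def)
  have "\<exists>e N. e > 0 \<and> (\<forall>s. dist s t < e \<longrightarrow> ?tail N s \<le> d)" for t
  proof -
    have "\<forall>\<^sub>F s in at t. dist (\<Sum>n. cmod (?f s n - ?f t n)) 0 < d/2" using D(7) by (rule tendstoD) (use d in simp)
    then obtain e where e: "e > 0" "\<And>s. s \<noteq> t \<Longrightarrow> dist s t < e \<Longrightarrow> dist (\<Sum>n. cmod (?f s n - ?f t n)) 0 < d/2"
      by (auto simp: eventually_at)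
    have "(\<lambda>N. \<Sum>n. cmod (?f t (n + N))) \<longlonglongrightarrow> 0" by (rule suminf_exist_split2) (use D(6) in auto)
    then have "\<forall>\<^sub>F N in sequentially. dist (\<Sum>n. cmod (?f t (n + N))) 0 < d/2" by (rule tendstoD) (use d in simp)
    then obtain N where N: "dist (\<Sum>n. cmod (?f t (n + N))) 0 < d/2" by (auto simp: eventually_sequentially)
    have "?tail N t = (\<Sum>n. cmod (restr {N..} F (Complex 1 t) (n + N))) + (\<Sum>n<N. cmod (restr {N..} F (Complex 1 t) n))"
      by (rule suminf_split_initial_segment) (intro calfD(6) calf_restr F)
    then have tailt: "?tail N t \<le> d/2" using N by (simp add: dist_real_def)
    have "?tail N s \<le> d" if "dist s t < e" for s
    proof (cases "s = t")
      case False
      have "?tail N s = (\<Sum>n. cmod ((if n \<in> {N..} then ?f s n - ?f t n else 0) + restr {N..} F (Complex 1 t) n))"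
        by (intro suminf_cong) simp
      also have "\<dots> \<le> (\<Sum>n. cmod (if n \<in> {N..} then ?f s n - ?f t n else 0)) + ?tail N t"
        by (intro l1_add l1_restrict l1_diff D calfD(6) calf_restr F)
      also have "(\<Sum>n. cmod (if n \<in> {N..} then ?f s n - ?f t n else 0)) \<le> (\<Sum>n. cmod (?f s n - ?f t n))"
        by (intro l1_restrict l1_diff D)
      finally show ?thesis using e(2)[OF False that] tailt by (simp add: dist_real_def)
    qed (use tailt d in simp)
    then show ?thesis using e(1) by blast
  qed
  then obtain e N where eN: "\<And>t. e t > 0" "\<And>t s. dist s t < e t \<Longrightarrow> ?tail (N t) s \<le> d" by metis
  obtain T where T: "finite T" "cball 0 R \<subseteq> (\<Union>t\<in>T. ball t (e t))"
  proof (rule compactE_image[of "cball 0 R" UNIV "\<lambda>t. ball t (e t)"])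
    show "cball 0 R \<subseteq> (\<Union>t. ball t (e t))"
    proof
      fix t show "t \<in> (\<Union>t. ball t (e t))" using eN(1)[of t] by (intro UN_I[of t]) auto
    qed
  qed auto
  have "?tail M t \<le> d" if M: "M \<ge> Max (insert 0 (N ` T))" for M t
  proof (cases "norm t \<le> R")
    case True
    then obtain s where s: "s \<in> T" "dist t s < e s" using T(2) by (force simp: dist_commute)
    then have "N s \<le> M" using M T(1) by simp
    then show ?thesis using tail_mono[of "N s" M t] eN(2)[OF s(2)] by linarith
  qed (use far in simp)
  then show ?thesis by blast
qed

lemma mul_ex_inverse: "mul (ex (- L)) (mul (ex L) F) = F"
  by (simp add: fun_eq_iff ex_def exp_add[symmetric] mult.assoc[symmetric] del: mult_minus_left)

text \<open>On \<open>Re z = 0\<close> the restriction need not become small, but on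
  \<open>Re z = 1\<close> its norm drops below \<open>exp (- L)\<close>. Multiplication by
  \<open>ex L\<close> turns both sides into \<open>O(exp (- L / 2))\<close>. Undoing it modulo third
  order is a polynomial in \<open>phi\<close> with coefficients \<open>O(L\<^sup>2)\<close>, and the
  exponential wins for large \<open>L\<close>.\<close>

lemma qn_tail:
  assumes F: "calf F" and e: "e > 0"
  shows "\<exists>N. \<forall>M\<ge>N. qn 3 (restr {M..} F) < e"
proof -
  \<comment> \<open>\<open>P L\<close> is the sum of the absolute values bounding the coefficients
    in \<open>jeq_ex\<close>, taken at \<open>- L\<close>.\<close>
  define P where "P = (\<lambda>L::real. 1 + 3/2 * L + (9/8 * L\<^sup>2 + 3/2 * L))"
  have "((\<lambda>L. P L * exp (- L / 2)) \<longlongrightarrow> 0) at_top" unfolding P_def by real_asymp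
  from tendsto_mult_right[OF this, of "cN F + 1"]
  have "((\<lambda>L. P L * (exp (- L / 2) * (cN F + 1))) \<longlongrightarrow> 0) at_top" by (simp add: mult.assoc)
  then have "\<forall>\<^sub>F L in at_top. dist (P L * (exp (- L / 2) * (cN F + 1))) 0 < e" using e by (rule tendstoD)
  then have "\<forall>\<^sub>F L in at_top. L > 0 \<and> P L * (exp (- L / 2) * (cN F + 1)) < e"
    using eventually_gt_at_top[of 0] by eventually_elim (simp add: dist_real_def)
  then obtain L where L: "L > 0" "P L * (exp (- L / 2) * (cN F + 1)) < e"
    using eventually_happens[of _ "at_top :: real filter"] by auto
  obtain N where N: "\<And>M t. M \<ge> N \<Longrightarrow> (\<Sum>n. cmod (restr {M..} F (Complex 1 t) n)) \<le> exp (- L)"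
    using uniform_l1_tail[OF F, of "exp (- L)"] by auto
  have "qn 3 (restr {M..} F) < e" if M: "M \<ge> N" for M
  proof -
    define R where "R = restr {M..} F"
    define G where "G = mul (ex L) R"
    have R: "calf R" unfolding R_def by (rule calf_restr[OF F])
    have G: "calf G" unfolding G_def by (intro calf_mul R) simp
    have cG: "cN G \<le> exp (- L / 2) * (cN F + 1)"
      unfolding G_def
    proof (rule cN_mul[OF R])
      show "cmod (ex L (Complex 0 t)) \<le> exp (- L / 2)" "cmod (ex L (Complex 1 t)) \<le> exp (L / 2)" for t
        by (simp_all add: cmod_ex)
      show "exp (- L / 2) * cmod (R (Complex 0 t) n) \<le> exp (- L / 2) * (cN F + 1)" for t n
        using cN_side0[OF R, of t n] cN_restr[OF F, of "{M..}"] by (intro mult_left_mono) (auto simp: R_def)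
      show "exp (L / 2) * (\<Sum>n. cmod (R (Complex 1 t) n)) \<le> exp (- L / 2) * (cN F + 1)" for t
      proof -
        have "exp (L / 2) * (\<Sum>n. cmod (R (Complex 1 t) n)) \<le> exp (L / 2) * exp (- L)"
          using N[OF M] by (intro mult_left_mono) (auto simp: R_def)
        also have "\<dots> = exp (- L / 2) * 1" by (simp add: exp_add[symmetric])
        also have "\<dots> \<le> exp (- L / 2) * (cN F + 1)" using cN_nonneg[OF F] by (intro mult_left_mono) auto
        finally show ?thesis .
      qed
    qed
    let ?c1 = "complex_of_real (3/2 * (- L))" and ?c2 = "complex_of_real (9/8 * (- L)\<^sup>2 + 3/2 * (- L))"
    let ?E = "G + mul (\<lambda>z. ?c1) (mul phi G) + mul (\<lambda>z. ?c2) (mul phi (mul phi G))"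
    have pG: "calf (mul phi G)" "calf (mul phi (mul phi G))" using G by (auto intro!: calf_mul)
    have "jeq 3 (mul (ex (- L)) G) ?E" by (rule jeq_ex[OF G])
    then have "jeq 3 ?E R" unfolding G_def mul_ex_inverse by (rule jeq_sym)
    then have "qn 3 R \<le> cN ?E" using G by (intro qn_leI calf_add calf_cmult calf_mul) auto
    also have "\<dots> \<le> cN G + cmod ?c1 * cN (mul phi G) + cmod ?c2 * cN (mul phi (mul phi G))"
      using G pG by (intro order_trans[OF cN_add] add_mono cN_cmult calf_add calf_cmult) auto
    also have "\<dots> \<le> cN G + 3/2 * L * cN G + (9/8 * L\<^sup>2 + 3/2 * L) * cN G"
    proof (intro add_mono mult_mono)
      show "cmod ?c1 \<le> 3/2 * L" using L by (simp add: norm_mult)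
      show "cmod ?c2 \<le> 9/8 * L\<^sup>2 + 3/2 * L" using L by (simp only: norm_of_real) (auto simp: abs_le_iff)
      show "cN (mul phi G) \<le> cN G" "cN (mul phi (mul phi G)) \<le> cN G"
        using cN_phi[OF G] cN_phi[OF pG(1)] by auto
    qed (use L pG in \<open>auto intro: cN_nonneg\<close>)
    also have "\<dots> = P L * cN G" by (simp add: P_def algebra_simps)
    also have "\<dots> \<le> P L * (exp (- L / 2) * (cN F + 1))"
      using L cG by (intro mult_left_mono) (auto simp: P_def)
    also have "\<dots> < e" by (rule L)
    finally show ?thesis by (simp add: R_def)
  qed
  then show ?thesis by blast
qed

section \<open>Choosing signs\<close>

definition sg :: "bool \<Rightarrow> 'a::ab_group_add \<Rightarrow> 'a" where "sg b x = (if b then x else - x)"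

definition signed_sum :: "(nat \<Rightarrow> bool) \<Rightarrow> nat \<Rightarrow> (nat \<Rightarrow> 'a::ab_group_add) \<Rightarrow> 'a" where
  "signed_sum \<epsilon> N F = (\<Sum>i<N. sg (\<epsilon> i) (F i))"

lemma sg_diff: "sg b (x - y) = sg b x - sg b (y :: 'a :: ab_group_add)"
  by (simp add: sg_def)

lemma signed_sum_diff: "signed_sum \<epsilon> N (\<lambda>i. F i - G i) = signed_sum \<epsilon> N F - signed_sum \<epsilon> N G"
  by (simp add: signed_sum_def sg_diff sum_subtractf)

text \<open>Splitting a family of \<open>2\<^sup>k\<close> vectors into halves, the sign between the two partial
  sums is chosen so that \<open>\<eta> + M \<alpha>\<close> does not exceed its average over both choices.\<close>

lemma signs_tree:
  fixes \<eta> \<alpha> :: "'f::ab_group_add \<Rightarrow> real"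
  assumes X: "\<And>x y. \<lbrakk>x \<in> X; y \<in> X\<rbrakk> \<Longrightarrow> x + y \<in> X" "\<And>x y. \<lbrakk>x \<in> X; y \<in> X\<rbrakk> \<Longrightarrow> x - y \<in> X"
    and \<alpha>: "\<And>x y. \<lbrakk>x \<in> X; y \<in> X\<rbrakk> \<Longrightarrow> \<alpha> (x + y) + \<alpha> (x - y) \<le> 2 * (\<alpha> x + \<alpha> y)"
    and \<eta>: "\<And>x y. \<lbrakk>x \<in> X; y \<in> X\<rbrakk> \<Longrightarrow> \<eta> (x + y) + \<eta> (x - y) \<le> 2 * \<theta> * (\<eta> x + \<eta> y) + 2 * \<kappa> * (\<alpha> x + \<alpha> y)"
    and \<alpha>0: "\<And>x. x \<in> X \<Longrightarrow> 0 \<le> \<alpha> x" and \<theta>: "\<theta> \<ge> 1" and \<kappa>: "\<kappa> \<ge> 0" and M: "M \<ge> 0"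
    and F: "\<And>i. i < 2 ^ k \<Longrightarrow> F i \<in> X"
  shows "\<exists>\<epsilon>. signed_sum \<epsilon> (2 ^ k) F \<in> X \<and>
    \<eta> (signed_sum \<epsilon> (2 ^ k) F) + M * \<alpha> (signed_sum \<epsilon> (2 ^ k) F)
     \<le> \<theta> ^ k * (\<Sum>i<2^k. \<eta> (F i)) + (M + k * \<kappa> * \<theta> ^ k) * (\<Sum>i<2^k. \<alpha> (F i))"
  using F M
proof (induction k arbitrary: F M)
  case 0
  then show ?case by (intro exI[of _ "\<lambda>_. True"]) (simp add: signed_sum_def sg_def)
next
  case (Suc k)
  define F' where "F' = (\<lambda>i. F (i + 2 ^ k))"
  \<comment> \<open>The weight to be demanded of the two halves: after one more level the factor
    \<open>\<theta>\<close> turns \<open>M'\<close> into \<open>\<kappa> + M\<close>, which pays for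
    the defect of \<open>\<eta>\<close> and leaves weight \<open>M\<close> on
    \<open>\<alpha>\<close>.\<close>
  define M' where "M' = (\<kappa> + M) / \<theta>"
  have M': "M' \<ge> 0" "\<theta> * M' = \<kappa> + M" using \<kappa> \<theta> Suc.prems by (simp_all add: M'_def)
  define S where "S = (\<lambda>\<epsilon> (F :: nat \<Rightarrow> 'f). signed_sum \<epsilon> (2 ^ k) F)"
  define A where "A = (\<lambda>F. \<Sum>i<(2::nat)^k. \<alpha> (F i :: 'f))"
  define E where "E = (\<lambda>F. \<Sum>i<(2::nat)^k. \<eta> (F i :: 'f))"
  have "F i \<in> X" if "i < 2 ^ k" for i using Suc.prems(1)[of i] that by simp
  from Suc.IH[of F M', OF this M'(1)]
  obtain \<epsilon>1 where \<epsilon>1: "S \<epsilon>1 F \<in> X" "\<eta> (S \<epsilon>1 F) + M' * \<alpha> (S \<epsilon>1 F)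
     \<le> \<theta> ^ k * E F + (M' + k * \<kappa> * \<theta> ^ k) * A F"
    unfolding S_def A_def E_def by blast
  have "F' i \<in> X" if "i < 2 ^ k" for i using Suc.prems(1)[of "i + 2 ^ k"] that by (simp add: F'_def)
  from Suc.IH[of F' M', OF this M'(1)]
  obtain \<epsilon>2 where \<epsilon>2: "S \<epsilon>2 F' \<in> X" "\<eta> (S \<epsilon>2 F') + M' * \<alpha> (S \<epsilon>2 F')
     \<le> \<theta> ^ k * E F' + (M' + k * \<kappa> * \<theta> ^ k) * A F'"
    unfolding S_def A_def E_def by blast
  define x where "x = S \<epsilon>1 F"
  define y where "y = S \<epsilon>2 F'"
  have xy: "x \<in> X" "y \<in> X" using \<epsilon>1 \<epsilon>2 by (simp_all add: x_def y_def)
  have split: "(\<Sum>i<2 ^ Suc k. f i) = (\<Sum>i<2 ^ k. f i) + (\<Sum>i<2 ^ k. f (i + 2 ^ k))" for f :: "nat \<Rightarrow> 'b::comm_monoid_add"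
  proof -
    have "(\<Sum>i<2 ^ Suc k. f i) = (\<Sum>i<2 ^ k. f i) + (\<Sum>i=2 ^ k..<2 ^ k + 2 ^ k. f i)"
      using sum.atLeastLessThan_concat[of 0 "2 ^ k" "2 ^ k + 2 ^ k" f] by (simp add: lessThan_atLeast0 mult_2)
    also have "(\<Sum>i=2 ^ k..<2 ^ k + 2 ^ k. f i) = (\<Sum>i<2 ^ k. f (i + 2 ^ k))"
      using sum.shift_bounds_nat_ivl[of f 0 "2 ^ k" "2 ^ k"] by (simp add: lessThan_atLeast0)
    finally show ?thesis .
  qed
  have ex: "\<exists>\<epsilon>. signed_sum \<epsilon> (2 ^ Suc k) F = x + sg b y" for b
  proof (intro exI)
    \<comment> \<open>Comparing with \<open>b\<close> keeps the signs of the second half if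
      \<open>b\<close> holds and flips them all otherwise.\<close>
    let ?\<epsilon> = "\<lambda>i. if i < 2 ^ k then \<epsilon>1 i else (\<epsilon>2 (i - 2 ^ k) = b)"
    have "signed_sum ?\<epsilon> (2 ^ Suc k) F = (\<Sum>i<2 ^ k. sg (\<epsilon>1 i) (F i)) + (\<Sum>i<2 ^ k. sg (\<epsilon>2 i = b) (F' i))"
      unfolding signed_sum_def split by (simp add: F'_def)
    also have "(\<Sum>i<2 ^ k. sg (\<epsilon>2 i = b) (F' i)) = sg b y"
      by (cases b) (auto simp: y_def S_def signed_sum_def sg_def sum_negf[symmetric] intro!: sum.cong)
    finally show "signed_sum ?\<epsilon> (2 ^ Suc k) F = x + sg b y" by (simp add: x_def S_def signed_sum_def)
  qed
  have "(\<eta> (x + y) + M * \<alpha> (x + y)) + (\<eta> (x - y) + M * \<alpha> (x - y))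
      \<le> 2 * \<theta> * (\<eta> x + \<eta> y) + 2 * \<kappa> * (\<alpha> x + \<alpha> y) + M * (2 * (\<alpha> x + \<alpha> y))"
    using \<eta>[OF xy] mult_left_mono[OF \<alpha>[OF xy] Suc.prems(2)] by (simp add: algebra_simps)
  also have "\<dots> = 2 * (\<theta> * ((\<eta> x + M' * \<alpha> x) + (\<eta> y + M' * \<alpha> y)))"
  proof -
    have "2 * (\<theta> * ((\<eta> x + M' * \<alpha> x) + (\<eta> y + M' * \<alpha> y))) = 2 * \<theta> * (\<eta> x + \<eta> y) + 2 * (\<theta> * M') * (\<alpha> x + \<alpha> y)"
      by (simp add: algebra_simps)
    then show ?thesis unfolding M'(2) by (simp add: algebra_simps)
  qed
  also have "\<dots> \<le> 2 * (\<theta> * ((\<theta> ^ k * E F + (M' + k * \<kappa> * \<theta> ^ k) * A F) + (\<theta> ^ k * E F' + (M' + k * \<kappa> * \<theta> ^ k) * A F')))"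
    unfolding x_def y_def by (intro mult_left_mono add_mono[OF \<epsilon>1(2) \<epsilon>2(2)]) (use \<theta> in auto)
  also have "\<dots> = 2 * (\<theta> ^ Suc k * (E F + E F') + (\<theta> * M' + k * \<kappa> * \<theta> ^ Suc k) * (A F + A F'))"
    by (simp add: algebra_simps)
  also have "\<dots> \<le> 2 * (\<theta> ^ Suc k * (E F + E F') + (M + Suc k * \<kappa> * \<theta> ^ Suc k) * (A F + A F'))"
  proof -
    have "\<kappa> * 1 \<le> \<kappa> * \<theta> ^ Suc k" using \<theta> \<kappa> by (intro mult_left_mono one_le_power) auto
    then have "\<theta> * M' + k * \<kappa> * \<theta> ^ Suc k \<le> M + Suc k * \<kappa> * \<theta> ^ Suc k"
      unfolding M'(2) by (simp add: algebra_simps)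
    moreover have "A F + A F' \<ge> 0"
      using \<alpha>0 Suc.prems(1) by (intro add_nonneg_nonneg) (auto simp: A_def F'_def intro!: sum_nonneg)
    ultimately show ?thesis by (intro mult_left_mono add_left_mono mult_right_mono) auto
  qed
  also have "E F + E F' = (\<Sum>i<2 ^ Suc k. \<eta> (F i))" unfolding split E_def F'_def by simp
  also have "A F + A F' = (\<Sum>i<2 ^ Suc k. \<alpha> (F i))" unfolding split A_def F'_def by simp
  finally have sum2: "(\<eta> (x + y) + M * \<alpha> (x + y)) + (\<eta> (x - y) + M * \<alpha> (x - y))
     \<le> 2 * (\<theta> ^ Suc k * (\<Sum>i<2 ^ Suc k. \<eta> (F i)) + (M + Suc k * \<kappa> * \<theta> ^ Suc k) * (\<Sum>i<2 ^ Suc k. \<alpha> (F i)))" .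
  have half: "A \<le> B \<Longrightarrow> A + B \<le> 2 * Z \<Longrightarrow> A \<le> Z" "\<not> A \<le> B \<Longrightarrow> A + B \<le> 2 * Z \<Longrightarrow> B \<le> Z" for A B Z :: real
    by linarith+
  have "\<exists>b. \<eta> (x + sg b y) + M * \<alpha> (x + sg b y)
     \<le> \<theta> ^ Suc k * (\<Sum>i<2 ^ Suc k. \<eta> (F i)) + (M + Suc k * \<kappa> * \<theta> ^ Suc k) * (\<Sum>i<2 ^ Suc k. \<alpha> (F i))"
  proof (cases "\<eta> (x + y) + M * \<alpha> (x + y) \<le> \<eta> (x - y) + M * \<alpha> (x - y)")
    case True
    from half(1)[OF True sum2] show ?thesis by (intro exI[of _ True]) (simp only: sg_def if_True)
  next
    case False
    from half(2)[OF False sum2] show ?thesis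
      by (intro exI[of _ False]) (simp only: sg_def if_False add_uminus_conv_diff)
  qed
  then obtain b where b: "\<eta> (x + sg b y) + M * \<alpha> (x + sg b y)
     \<le> \<theta> ^ Suc k * (\<Sum>i<2 ^ Suc k. \<eta> (F i)) + (M + Suc k * \<kappa> * \<theta> ^ Suc k) * (\<Sum>i<2 ^ Suc k. \<alpha> (F i))" ..
  obtain \<epsilon> where \<epsilon>: "signed_sum \<epsilon> (2 ^ Suc k) F = x + sg b y" using ex by blast
  have "x + sg b y \<in> X" using X xy by (cases b) (auto simp: sg_def)
  then show ?case using b \<epsilon> by metis
qed

text \<open>Type 2 on \<open>2\<^sup>k\<close> vectors with a logarithmic loss, in a form that does not involve averages.\<close>

definition sign_type :: "'f::ab_group_add set \<Rightarrow> ('f \<Rightarrow> real) \<Rightarrow> bool" where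
  "sign_type X p \<longleftrightarrow> (\<exists>C\<ge>0. \<forall>k\<ge>1. \<forall>R\<ge>0. \<forall>F. (\<forall>i<2^k. F i \<in> X \<and> p (F i) \<le> R) \<longrightarrow>
     (\<exists>\<epsilon>. p (signed_sum \<epsilon> (2^k) F) \<le> C * R * real k * sqrt (2^k)))"

text \<open>Here \<open>\<alpha>\<close> is a quadratic quantity satisfying the parallelogram
  inequality, and \<open>\<eta>\<close> satisfies it up to a multiple of \<open>\<alpha>\<close>.
  Taking \<open>s = k\<close> over the \<open>k\<close> levels of the tree keeps
  \<open>(1 + 1/k) ^ k\<close> below 3, while the coefficient of \<open>\<alpha>\<close> grows like
  \<open>k * (1 + k) * C\<close>, hence quadratically; the square root leaves one factor
  \<open>k\<close>.\<close>

lemma sign_typeI: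
  fixes p \<eta> \<alpha> :: "'f::ab_group_add \<Rightarrow> real"
  assumes X: "\<And>x y. \<lbrakk>x \<in> X; y \<in> X\<rbrakk> \<Longrightarrow> x + y \<in> X" "\<And>x y. \<lbrakk>x \<in> X; y \<in> X\<rbrakk> \<Longrightarrow> x - y \<in> X"
    and \<alpha>: "\<And>x y. \<lbrakk>x \<in> X; y \<in> X\<rbrakk> \<Longrightarrow> \<alpha> (x + y) + \<alpha> (x - y) \<le> 2 * (\<alpha> x + \<alpha> y)"
    and \<eta>: "\<And>x y s. \<lbrakk>x \<in> X; y \<in> X; s > 0\<rbrakk> \<Longrightarrow>
      \<eta> (x + y) + \<eta> (x - y) \<le> 2 * (1 + 1/s) * (\<eta> x + \<eta> y) + 2 * ((1 + s) * C) * (\<alpha> x + \<alpha> y)"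
    and \<alpha>0: "\<And>x. x \<in> X \<Longrightarrow> 0 \<le> \<alpha> x" and \<eta>0: "\<And>x. x \<in> X \<Longrightarrow> 0 \<le> \<eta> x"
    and p0: "\<And>x. x \<in> X \<Longrightarrow> 0 \<le> p x"
    and le: "\<And>x. x \<in> X \<Longrightarrow> (p x)\<^sup>2 \<le> D * (\<eta> x + \<alpha> x)" "\<And>x. x \<in> X \<Longrightarrow> \<eta> x + \<alpha> x \<le> D * (p x)\<^sup>2"
    and C: "C \<ge> 0" and D: "D \<ge> 0"
  shows "sign_type X p"
  unfolding sign_type_def
\<comment> \<open>The constant is the bound
  \<open>3 + 1 + 3 * k * (1 + k) * C \<le> (4 + 6 * C) * k\<^sup>2\<close>, with one factor
  \<open>D\<close> for each direction of the comparison with \<open>p\<close>.\<close>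
proof (intro exI[of _ "sqrt (D\<^sup>2 * (4 + 6 * C))"] conjI allI impI)
  show "0 \<le> sqrt (D\<^sup>2 * (4 + 6 * C))" using C by simp
  fix k :: nat and R :: real and F :: "nat \<Rightarrow> 'f" assume k: "1 \<le> k" and R: "0 \<le> R" and F: "\<forall>i<2^k. F i \<in> X \<and> p (F i) \<le> R"
  let ?k = "real k"
  have bnd: "\<eta> (F i) + \<alpha> (F i) \<le> D * R\<^sup>2" if "i < 2^k" for i
  proof -
    have "(p (F i))\<^sup>2 \<le> R\<^sup>2" using F that p0 by (intro power_mono) auto
    then have "D * (p (F i))\<^sup>2 \<le> D * R\<^sup>2" using D by (intro mult_left_mono)
    then show ?thesis using le(2)[of "F i"] F that by fastforce
  qed
  have "\<exists>\<epsilon>. signed_sum \<epsilon> (2 ^ k) F \<in> X \<and> \<eta> (signed_sum \<epsilon> (2 ^ k) F) + 1 * \<alpha> (signed_sum \<epsilon> (2 ^ k) F)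
     \<le> (1 + 1/?k) ^ k * (\<Sum>i<2^k. \<eta> (F i)) + (1 + ?k * ((1 + ?k) * C) * (1 + 1/?k) ^ k) * (\<Sum>i<2^k. \<alpha> (F i))"
    by (rule signs_tree; (rule X \<alpha> \<alpha>0 \<eta>)?) (use k F C in auto)
  then obtain \<epsilon> where \<epsilon>: "signed_sum \<epsilon> (2 ^ k) F \<in> X"
    "\<eta> (signed_sum \<epsilon> (2 ^ k) F) + 1 * \<alpha> (signed_sum \<epsilon> (2 ^ k) F)
     \<le> (1 + 1/?k) ^ k * (\<Sum>i<2^k. \<eta> (F i)) + (1 + ?k * ((1 + ?k) * C) * (1 + 1/?k) ^ k) * (\<Sum>i<2^k. \<alpha> (F i))"
    by blast
  have \<theta>: "(1 + 1/?k) ^ k \<le> 3"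
  proof -
    have "(1 + 1/?k) ^ k \<le> exp (1/?k) ^ k" by (intro power_mono) auto
    also have "\<dots> = exp 1" using k by (simp add: exp_of_nat_mult[symmetric])
    finally show ?thesis using exp_le by linarith
  qed
  have s\<eta>: "(\<Sum>i<2^k. \<eta> (F i)) \<le> 2^k * (D * R\<^sup>2)"
  proof -
    have "\<eta> (F i) \<le> D * R\<^sup>2" if "i < 2^k" for i using bnd[OF that] \<alpha>0[of "F i"] F that by fastforce
    then have "(\<Sum>i<2^k. \<eta> (F i)) \<le> of_nat (card {..<(2::nat)^k}) * (D * R\<^sup>2)" by (intro sum_bounded_above) auto
    then show ?thesis by simp
  qed
  have s\<alpha>: "(\<Sum>i<2^k. \<alpha> (F i)) \<le> 2^k * (D * R\<^sup>2)"
  proof -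
    have "\<alpha> (F i) \<le> D * R\<^sup>2" if "i < 2^k" for i using bnd[OF that] \<eta>0[of "F i"] F that by fastforce
    then have "(\<Sum>i<2^k. \<alpha> (F i)) \<le> of_nat (card {..<(2::nat)^k}) * (D * R\<^sup>2)" by (intro sum_bounded_above) auto
    then show ?thesis by simp
  qed
  have nn: "0 \<le> (\<Sum>i<2^k. \<eta> (F i))" "0 \<le> (\<Sum>i<2^k. \<alpha> (F i))"
    by (rule sum_nonneg, use F \<alpha>0 \<eta>0 in simp)+
  have "\<eta> (signed_sum \<epsilon> (2 ^ k) F) + \<alpha> (signed_sum \<epsilon> (2 ^ k) F)
     \<le> 3 * (2^k * (D * R\<^sup>2)) + (1 + ?k * ((1 + ?k) * C) * 3) * (2^k * (D * R\<^sup>2))"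
    using \<epsilon>(2) mult_mono[OF \<theta> s\<eta>]
      mult_mono[OF add_left_mono[OF mult_left_mono[OF \<theta>, of "?k * ((1 + ?k) * C)"], of 1] s\<alpha>]
      C D nn by simp
  also have "\<dots> = (4 + 3 * (?k * (1 + ?k)) * C) * (2^k * (D * R\<^sup>2))" by (simp add: algebra_simps)
  also have "\<dots> \<le> ((4 + 6 * C) * ?k\<^sup>2) * (2^k * (D * R\<^sup>2))"
  proof (intro mult_right_mono)
    have "1 \<le> ?k" using k by simp
    then have k2: "1 \<le> ?k\<^sup>2" "?k \<le> ?k * ?k" using mult_left_mono[of 1 ?k ?k] by (simp_all add: one_le_power)
    then have "?k * (1 + ?k) \<le> 2 * ?k\<^sup>2" by (simp add: power2_eq_square algebra_simps)
    then have "(?k * (1 + ?k)) * C \<le> (2 * ?k\<^sup>2) * C" using C by (rule mult_right_mono)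
    then have "4 + 3 * ((?k * (1 + ?k)) * C) \<le> 4 * ?k\<^sup>2 + 3 * ((2 * ?k\<^sup>2) * C)" using k2(1) by linarith
    then show "4 + 3 * (?k * (1 + ?k)) * C \<le> (4 + 6 * C) * ?k\<^sup>2" by (simp add: algebra_simps)
  qed (use D in auto)
  finally have "(p (signed_sum \<epsilon> (2 ^ k) F))\<^sup>2 \<le> D * (((4 + 6 * C) * ?k\<^sup>2) * (2^k * (D * R\<^sup>2)))"
    using le(1)[OF \<epsilon>(1)] D by (meson mult_left_mono order_trans)
  also have "\<dots> = (sqrt (D\<^sup>2 * (4 + 6 * C)) * R * ?k * sqrt (2^k))\<^sup>2"
    using C by (simp add: power_mult_distrib) (simp add: power2_eq_square)
  finally have "p (signed_sum \<epsilon> (2 ^ k) F) \<le> sqrt (D\<^sup>2 * (4 + 6 * C)) * R * ?k * sqrt (2^k)"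
    by (rule power2_le_imp_le) (use C R in auto)
  then show "\<exists>\<epsilon>. p (signed_sum \<epsilon> (2^k) F) \<le> sqrt (D\<^sup>2 * (4 + 6 * C)) * R * ?k * sqrt (2^k)" by blast
qed

section \<open>Disjoint blocks\<close>

lemma sum_fun_apply: "(\<Sum>i\<in>I. f i) x = (\<Sum>i\<in>I. f i x)"
  by (induction I rule: infinite_finite_induct) auto

lemma sg_fun_apply: "sg b f x = sg b (f x)" for f :: "'a \<Rightarrow> 'b::ab_group_add"
  by (simp add: sg_def)

lemma signed_sum_apply: "signed_sum \<epsilon> N W z n = signed_sum \<epsilon> N (\<lambda>i. W i z n)"
  by (simp add: signed_sum_def sum_fun_apply sg_fun_apply)

lemma cmod_sg [simp]: "cmod (sg b z) = cmod z"
  by (simp add: sg_def)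

lemma calf_sg: "calf F \<Longrightarrow> calf (sg b F)"
  using calf_uminus by (cases b) (simp_all add: sg_def)

lemma calf_signed_sum: "(\<And>i. i < N \<Longrightarrow> calf (F i)) \<Longrightarrow> calf (signed_sum \<epsilon> N F)"
  unfolding signed_sum_def by (intro calf_sum calf_sg) auto

lemma qn_sg: "calf F \<Longrightarrow> qn r (sg b F) = qn r F"
  using qn_uminus by (cases b) (simp_all add: sg_def)

lemma qn_signed_sum:
  assumes "\<And>i. i < N \<Longrightarrow> calf (F i)" shows "qn r (signed_sum \<epsilon> N F) \<le> (\<Sum>i<N. qn r (F i))"
proof -
  have "qn r (signed_sum \<epsilon> N F) \<le> (\<Sum>i<N. qn r (sg (\<epsilon> i) (F i)))"
    unfolding signed_sum_def by (intro qn_sum calf_sg assms) auto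
  also have "\<dots> = (\<Sum>i<N. qn r (F i))" by (intro sum.cong) (auto simp: qn_sg assms)
  finally show ?thesis .
qed

lemma cN_uminus: "calf F \<Longrightarrow> cN (- F) \<le> cN F"
  using cN_cmult[of F "-1"] by (simp add: uminus_eq_mul)

lemma cN_signed_sum:
  assumes "\<And>i. i < N \<Longrightarrow> calf (F i)" "\<And>i. i < N \<Longrightarrow> cN (F i) \<le> K"
  shows "cN (signed_sum \<epsilon> N F) \<le> N * K"
  using assms
proof (induction N)
  case (Suc N)
  have "cN (sg (\<epsilon> N) (F N)) \<le> K"
    using Suc.prems[of N] cN_uminus[of "F N"] by (cases "\<epsilon> N") (auto simp: sg_def)
  moreover have "cN (signed_sum \<epsilon> N F + sg (\<epsilon> N) (F N)) \<le> cN (signed_sum \<epsilon> N F) + cN (sg (\<epsilon> N) (F N))"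
    using Suc.prems by (intro cN_add calf_signed_sum calf_sg) auto
  moreover have "signed_sum \<epsilon> (Suc N) F = signed_sum \<epsilon> N F + sg (\<epsilon> N) (F N)" by (simp add: signed_sum_def)
  ultimately have "cN (signed_sum \<epsilon> (Suc N) F) \<le> N * K + K" using Suc by fastforce
  then show ?case by (simp add: algebra_simps)
qed (simp add: signed_sum_def)

lemma mul_add: "mul g (F + G) = mul g F + mul g G"
  by (simp add: fun_eq_iff algebra_simps)

lemma mul_signed_sum: "mul g (signed_sum \<epsilon> N F) = signed_sum \<epsilon> N (\<lambda>i. mul g (F i))"
  unfolding signed_sum_def
proof (induction N)
  case (Suc N)
  have "mul g (sg b (F N)) = sg b (mul g (F N))" for b by (cases b) (simp_all add: sg_def fun_eq_iff)
  then show ?case using Suc by (simp add: mul_add del: plus_fun_apply mul_apply)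
qed (simp add: fun_eq_iff)

lemma calf_phi_pow: "calf F \<Longrightarrow> calf ((mul phi ^^ j) F)"
  by (induction j) (auto intro: calf_mul)

lemma cN_phi_pow: "calf F \<Longrightarrow> cN ((mul phi ^^ j) F) \<le> cN F"
proof (induction j)
  case (Suc j)
  then show ?case using cN_phi[OF calf_phi_pow[OF Suc.prems, of j]] by (simp del: mul_apply)
qed simp

lemma phi_pow_add: "(mul phi ^^ j) (F + G) = (mul phi ^^ j) F + (mul phi ^^ j) G"
  by (induction j) (simp_all add: mul_add del: plus_fun_apply mul_apply)

lemma phi_pow_signed_sum: "(mul phi ^^ j) (signed_sum \<epsilon> N F) = signed_sum \<epsilon> N (\<lambda>i. (mul phi ^^ j) (F i))"
  by (induction j) (simp_all add: mul_signed_sum del: mul_apply)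

lemma l2n_le_cN:
  assumes "calf F" "finite {n. F (1/2) n \<noteq> 0}" shows "l2n (F (1/2)) \<le> cN F"
  using jet_l2_bound[OF assms, of 0] by (simp add: l2n_def)

lemma qn_cmult_ge:
  assumes "calf F" "c > 0" shows "c * qn r F \<le> qn r (mul (\<lambda>z. complex_of_real c) F)"
proof -
  have "F = mul (\<lambda>z. complex_of_real (1 / c)) (mul (\<lambda>z. complex_of_real c) F)"
    using assms by (simp add: fun_eq_iff)
  then have "qn r F \<le> cmod (complex_of_real (1 / c)) * qn r (mul (\<lambda>z. complex_of_real c) F)"
    using qn_cmult[OF calf_cmult[OF assms(1)], of r "complex_of_real (1 / c)"] by metis
  then show ?thesis using assms by (simp add: norm_divide field_simps)
qed

lemma signed_sum_single:
  assumes "i < N" "\<And>j. j < N \<Longrightarrow> j \<noteq> i \<Longrightarrow> F j = 0"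
  shows "signed_sum \<epsilon> N F = sg (\<epsilon> i) (F i)"
proof -
  have "signed_sum \<epsilon> N F = (\<Sum>j\<in>{i}. sg (\<epsilon> j) (F j))"
    unfolding signed_sum_def by (rule sum.mono_neutral_right) (use assms in \<open>auto simp: sg_def\<close>)
  then show ?thesis by simp
qed

text \<open>Multiplication by \<open>ex (- k ln 2)\<close> balances the two boundary norms \<open>K\<close> and
  \<open>2\<^sup>k K\<close> of a sum of \<open>2\<^sup>k\<close> disjoint blocks.\<close>

lemma block_estimates:
  fixes W :: "nat \<Rightarrow> complex \<Rightarrow> cseq" and k :: nat and \<epsilon> :: "nat \<Rightarrow> bool"
  assumes W: "\<And>i. i < 2 ^ k \<Longrightarrow> calf (W i)" "\<And>i. i < 2 ^ k \<Longrightarrow> cN (W i) \<le> K"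
    and A: "\<And>i. i < 2 ^ k \<Longrightarrow> finite (A i)" "\<And>i z n. \<lbrakk>i < 2 ^ k; n \<notin> A i\<rbrakk> \<Longrightarrow> W i z n = 0"
      "\<And>i j. \<lbrakk>i < j; j < 2 ^ k\<rbrakk> \<Longrightarrow> A i \<inter> A j = {}"
    and \<delta>: "\<And>i. i < 2 ^ k \<Longrightarrow> \<delta> \<le> l2n (W i (1/2))" "0 \<le> \<delta>"
  defines "G \<equiv> mul (ex (- (k * ln 2))) (signed_sum \<epsilon> (2 ^ k) W)"
  shows "calf G" "cN G \<le> K * sqrt (2 ^ k)" "\<delta> / 36 * sqrt (2 ^ k) \<le> qn 3 (mul phi (mul phi G))"
    "jeq 3 (signed_sum \<epsilon> (2 ^ k) W) (G + mul (\<lambda>z. of_real (3/2 * (k * ln 2))) (mul phi G) +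
     mul (\<lambda>z. of_real (9/8 * (k * ln 2)\<^sup>2 + 3/2 * (k * ln 2))) (mul phi (mul phi G)))"
proof -
  define F where "F = signed_sum \<epsilon> (2 ^ k) W"
  define L where "L = k * ln 2"
  define q where "q = sqrt (2 ^ k)"
  have q: "q > 0" "q * q = 2 ^ k" by (simp_all add: q_def)
  \<comment> \<open>\<open>L\<close> is chosen so that \<open>ex (- L)\<close> has modulus
    \<open>sqrt (2 ^ k)\<close> on \<open>Re z = 0\<close> and its inverse on
    \<open>Re z = 1\<close>.\<close>
  have "exp (L / 2) * exp (L / 2) = 2 ^ k"
    by (simp add: L_def exp_add[symmetric] exp_of_nat_mult)
  then have expL: "exp (L / 2) = q"
    by (simp add: q_def real_sqrt_unique power2_eq_square)
  have expL': "exp (- L / 2) = 1 / q" using expL by (simp add: exp_minus inverse_eq_divide)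
  have F: "calf F" unfolding F_def by (intro calf_signed_sum W)
  show G: "calf G" unfolding G_def F_def[symmetric] by (intro calf_mul F) simp
  have GF: "G = mul (ex (- L)) F" by (simp add: G_def F_def L_def)
  have FG: "F = mul (ex L) G" using mul_ex_inverse[of "- L" F] unfolding GF by simp
  have disj: "A i \<inter> A j = {}" if "i \<noteq> j" "i < 2 ^ k" "j < 2 ^ k" for i j
    using A(3)[of i j] A(3)[of j i] that by (cases "i < j") auto
  have Feq: "F z n = sg (\<epsilon> i) (W i z n)" if "i < 2 ^ k" "n \<in> A i" for z n i
    unfolding F_def signed_sum_apply
    by (rule signed_sum_single[OF that(1)]) (use A(2) disj[of _ i] that in blast)
  have K0: "0 \<le> K" using W(2)[of 0] cN_nonneg[OF W(1)[of 0]] by simp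
  \<comment> \<open>Disjointness enters here: at each coordinate at most one block is active, so the
    sup norm does not grow with the number of blocks.\<close>
  have side0: "cmod (F (Complex 0 t) n) \<le> K" for t n
  proof (cases "\<exists>i<2 ^ k. n \<in> A i")
    case True
    then obtain i where i: "i < 2 ^ k" "n \<in> A i" by blast
    then show ?thesis using Feq[OF i] cN_side0[OF W(1)[OF i(1)], of t n] W(2)[OF i(1)] by simp
  next
    case False
    then have "signed_sum \<epsilon> (2 ^ k) (\<lambda>i. W i (Complex 0 t) n) = 0"
      unfolding signed_sum_def using A(2) by (intro sum.neutral) (auto simp: sg_def)
    then have "F (Complex 0 t) n = 0" by (simp only: F_def signed_sum_apply)
    then show ?thesis using K0 by simp
  qed
  have "cN F \<le> real (2 ^ k) * K" unfolding F_def by (rule cN_signed_sum) (use W in auto)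
  then have side1: "(\<Sum>n. cmod (F (Complex 1 t) n)) \<le> q * q * K" for t
    using cN_side1[OF F, of t] q by simp
  show "cN G \<le> K * sqrt (2 ^ k)"
    unfolding GF q_def[symmetric]
  proof (rule cN_mul[OF F])
    show "cmod (ex (- L) (Complex 0 t)) \<le> q" "cmod (ex (- L) (Complex 1 t)) \<le> 1 / q" for t
      using expL expL' by (simp_all add: cmod_ex)
    show "q * cmod (F (Complex 0 t) n) \<le> K * q" for t n using side0[of t n] q by (simp add: mult.commute)
    show "1 / q * (\<Sum>n. cmod (F (Complex 1 t) n)) \<le> K * q" for t
    proof -
      have "1 / q * (\<Sum>n. cmod (F (Complex 1 t) n)) \<le> 1 / q * (q * q * K)"
        using side1[of t] q(1) by (intro mult_left_mono) auto
      also have "\<dots> = K * q" using q(1) by simp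
      finally show ?thesis .
    qed
  qed
  show "jeq 3 (signed_sum \<epsilon> (2 ^ k) W) (G + mul (\<lambda>z. of_real (3/2 * (k * ln 2))) (mul phi G) +
     mul (\<lambda>z. of_real (9/8 * (k * ln 2)\<^sup>2 + 3/2 * (k * ln 2))) (mul phi (mul phi G)))"
    using jeq_ex[OF G, of L, folded FG] unfolding F_def L_def .
  show "\<delta> / 36 * sqrt (2 ^ k) \<le> qn 3 (mul phi (mul phi G))"
  proof (rule qn_geI)
    show "calf (mul phi (mul phi G))" using G by (intro calf_mul) auto
    fix H assume H: "calf H" "jeq 3 H (mul phi (mul phi G))"
    have G0: "jet 0 G n = F (1/2) n" for n by (simp add: GF)
    have pG: "calf (mul phi G)" using G by (intro calf_mul) auto
    \<comment> \<open>The factor \<open>4/9\<close> is the square of the derivative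
      \<open>2/3\<close> of \<open>phi\<close> at \<open>1/2\<close>. The second-order case of
      \<open>jet_l2_bound\<close> costs 16, which gives \<open>4/9 / 16 = 1/36\<close>.\<close>
    have j: "jet 0 H n = 0" "jet (Suc 0) H n = 0" "jet (Suc (Suc 0)) H n = 4/9 * F (1/2) n" for n
      using H(2) G pG by (simp_all add: jeq_3_iff jet_mul_012 G0 del: jet_0)
    define B where "B = (\<Union>i<2 ^ k. A i)"
    have finB: "finite B" unfolding B_def using A by auto
    have a: "sqrt (\<Sum>n\<in>B. (cmod (jet 2 H n))\<^sup>2) \<le> 4 ^ 2 * cN H"
    proof (rule jet_l2_bound[OF H(1) finB])
      show "jet i H n = 0" if "i < 2" for i n using that j by (auto simp: less_Suc_eq numeral_2_eq_2)
    qed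
    have b: "(\<Sum>n\<in>B. (cmod (jet 2 H n))\<^sup>2) = (4/9)\<^sup>2 * (\<Sum>n\<in>B. (cmod (F (1/2) n))\<^sup>2)"
      by (simp add: j numeral_2_eq_2[symmetric] sum_distrib_left norm_mult power_mult_distrib norm_divide
           flip: numeral_2_eq_2) (simp add: numeral_2_eq_2 j norm_mult norm_divide power_mult_distrib sum_distrib_left)
    have c: "2 ^ k * \<delta>\<^sup>2 \<le> (\<Sum>n\<in>B. (cmod (F (1/2) n))\<^sup>2)"
    proof -
      have "(\<Sum>n\<in>B. (cmod (F (1/2) n))\<^sup>2) = (\<Sum>i<2 ^ k. \<Sum>n\<in>A i. (cmod (F (1/2) n))\<^sup>2)"
        unfolding B_def by (intro sum.UNION_disjoint) (use A disj in auto)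
      also have "\<dots> = (\<Sum>i<2 ^ k. (l2n (W i (1/2)))\<^sup>2)"
      proof (rule sum.cong)
        fix i assume "i \<in> {..<(2::nat) ^ k}"
        then have i: "i < 2 ^ k" by simp
        have "l2n (W i (1/2)) = sqrt (\<Sum>n\<in>A i. (cmod (W i (1/2) n))\<^sup>2)"
          using A i by (intro l2n_eq) auto
        then show "(\<Sum>n\<in>A i. (cmod (F (1/2) n))\<^sup>2) = (l2n (W i (1/2)))\<^sup>2"
          by (simp add: Feq[OF i] sum_nonneg)
      qed simp
      also have "\<dots> \<ge> (\<Sum>i<(2::nat) ^ k. \<delta>\<^sup>2)" using \<delta> by (intro sum_mono power_mono) auto
      finally show ?thesis by simp
    qed
    have "sqrt ((4/9)\<^sup>2 * (2 ^ k * \<delta>\<^sup>2)) \<le> sqrt ((4/9)\<^sup>2 * (\<Sum>n\<in>B. (cmod (F (1/2) n))\<^sup>2))"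
      by (intro real_sqrt_le_mono mult_left_mono c) simp
    also have "\<dots> \<le> 16 * cN H" using a unfolding b by simp
    finally have "4/9 * (q * \<delta>) \<le> 16 * cN H"
      using \<delta>(2) by (simp add: real_sqrt_mult q_def)
    then show "\<delta> / 36 * sqrt (2 ^ k) \<le> cN H" by (simp add: q_def mult.commute)
  qed
qed

section \<open>Approximation by blocks\<close>

text \<open>The sequence \<open>V\<close> is, up to a null sequence in \<open>Z\<^sub>3\<close>, the image under \<open>\<Phi>\<^sup>j\<close> of blocks moving
  off to infinity.\<close>

definition blocks :: "nat \<Rightarrow> (nat \<Rightarrow> complex \<Rightarrow> cseq) \<Rightarrow> (nat \<Rightarrow> complex \<Rightarrow> cseq) \<Rightarrow> real \<Rightarrow> bool" where
  "blocks j V W K \<longleftrightarrow> (\<forall>n. calf (V n)) \<and> (\<forall>n. calf (W n)) \<and> (\<forall>n. cN (W n) \<le> K) \<and>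
     (\<forall>n. \<exists>A. finite A \<and> A \<subseteq> {n..} \<and> (\<forall>z i. i \<notin> A \<longrightarrow> W n z i = 0)) \<and>
     (\<lambda>n. qn 3 (V n - (mul phi ^^ j) (W n))) \<longlonglongrightarrow> 0"

text \<open>If the values at \<open>1/2\<close> are negligible, they can be removed by subtracting their lifts, after
  which the blocks are divisible by \<open>phi\<close>.\<close>

lemma blocks_step:
  assumes V: "blocks j V W K" and lim: "(\<lambda>n. l2n (W n (1/2))) \<longlonglongrightarrow> 0"
  shows "\<exists>W'. blocks (Suc j) V W' (12 * K)"
proof -
  note D = V[unfolded blocks_def]
  \<comment> \<open>12 is \<open>4 * 3\<close>: subtracting the lift costs at most
    \<open>2 * K\<close> in addition to \<open>K\<close>, and division by \<open>phi\<close> costs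
    4.\<close>
  have "\<exists>W'. calf W' \<and> cN W' \<le> 12 * K \<and> (\<exists>A. finite A \<and> A \<subseteq> {n..} \<and> (\<forall>z i. i \<notin> A \<longrightarrow> W' z i = 0)) \<and>
     qn 3 (V n - (mul phi ^^ Suc j) W') \<le> qn 3 (V n - (mul phi ^^ j) (W n)) + 2 * l2n (W n (1/2))" for n
  proof -
    define x where "x = W n (1/2)"
    have W: "calf (W n)" "cN (W n) \<le> K" "calf (V n)" using D by auto
    obtain A where A: "finite A" "A \<subseteq> {n..}" "\<And>z i. i \<notin> A \<Longrightarrow> W n z i = 0" using D by metis
    have "{i. x i \<noteq> 0} \<subseteq> A" using A(3) by (auto simp: x_def)
    then have fin: "finite {i. x i \<noteq> 0}" using A(1) finite_subset by blast
    have lx: "l2n x \<le> K" using l2n_le_cN[OF W(1)] fin W(2) by (simp add: x_def)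
    note lf = calf_lift[OF fin] cN_lift[OF fin]
    define H where "H = W n - lift x"
    have H: "calf H" unfolding H_def by (intro calf_diff W lf)
    have cH: "cN H \<le> 3 * K"
    proof -
      have "cN H \<le> cN (W n) + cN (- lift x)"
        using cN_add[OF W(1) calf_uminus[OF lf(1)]] by (simp add: H_def)
      then show ?thesis using cN_uminus[OF lf(1)] lf(2) lx W(2) by linarith
    qed
    have H0: "H (1/2) = 0" by (simp only: H_def minus_apply lift_half x_def diff_self)
    have HA: "H z i = 0" if "i \<notin> A" for z i
      using A(3)[OF that] that by (simp add: H_def lift_eq_0 x_def)
    obtain W' where W': "calf W'" "H = mul phi W'" "cN W' \<le> 4 * cN H" "\<And>z i. i \<notin> A \<Longrightarrow> W' z i = 0"
      using phi_division[OF H A(1) HA H0] by metis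
    have "W n = lift x + mul phi W'" using W'(2) by (simp add: H_def algebra_simps)
    then have "(mul phi ^^ j) (W n) = (mul phi ^^ j) (lift x) + (mul phi ^^ Suc j) W'"
      by (simp only: phi_pow_add funpow_Suc_right o_apply)
    then have "V n - (mul phi ^^ Suc j) W' = (V n - (mul phi ^^ j) (W n)) + (mul phi ^^ j) (lift x)"
      by (simp only: algebra_simps)
    then have "qn 3 (V n - (mul phi ^^ Suc j) W') \<le> qn 3 (V n - (mul phi ^^ j) (W n)) + qn 3 ((mul phi ^^ j) (lift x))"
      using W lf by (metis qn_add calf_diff calf_phi_pow)
    also have "qn 3 ((mul phi ^^ j) (lift x)) \<le> 2 * l2n x"
      using qn_le_cN[OF calf_phi_pow[OF lf(1)], of 3 j] cN_phi_pow[OF lf(1), of j] lf(2) by linarith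
    finally have le: "qn 3 (V n - (mul phi ^^ Suc j) W') \<le> qn 3 (V n - (mul phi ^^ j) (W n)) + 2 * l2n x"
      by (simp only: add_left_mono)
    have "cN W' \<le> 12 * K" using W'(3) cH by linarith
    moreover have "\<exists>A. finite A \<and> A \<subseteq> {n..} \<and> (\<forall>z i. i \<notin> A \<longrightarrow> W' z i = 0)"
      using A(1,2) W'(4) by blast
    ultimately show ?thesis using W'(1) le unfolding x_def by blast
  qed
  then obtain W' where W': "\<And>n. calf (W' n)" "\<And>n. cN (W' n) \<le> 12 * K"
     "\<And>n. \<exists>A. finite A \<and> A \<subseteq> {n..} \<and> (\<forall>z i. i \<notin> A \<longrightarrow> W' n z i = 0)"
     "\<And>n. qn 3 (V n - (mul phi ^^ Suc j) (W' n)) \<le> qn 3 (V n - (mul phi ^^ j) (W n)) + 2 * l2n (W n (1/2))"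
    by metis
  have "(\<lambda>n. qn 3 (V n - (mul phi ^^ Suc j) (W' n))) \<longlonglongrightarrow> 0"
  proof (rule tendsto_sandwich[OF _ _ tendsto_const])
    show "(\<lambda>n. qn 3 (V n - (mul phi ^^ j) (W n)) + 2 * l2n (W n (1/2))) \<longlonglongrightarrow> 0"
      using tendsto_add[OF _ tendsto_mult_left[OF lim, of 2]] D by fastforce
    show "\<forall>\<^sub>F n in sequentially. 0 \<le> qn 3 (V n - (mul phi ^^ Suc j) (W' n))"
      using D W'(1) by (intro always_eventually allI qn_nonneg calf_diff calf_phi_pow) auto
  qed (use W'(4) in auto)
  then show ?thesis using W' D unfolding blocks_def by blast
qed

text \<open>The third power of \<open>phi\<close> annihilates 2-jets, so the blocks vanish in the
  quotient and \<open>V\<close> itself would be a null sequence.\<close>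

lemma not_blocks_3:
  assumes V: "blocks 3 V W K" shows "\<not> (\<forall>n. qn 3 (V n) \<ge> 1)"
proof
  assume 1: "\<forall>n. qn 3 (V n) \<ge> 1"
  note D = V[unfolded blocks_def]
  have "1 \<le> qn 3 (V n - (mul phi ^^ 3) (W n))" for n
  proof -
    have "(mul phi ^^ 3) (W n) = mul phi (mul phi (mul phi (W n)))" by (simp only: numeral_3_eq_3 funpow.simps o_apply id_apply)
    then have "jeq 3 ((mul phi ^^ 3) (W n)) 0" using jeq_phi3[of "W n"] D by metis
    then have "qn 3 ((mul phi ^^ 3) (W n)) \<le> cN 0" by (intro qn_leI calf_0) (rule jeq_sym)
    moreover have "calf (V n)" "calf ((mul phi ^^ 3) (W n))" using D calf_phi_pow by blast+
    note qn_triangle[OF this, of 3]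
    moreover have "1 \<le> qn 3 (V n)" using 1 by blast
    ultimately show ?thesis using cN_0 by linarith
  qed
  moreover have "(\<lambda>n. qn 3 (V n - (mul phi ^^ 3) (W n))) \<longlonglongrightarrow> 0" using D by blast
  ultimately have "(1::real) \<le> 0" by (intro tendsto_lowerbound) auto
  then show False by simp
qed

text \<open>The gliding hump: an element whose jets vanish on the first \<open>n\<close> coordinates
  is normalised, represented with norm below 2 and cut off on the right at a negligible cost by
  \<open>qn_tail\<close>.\<close>

lemma blocks_0:
  assumes S: "\<And>F. F \<in> S \<Longrightarrow> calf F" "\<And>F c. F \<in> S \<Longrightarrow> mul (\<lambda>z. c) F \<in> S"
      "\<And>F G. \<lbrakk>F \<in> S; calf G; jeq 3 G F\<rbrakk> \<Longrightarrow> G \<in> S"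
    and nz: "\<And>m. \<exists>F\<in>S. (\<forall>k<3. \<forall>n<m. jet k F n = 0) \<and> qn 3 F > 0"
  shows "\<exists>V W. blocks 0 V W 2 \<and> (\<forall>n. V n \<in> S \<and> qn 3 (V n) \<ge> 1)"
proof -
  have "\<exists>V W. calf W \<and> cN W \<le> 2 \<and> (\<exists>A. finite A \<and> A \<subseteq> {n..} \<and> (\<forall>z i. i \<notin> A \<longrightarrow> W z i = 0)) \<and>
     qn 3 (V - W) \<le> 1 / Suc n \<and> V \<in> S \<and> qn 3 V \<ge> 1" for n
  proof -
    obtain F where F: "F \<in> S" "\<And>k i. k < 3 \<Longrightarrow> i < n \<Longrightarrow> jet k F i = 0" "qn 3 F > 0" using nz[of n] by metis
    define U where "U = mul (\<lambda>z. complex_of_real (1 / qn 3 F)) F"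
    have calfF: "calf F" by (rule S(1)[OF F(1)])
    have US: "U \<in> S" unfolding U_def by (rule S(2)[OF F(1)])
    note U = US S(1)[OF US]
    have "cmod (complex_of_real (1 / qn 3 F)) = 1 / qn 3 F" using F(3) by (simp add: norm_divide)
    then have "qn 3 U \<le> 1" using qn_cmult[OF calfF, of 3 "complex_of_real (1 / qn 3 F)"] F(3) by (simp add: U_def)
    then obtain V where V: "calf V" "jeq 3 V U" "cN V < 2" using qn_obtain[OF U(2), of 3 2] by auto
    have "1 / qn 3 F * qn 3 F \<le> qn 3 U" unfolding U_def by (rule qn_cmult_ge) (use calfF F in auto)
    then have "qn 3 V \<ge> 1" using F(3) qn_cong[OF V(2)] by simp
    moreover have "V \<in> S" using S(3)[OF U(1) V(1,2)] .
    moreover have V0: "jet k V i = 0" if "k < 3" "i < n" for k i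
    proof -
      have "jet k V i = jet k U i" using V(2) that by (simp add: jeq_def)
      also have "\<dots> = complex_of_real (1 / qn 3 F) * jet k F i" unfolding U_def by (rule jet_cmult[OF calfF])
      finally show ?thesis using F(2)[OF that] by simp
    qed
    obtain M where M: "\<And>M'. M' \<ge> M \<Longrightarrow> qn 3 (restr {M'..} V) < 1 / Suc n" using qn_tail[OF V(1), of "1 / Suc n"] by auto
    define M' where "M' = max M n"
    define W where "W = restr {n..<M'} V"
    have "calf W" unfolding W_def by (rule calf_restr[OF V(1)])
    moreover have "cN W \<le> 2" using cN_restr[OF V(1), of "{n..<M'}"] V(3) by (simp add: W_def)
    \<comment> \<open>The representative may be nonzero on coordinates below \<open>n\<close>;
      cutting them off is free because their jets are zero.\<close>
    moreover have "jeq 3 (V - W) (restr {M'..} V)"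
      unfolding jeq_def
    proof (intro allI impI ext)
      fix k i assume k: "k < (3::nat)"
      show "jet k (V - W) i = jet k (restr {M'..} V) i"
        using V0[OF k, of i] \<open>calf W\<close> V(1) by (simp add: jet_diff W_def jet_restr M'_def max_def)
    qed
    then have "qn 3 (V - W) = qn 3 (restr {M'..} V)" by (rule qn_cong)
    then have "qn 3 (V - W) \<le> 1 / Suc n" using M[of M'] by (simp add: M'_def)
    moreover have "\<exists>A. finite A \<and> A \<subseteq> {n..} \<and> (\<forall>z i. i \<notin> A \<longrightarrow> W z i = 0)"
      by (intro exI[of _ "{n..<M'}"]) (auto simp: W_def)
    ultimately show ?thesis by blast
  qed
  then obtain V W where VW: "\<And>n. calf (W n)" "\<And>n. cN (W n) \<le> 2"
     "\<And>n. \<exists>A. finite A \<and> A \<subseteq> {n..} \<and> (\<forall>z i. i \<notin> A \<longrightarrow> W n z i = 0)"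
     "\<And>n. qn 3 (V n - W n) \<le> 1 / Suc n" "\<And>n. V n \<in> S" "\<And>n. qn 3 (V n) \<ge> 1"
    by metis
  have "(\<lambda>n. qn 3 (V n - W n)) \<longlonglongrightarrow> 0"
  proof (rule tendsto_sandwich[OF _ _ tendsto_const])
    show "(\<lambda>n. 1 / Suc n) \<longlonglongrightarrow> 0" using LIMSEQ_Suc[OF lim_1_over_n] by simp
  qed (use VW S(1)[OF VW(5)] in \<open>auto intro!: always_eventually qn_nonneg calf_diff\<close>)
  then have "blocks 0 V W 2" unfolding blocks_def using VW S(1)[OF VW(5)] by simp
  with VW(5,6) show ?thesis by blast
qed

text \<open>Bounds \<open>sqrt (2 ^ k) / k\<close> below, so that even this smallest of the three
  growth orders absorbs a bounded perturbation.\<close>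

lemma real_le_two_sqrt_power: "real k \<le> 2 * sqrt (2 ^ k)"
proof -
  have "k * k \<le> 4 * 2 ^ k"
  proof (induction k)
    case (Suc k)
    have "k < 2 ^ k" by (rule less_exp)
    then show ?case using Suc.IH by (simp only: mult_Suc mult_Suc_right power_Suc)
  qed simp
  then have "real (k * k) \<le> real (4 * 2 ^ k)" by (simp only: of_nat_le_iff)
  then have "(real k)\<^sup>2 \<le> (2 * sqrt (2 ^ k))\<^sup>2" by (simp add: power2_eq_square)
  then show ?thesis by (rule power2_le_imp_le) simp
qed

section \<open>The growth argument\<close>

text \<open>Stands for \<open>F\<close> mapped to the norm of the image of its 2-jet under an
  operator. Pulling the target norm back to Calderon functions makes the growth argument independent
  of the target.\<close>

locale sign_type_seminorm =
  fixes p :: "(complex \<Rightarrow> cseq) \<Rightarrow> real" and Kp :: real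
  assumes p_add: "\<lbrakk>calf F; calf G\<rbrakk> \<Longrightarrow> p (F + G) \<le> p F + p G"
    and p_cmult: "calf F \<Longrightarrow> p (mul (\<lambda>z. c) F) \<le> cmod c * p F"
    and p_nonneg: "calf F \<Longrightarrow> 0 \<le> p F"
    and p_qn: "calf F \<Longrightarrow> p F \<le> Kp * qn 3 F"
    and Kp: "Kp \<ge> 0"
    and sign_type: "sign_type {F. calf F} p"
begin

lemma p_cN: "calf F \<Longrightarrow> p F \<le> Kp * cN F"
  using p_qn[of F] qn_le_cN[of F 3] Kp mult_left_mono order_trans by metis

lemma p_uminus: "calf F \<Longrightarrow> p (- F) \<le> p F"
  using p_cmult[of F "-1"] by (simp add: uminus_eq_mul)

lemma p_diff: "calf F \<Longrightarrow> calf G \<Longrightarrow> p (F - G) \<le> p F + p G"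
  using p_add[of F "- G"] p_uminus[of G] calf_uminus[of G] by simp

lemma p_triangle: "calf F \<Longrightarrow> calf G \<Longrightarrow> p F \<le> p (F - G) + p G"
  using p_add[of "F - G" G] calf_diff[of F G] by simp

text \<open>Being dominated by the quotient seminorm, \<open>p\<close> depends on jets only; a
  function may thus be exchanged for its expansion in \<open>phi\<close>.\<close>

lemma p_jeq:
  assumes "calf F" "calf G" "jeq 3 F G" shows "p F = p G"
proof -
  have "p F \<le> p G" if "calf F" "calf G" "jeq 3 F G" for F G
  proof -
    have "jeq 3 (F - G) 0"
      unfolding jeq_def
    proof (intro allI impI ext)
      fix k n assume "k < (3::nat)"
      then show "jet k (F - G) n = jet k 0 n" using that
        by (simp add: jet_diff jeq_def) (simp add: jet_def)
    qed
    then have "qn 3 (F - G) \<le> cN 0" by (intro qn_leI calf_0) (rule jeq_sym)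
    then have "qn 3 (F - G) = 0" using qn_nonneg[OF calf_diff, of F G 3] that by simp
    then have "p (F - G) \<le> 0" using p_qn[OF calf_diff, of F G] that by simp
    then show ?thesis using p_triangle[of F G] that by linarith
  qed
  then show ?thesis using assms jeq_sym by (metis antisym)
qed


text \<open>Otherwise infinitely many blocks have \<open>\<ell>\<^sub>2\<close> norm at least
  \<open>\<delta>\<close> at \<open>1/2\<close>. A signed sum of \<open>2 ^ k\<close> of them with
  disjoint supports has a quotient norm exceeding \<open>p\<close> by a factor of order
  \<open>k\<close>, for each \<open>j\<close>, which contradicts the lower bound on \<open>S\<close>
  for large \<open>k\<close>.\<close>

lemma blocks_small:
  assumes V: "blocks j V W K" and j: "j \<le> 2" and VS: "\<And>n. V n \<in> S"
    and S: "\<And>F. F \<in> S \<Longrightarrow> calf F" "\<And>F c. F \<in> S \<Longrightarrow> mul (\<lambda>z. c) F \<in> S"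
      "\<And>F G. \<lbrakk>F \<in> S; G \<in> S\<rbrakk> \<Longrightarrow> F + G \<in> S"
    and B: "\<And>F. F \<in> S \<Longrightarrow> qn 3 F \<le> B * p F" "B \<ge> 0"
  shows "(\<lambda>n. l2n (W n (1/2))) \<longlonglongrightarrow> 0"
proof (rule ccontr)
  assume "\<not> (\<lambda>n. l2n (W n (1/2))) \<longlonglongrightarrow> 0"
  then obtain \<delta> where \<delta>: "\<delta> > 0" "\<And>m. \<exists>n\<ge>m. \<delta> \<le> l2n (W n (1/2))"
    unfolding LIMSEQ_def by (auto simp: not_less l2n_nonneg)
  note D = V[unfolded blocks_def]
  have calfW: "calf (W n)" "cN (W n) \<le> K" "calf (V n)" for n using D by auto
  have K: "0 \<le> K" using calfW(2)[of 0] cN_nonneg[OF calfW(1)[of 0]] by linarith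
  obtain A where A: "\<And>n. finite (A n)" "\<And>n. A n \<subseteq> {n..}" "\<And>n z i. i \<notin> A n \<Longrightarrow> W n z i = 0"
    using D by metis
  obtain C where C: "C \<ge> 0" "\<And>k R F. k \<ge> 1 \<Longrightarrow> R \<ge> 0 \<Longrightarrow> (\<And>i. i < 2 ^ k \<Longrightarrow> calf (F i) \<and> p (F i) \<le> R) \<Longrightarrow>
      \<exists>\<epsilon>. p (signed_sum \<epsilon> (2 ^ k) F) \<le> C * R * real k * sqrt (2 ^ k)"
    using sign_type unfolding sign_type_def by fastforce
  define R where "R = Kp * K"
  have R: "R \<ge> 0" using K Kp by (simp add: R_def)
  define c where "c = \<delta> / 36"
  have c: "c > 0" using \<delta> by (simp add: c_def)
  \<comment> \<open>\<open>D1 / 4\<close> is \<open>C * R + R + 3/2 * R\<close>, from solving the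
    expansion for its last term, and the 4 comes from \<open>c2 \<ge> k\<^sup>2 / 4\<close>.
    \<open>D2\<close> dominates the constants of all three cases of \<open>j\<close>:
    \<open>C * R\<close>, \<open>R + 3/2 * D1\<close> and \<open>D1\<close>.\<close>
  define D1 where "D1 = 4 * C * R + 10 * R"
  define D2 where "D2 = C * R + R + 3/2 * D1"
  have D12: "D1 \<ge> 0" "D1 \<le> D2" "C * R \<le> D2" "R + 3/2 * D1 \<le> D2" "0 \<le> C * R"
    using C(1) R by (auto simp: D1_def D2_def)
  define E where "E = B * Kp + 1"
  have E: "E \<ge> 1" using B(2) Kp by (simp add: E_def)
  \<comment> \<open>\<open>k\<close> is fixed before the blocks, since the accuracy
    \<open>1 / 2 ^ k\<close> demanded of each block depends on it; the total error of the signed sum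
    is then at most 1. The threshold is the one violated by the final inequality.\<close>
  obtain k :: nat where k: "4 / c * (5/2 * K + B * D2 + 2 * E) < real k" using reals_Archimedean2 by blast
  have "0 \<le> 4 / c * (5/2 * K + B * D2 + 2 * E)" using c K B(2) D12 E by simp
  then have k1: "k \<ge> 1" "real k \<ge> 1" using k by (cases k; simp)+
  define P where "P = (\<lambda>n. \<delta> \<le> l2n (W n (1/2)) \<and> qn 3 (V n - (mul phi ^^ j) (W n)) \<le> 1 / 2 ^ k)"
  have P: "\<exists>n\<ge>m. P n" for m
  proof -
    have "(\<lambda>n. qn 3 (V n - (mul phi ^^ j) (W n))) \<longlonglongrightarrow> 0" using D by blast
    then have "\<forall>\<^sub>F n in sequentially. dist (qn 3 (V n - (mul phi ^^ j) (W n))) 0 < 1 / 2 ^ k"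
      by (rule tendstoD) simp
    then obtain m' where "\<forall>n\<ge>m'. dist (qn 3 (V n - (mul phi ^^ j) (W n))) 0 < 1 / 2 ^ k"
      unfolding eventually_sequentially by blast
    then have "qn 3 (V n - (mul phi ^^ j) (W n)) < 1 / 2 ^ k" if "n \<ge> m'" for n
      using that by (fastforce simp: dist_real_def)
    moreover obtain n where "n \<ge> max m m'" "\<delta> \<le> l2n (W n (1/2))" using \<delta>(2) by blast
    ultimately show ?thesis by (intro exI[of _ n]) (auto simp: P_def less_imp_le)
  qed
  \<comment> \<open>Each index is taken beyond the support of the preceding block; as
    \<open>W n\<close> lives on \<open>{n..}\<close>, the chosen blocks are disjoint.\<close>
  have "\<exists>f. \<forall>i. P (f i) \<and> (f i < f (Suc i) \<and> A (f i) \<subseteq> {..<f (Suc i)})"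
  proof (rule dependent_nat_choice)
    show "\<exists>x. P x" using P by blast
    fix x and i :: nat
    obtain y where "y \<ge> Suc (Max (insert x (A x)))" "P y" using P by blast
    then have "\<forall>a\<in>insert x (A x). a < y" using A(1)[of x] by (auto simp: Suc_le_eq)
    then show "\<exists>y. P y \<and> (x < y \<and> A x \<subseteq> {..<y})" using \<open>P y\<close> by blast
  qed
  then obtain f where f: "\<And>i. P (f i)" "\<And>i. f i < f (Suc i)" "\<And>i. A (f i) \<subseteq> {..<f (Suc i)}" by blast
  have disj: "A (f i) \<inter> A (f i') = {}" if "i < i'" for i i'
  proof -
    have "strict_mono f" using f(2) by (simp add: strict_mono_Suc_iff)
    then have le: "f (Suc i) \<le> f i'" using that by (simp add: strict_mono_less_eq Suc_le_eq)
    have "False" if a: "a \<in> A (f i)" "a \<in> A (f i')" for a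
    proof -
      have "a < f (Suc i)" using f(3)[of i] a(1) by blast
      moreover have "f i' \<le> a" using A(2)[of "f i'"] a(2) by blast
      ultimately show False using le by linarith
    qed
    then show ?thesis by blast
  qed
  define W' where "W' = (\<lambda>i. W (f i))"
  define V' where "V' = (\<lambda>i. V (f i))"
  \<comment> \<open>The signs are adapted to the blocks themselves, also when
    \<open>j > 0\<close>.\<close>
  obtain \<epsilon> where \<epsilon>: "p (signed_sum \<epsilon> (2 ^ k) W') \<le> C * R * real k * sqrt (2 ^ k)"
  proof -
    have "p (W' i) \<le> R" for i
      using p_cN[OF calfW(1)[of "f i"]] mult_left_mono[OF calfW(2)[of "f i"] Kp] by (simp add: W'_def R_def)
    then show ?thesis using C(2)[OF k1(1) R, of W'] calfW(1) that by (auto simp: W'_def)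
  qed
  define F where "F = signed_sum \<epsilon> (2 ^ k) W'"
  define Vs where "Vs = signed_sum \<epsilon> (2 ^ k) V'"
  define Q where "Q = sqrt (2 ^ k)"
  define L where "L = real k * ln 2"
  define G where "G = mul (ex (- L)) F"
  define c1 where "c1 = 3/2 * L"
  define c2 where "c2 = 9/8 * L\<^sup>2 + 3/2 * L"
  define X1 where "X1 = mul phi G"
  define X2 where "X2 = mul phi X1"
  let ?c1 = "mul (\<lambda>z. complex_of_real c1)" and ?c2 = "mul (\<lambda>z. complex_of_real c2)"
  have be: "calf G" "cN G \<le> K * Q" "c * Q \<le> qn 3 X2" "jeq 3 F (G + ?c1 X1 + ?c2 X2)"
    using block_estimates[of k W' K "\<lambda>i. A (f i)" \<delta> \<epsilon>] calfW A disj f(1) \<delta>(1)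
    unfolding G_def F_def c1_def c2_def L_def X1_def X2_def Q_def c_def by (auto simp: W'_def P_def less_imp_le)
  have F: "calf F" unfolding F_def W'_def by (intro calf_signed_sum calfW)
  have X: "calf X1" "calf X2" unfolding X1_def X2_def by (intro calf_mul be; simp)+
  have cX: "cN X1 \<le> K * Q" "cN X2 \<le> K * Q"
    using cN_phi[OF be(1)] cN_phi[OF X(1)] be(2) by (simp_all only: X1_def[symmetric] X2_def[symmetric])
  have NX: "qn 3 G \<le> K * Q" "qn 3 X1 \<le> K * Q" "qn 3 X2 \<le> K * Q"
    using qn_le_cN[OF be(1), of 3] qn_le_cN[OF X(1), of 3] qn_le_cN[OF X(2), of 3] cX be(2) by linarith+
  have pX: "p G \<le> R * Q" "p X1 \<le> R * Q" "p X2 \<le> R * Q"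
    using p_cN[OF be(1)] p_cN[OF X(1)] p_cN[OF X(2)] mult_left_mono[OF cX(1) Kp] mult_left_mono[OF cX(2) Kp]
      mult_left_mono[OF be(2) Kp] by (simp_all add: R_def)
  have Q: "Q > 0" "real k \<le> 2 * Q" "1 \<le> Q" using real_le_two_sqrt_power[of k] by (simp_all add: Q_def)
  have L: "real k / 2 \<le> L" "L \<le> real k"
    using ln2_ge_two_thirds ln_2_less_1 k1 mult_left_mono[of "1/2" "ln 2" "real k"] mult_left_mono[of "ln 2" 1 "real k"]
    by (simp_all add: L_def)
  have c12: "c1 \<ge> real k / 2" "c1 \<le> 3/2 * real k" "c2 \<ge> (real k)\<^sup>2 / 4" "c2 > 0" "c1 > 0"
  proof -
    show "c1 \<ge> real k / 2" "c1 \<le> 3/2 * real k" "c1 > 0" using L k1 by (simp_all add: c1_def)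
    have "(real k / 2)\<^sup>2 \<le> L\<^sup>2" using L k1 by (intro power_mono) auto
    then have "(real k)\<^sup>2 / 4 \<le> L\<^sup>2" by (simp add: power_divide)
    moreover have "L > 0" "L\<^sup>2 \<ge> 0" using L k1 by auto
    ultimately show "c2 \<ge> (real k)\<^sup>2 / 4" "c2 > 0" unfolding c2_def by linarith+
  qed
  have cc: "calf (?c1 X1)" "calf (?c2 X2)" "calf (?c1 X2)" by (intro calf_cmult X)+
  have jF: "jeq 3 F (G + ?c1 X1 + ?c2 X2)" by (rule be)
  \<comment> \<open>Multiplying by \<open>phi\<close> shifts the expansion and discards its last
    term, cubes of \<open>phi\<close> being invisible to \<open>jeq 3\<close>.\<close>
  have jF1: "jeq 3 (mul phi F) (X1 + ?c1 X2)" and jF2: "jeq 3 (mul phi (mul phi F)) X2"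
    using jF be(1) F X cc unfolding jeq_3_iff X1_def X2_def
    by (simp_all add: jet_add calf_add calf_mul calf_cmult jet_mul_012 jet_cmult algebra_simps del: jet_0)
  have kQ: "0 \<le> real k * Q" using Q by simp
  have pF: "p F \<le> C * R * real k * Q" using \<epsilon> by (simp add: F_def Q_def)
  \<comment> \<open>The key gain: the trivial bound for \<open>p X2\<close> is \<open>R * Q\<close>.
    Solving for the last term of the expansion uses the good signs through \<open>p F\<close>, and
    division by \<open>c2\<close>, of order \<open>k\<^sup>2\<close>, improves the bound to order
    \<open>Q / k\<close>.\<close>
  have p2: "p X2 \<le> D1 * (Q / real k)"
  proof -
    have "?c2 X2 = (G + ?c1 X1 + ?c2 X2) - (G + ?c1 X1)" by simp
    then have "p (?c2 X2) \<le> p (G + ?c1 X1 + ?c2 X2) + p (G + ?c1 X1)"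
      using be(1) cc by (metis p_diff calf_add)
    also have "p (G + ?c1 X1 + ?c2 X2) = p F"
      using jF F be(1) cc by (intro p_jeq[symmetric] calf_add)
    also have "p (G + ?c1 X1) \<le> p G + c1 * p X1"
      using p_add[OF be(1) cc(1)] p_cmult[OF X(1), of "complex_of_real c1"] c12 by simp
    finally have "p (?c2 X2) \<le> C * R * real k * Q + (R * Q + c1 * (R * Q))"
      using pF pX(1) mult_left_mono[OF pX(2) less_imp_le[OF c12(5)]] by linarith
    also have "\<dots> \<le> C * R * real k * Q + (real k * (R * Q) + 3/2 * real k * (R * Q))"
    proof -
      have RQ: "0 \<le> R * Q" using R Q by simp
      show ?thesis using mult_right_mono[OF k1(2) RQ] mult_right_mono[OF c12(2) RQ] by linarith
    qed
    also have "\<dots> = D1 / 4 * (real k * Q)" by (simp add: D1_def algebra_simps)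
    finally have 1: "p (?c2 X2) \<le> D1 / 4 * (real k * Q)" .
    have "X2 = mul (\<lambda>z. complex_of_real (1 / c2)) (?c2 X2)" using c12 by (simp add: fun_eq_iff)
    then have "p X2 \<le> cmod (complex_of_real (1 / c2)) * p (?c2 X2)"
      using p_cmult[OF cc(2), of "complex_of_real (1 / c2)"] by metis
    also have "cmod (complex_of_real (1 / c2)) = 1 / c2" using c12 by (simp add: norm_divide)
    also have "1 / c2 * p (?c2 X2) \<le> 1 / ((real k)\<^sup>2 / 4) * (D1 / 4 * (real k * Q))"
      using c12 k1 by (intro mult_mono 1 divide_left_mono p_nonneg cc) auto
    also have "\<dots> = D1 * (Q / real k)" using k1 by (simp add: power2_eq_square)
    finally show ?thesis .
  qed
  have VsS: "Vs \<in> S"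
  proof -
    have "signed_sum \<epsilon> N V' \<in> S" for N
    proof (induction N)
      case 0
      have "signed_sum \<epsilon> 0 V' = mul (\<lambda>z. 0) (V 0)" by (simp add: signed_sum_def fun_eq_iff)
      then show ?case using S(2)[OF VS] by metis
    next
      case (Suc N)
      have "sg (\<epsilon> N) (V' N) \<in> S"
        using VS S(2)[OF VS, of "-1" "f N"] by (simp add: sg_def V'_def uminus_eq_mul)
      then show ?case using S(3)[OF Suc.IH] by (simp add: signed_sum_def del: plus_fun_apply)
    qed
    then show ?thesis by (simp add: Vs_def)
  qed
  have calfVs: "calf Vs" by (rule S(1)[OF VsS])
  define Fj where "Fj = (mul phi ^^ j) F"
  have calfFj: "calf Fj" unfolding Fj_def by (rule calf_phi_pow[OF F])
  have err: "qn 3 (Vs - Fj) \<le> 1"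
  proof -
    have "Vs - Fj = signed_sum \<epsilon> (2 ^ k) (\<lambda>i. V' i - (mul phi ^^ j) (W' i))"
      by (simp only: signed_sum_diff phi_pow_signed_sum Vs_def Fj_def F_def)
    then have "qn 3 (Vs - Fj) \<le> (\<Sum>i<(2::nat)^k. qn 3 (V' i - (mul phi ^^ j) (W' i)))"
      using qn_signed_sum[of "2 ^ k" "\<lambda>i. V' i - (mul phi ^^ j) (W' i)" 3 \<epsilon>] calfW calf_diff calf_phi_pow
      by (metis V'_def W'_def)
    also have "\<dots> \<le> (\<Sum>i<(2::nat)^k. 1 / 2 ^ k)"
      using f(1) by (intro sum_mono) (simp only: V'_def W'_def P_def)
    finally show ?thesis by simp
  qed
  \<comment> \<open>\<open>E\<close> collects the perturbation: 1 for the quotient norm and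
    \<open>B * Kp\<close> for \<open>p\<close>.\<close>
  have main: "qn 3 Fj \<le> B * p Fj + E"
  proof -
    have "qn 3 (Fj - Vs) = qn 3 (Vs - Fj)"
      using qn_uminus[OF calf_diff[OF calfVs calfFj], of 3] by simp
    then have 1: "qn 3 Fj \<le> 1 + qn 3 Vs" using qn_triangle[OF calfFj calfVs, of 3] err by linarith
    have 2: "p Vs \<le> Kp * 1 + p Fj"
      using p_triangle[OF calfVs calfFj] p_qn[OF calf_diff[OF calfVs calfFj]] mult_left_mono[OF err Kp] by linarith
    show ?thesis using 1 B(1)[OF VsS] mult_left_mono[OF 2 B(2)] by (simp add: E_def algebra_simps)
  qed
  \<comment> \<open>\<open>u\<close> is the order of the upper bound for \<open>p Fj\<close>, namely
    \<open>k * Q\<close>, \<open>Q\<close> or \<open>Q / k\<close> for \<open>j = 0, 1, 2\<close>,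
    and the quotient norm is larger by a factor of order \<open>k\<close>. The condition
    \<open>1 \<le> 2 * u\<close> allows the error \<open>E\<close> to be absorbed.\<close>
  have "\<exists>u>0. 1 \<le> 2 * u \<and> c / 4 * real k * u - 5/2 * K * u \<le> qn 3 Fj \<and> p Fj \<le> D2 * u"
  proof -
    consider "j = 0" | "j = 1" | "j = 2" using j by linarith
    then show ?thesis
    proof cases
      case 1
      have Fj: "Fj = F" by (simp add: Fj_def 1)
      show ?thesis
      proof (intro exI[of _ "real k * Q"] conjI)
        show "0 < real k * Q" using k1 Q by simp
        show "1 \<le> 2 * (real k * Q)" using mult_mono[of 1 "real k" 1 Q] k1 Q by simp
        have "?c2 X2 = (G + ?c1 X1 + ?c2 X2) - (G + ?c1 X1)" by simp
        then have "qn 3 (?c2 X2) \<le> qn 3 (G + ?c1 X1 + ?c2 X2) + qn 3 (G + ?c1 X1)"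
          using be(1) cc by (metis qn_diff calf_add)
        also have "qn 3 (G + ?c1 X1 + ?c2 X2) = qn 3 F" using qn_cong[OF jF] by simp
        also have "qn 3 (G + ?c1 X1) \<le> qn 3 G + c1 * qn 3 X1"
          using qn_add[OF be(1) cc(1), of 3] qn_cmult[OF X(1), of 3 "complex_of_real c1"] c12 by simp
        finally have "qn 3 (?c2 X2) \<le> qn 3 F + (K * Q + c1 * (K * Q))"
          using NX mult_left_mono[OF NX(2) less_imp_le[OF c12(5)]] by linarith
        moreover have "(real k)\<^sup>2 / 4 * (c * Q) \<le> c2 * qn 3 X2"
          using c12 be(3) c Q by (intro mult_mono) auto
        moreover have "c2 * qn 3 X2 \<le> qn 3 (?c2 X2)" using X(2) c12 by (intro qn_cmult_ge)
        moreover have "K * Q + c1 * (K * Q) \<le> 5/2 * (real k * (K * Q))"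
        proof -
          have KQ: "0 \<le> K * Q" using K Q by simp
          show ?thesis using mult_right_mono[OF k1(2) KQ] mult_right_mono[OF c12(2) KQ] by linarith
        qed
        ultimately show "c / 4 * real k * (real k * Q) - 5/2 * K * (real k * Q) \<le> qn 3 Fj"
          unfolding Fj by (simp add: power2_eq_square algebra_simps)
        show "p Fj \<le> D2 * (real k * Q)"
          using \<epsilon> mult_right_mono[OF D12(3) kQ] unfolding Fj by (simp add: F_def Q_def mult.assoc)
      qed
    next
      case 2
      have Fj: "Fj = mul phi F" by (simp add: Fj_def 2 del: mul_apply)
      have j: "jeq 3 Fj (X1 + ?c1 X2)" using jF1 by (simp only: Fj)
      show ?thesis
      proof (intro exI[of _ Q] conjI)
        show "0 < Q" "1 \<le> 2 * Q" using Q by simp_all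
        have "?c1 X2 = (X1 + ?c1 X2) - X1" by simp
        then have "qn 3 (?c1 X2) \<le> qn 3 (X1 + ?c1 X2) + qn 3 X1"
          using X cc by (metis qn_diff calf_add)
        also have "qn 3 (X1 + ?c1 X2) = qn 3 Fj" using qn_cong[OF j] by simp
        finally have "qn 3 (?c1 X2) \<le> qn 3 Fj + K * Q" using NX by linarith
        moreover have "real k / 2 * (c * Q) \<le> c1 * qn 3 X2" using c12 be(3) c Q by (intro mult_mono) auto
        moreover have "c1 * qn 3 X2 \<le> qn 3 (?c1 X2)" using X(2) c12 by (intro qn_cmult_ge)
        moreover have "0 \<le> real k * (c * Q)" "0 \<le> K * Q" using c Q K by auto
        ultimately show "c / 4 * real k * Q - 5/2 * K * Q \<le> qn 3 Fj" by (simp add: algebra_simps)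
        have "p Fj = p (X1 + ?c1 X2)" by (intro p_jeq j calfFj calf_add X cc)
        also have "\<dots> \<le> p X1 + c1 * p X2"
          using p_add[OF X(1) cc(3)] p_cmult[OF X(2), of "complex_of_real c1"] c12 by simp
        also have "c1 * p X2 \<le> (3/2 * real k) * (D1 * (Q / real k))"
          using c12 p2 p_nonneg[OF X(2)] k1 by (intro mult_mono) auto
        also have "\<dots> = 3/2 * D1 * Q" using k1 by simp
        finally have "p Fj \<le> (R + 3/2 * D1) * Q" using pX by (simp add: algebra_simps)
        then show "p Fj \<le> D2 * Q" using mult_right_mono[OF D12(4), of Q] Q by linarith
      qed
    next
      case 3
      have Fj: "Fj = mul phi (mul phi F)" by (simp add: Fj_def 3 numeral_2_eq_2 del: mul_apply)
      have j: "jeq 3 Fj X2" using jF2 by (simp only: Fj)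
      show ?thesis
      proof (intro exI[of _ "Q / real k"] conjI)
        show "0 < Q / real k" "1 \<le> 2 * (Q / real k)" using Q k1 by (simp_all add: field_simps)
        have "c / 4 * real k * (Q / real k) = c / 4 * Q" using k1 by simp
        also have "\<dots> \<le> c * Q" using c Q by simp
        finally have "c / 4 * real k * (Q / real k) \<le> qn 3 Fj" using be(3) qn_cong[OF j] by linarith
        moreover have "0 \<le> 5/2 * K * (Q / real k)" using K Q by simp
        ultimately show "c / 4 * real k * (Q / real k) - 5/2 * K * (Q / real k) \<le> qn 3 Fj" by linarith
        have "p Fj = p X2" by (intro p_jeq j calfFj X)
        also have "\<dots> \<le> D1 * (Q / real k)" by (rule p2)
        also have "\<dots> \<le> D2 * (Q / real k)" using D12 Q by (intro mult_right_mono) auto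
        finally show "p Fj \<le> D2 * (Q / real k)" .
      qed
    qed
  qed
  then obtain u where u: "u > 0" "1 \<le> 2 * u" "c / 4 * real k * u - 5/2 * K * u \<le> qn 3 Fj" "p Fj \<le> D2 * u" by blast
  have "c / 4 * real k * u - 5/2 * K * u \<le> B * (D2 * u) + E * (2 * u)"
    using u main mult_left_mono[OF u(4) B(2)] mult_left_mono[OF u(2), of E] E by linarith
  then have "(c / 4 * real k) * u \<le> (5/2 * K + B * D2 + 2 * E) * u" by (simp add: algebra_simps)
  then have "c / 4 * real k \<le> 5/2 * K + B * D2 + 2 * E" using u(1) by simp
  then have "real k \<le> 4 / c * (5/2 * K + B * D2 + 2 * E)" using c by (simp add: field_simps)
  then show False using k by linarith
qed

text \<open>\<open>V\<close> stays fixed and normalised while the blocks behind it are divided by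
  \<open>phi\<close> three times; the growth of their norm bound by 12 at each step is
  harmless.\<close>

theorem not_bounded_below:
  assumes S: "\<And>F. F \<in> S \<Longrightarrow> calf F" "\<And>F c. F \<in> S \<Longrightarrow> mul (\<lambda>z. c) F \<in> S"
      "\<And>F G. \<lbrakk>F \<in> S; G \<in> S\<rbrakk> \<Longrightarrow> F + G \<in> S"
      "\<And>F G. \<lbrakk>F \<in> S; calf G; jeq 3 G F\<rbrakk> \<Longrightarrow> G \<in> S"
    and nz: "\<And>m. \<exists>F\<in>S. (\<forall>k<3. \<forall>n<m. jet k F n = 0) \<and> qn 3 F > 0"
    and B: "\<And>F. F \<in> S \<Longrightarrow> qn 3 F \<le> B * p F" "B \<ge> 0"
  shows False
proof -
  have "\<exists>V W. blocks 0 V W 2 \<and> (\<forall>n. V n \<in> S \<and> qn 3 (V n) \<ge> 1)"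
    by (rule blocks_0[of S]; fact)
  then obtain V W where V: "blocks 0 V W 2" "\<And>n. V n \<in> S" "\<And>n. qn 3 (V n) \<ge> 1" by blast
  have step: "\<exists>W'. blocks (Suc j) V W' (12 * K)" if "blocks j V W K" "j \<le> 2" for j W K
    by (rule blocks_step[OF that(1)], rule blocks_small[OF that, of S B]) (fact V(2) S B)+
  obtain W1 where "blocks (Suc 0) V W1 (12 * 2)" using step[OF V(1)] by auto
  then obtain W2 where "blocks (Suc (Suc 0)) V W2 (12 * (12 * 2))" using step by fastforce
  then obtain W3 where "blocks (Suc (Suc (Suc 0))) V W3 (12 * (12 * (12 * 2)))" using step by fastforce
  then have "blocks 3 V W3 (12 * (12 * (12 * 2)))" by (simp only: numeral_3_eq_3)
  from not_blocks_3[OF this] V(3) show False by blast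
qed

end

section \<open>The spaces \<open>Z\<^sub>2\<close> and \<open>Z\<^sub>3\<close>\<close>

definition J2 :: "(complex \<Rightarrow> cseq) \<Rightarrow> cseq \<times> cseq" where
  "J2 F = (jet 1 F, jet 0 F)"

definition J3 :: "(complex \<Rightarrow> cseq) \<Rightarrow> cseq \<times> cseq \<times> cseq" where
  "J3 F = (jet 2 F, jet 1 F, jet 0 F)"

lemma J2_eq_iff: "J2 F = J2 G \<longleftrightarrow> jeq 2 F G"
  by (auto simp: J2_def jeq_2_iff fun_eq_iff)

lemma J3_eq_iff: "J3 F = J3 G \<longleftrightarrow> jeq 3 F G"
  by (auto simp: J3_def jeq_3_iff fun_eq_iff numeral_2_eq_2)

lemma J2_Delta: "calf F \<Longrightarrow> (\<Delta> 1 F, \<Delta> 0 F) = J2 F"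
  by (simp only: J2_def Delta_eq_jet)

lemma J3_Delta: "calf F \<Longrightarrow> (\<Delta> 2 F, \<Delta> 1 F, \<Delta> 0 F) = J3 F"
  by (simp only: J3_def Delta_eq_jet)

lemma carr_Z2: "carr Z2 = J2 ` {F. calf F}"
proof -
  have "carr Z2 = (\<lambda>F. (\<Delta> 1 F, \<Delta> 0 F)) ` {F. calf F}" by (simp add: Z2_def Let_def carr_calderon)
  also have "\<dots> = J2 ` {F. calf F}" by (rule image_cong) (simp_all only: mem_Collect_eq J2_Delta)
  finally show ?thesis .
qed

lemma carr_Z3: "carr Z3 = J3 ` {F. calf F}"
proof -
  have "carr Z3 = (\<lambda>F. (\<Delta> 2 F, \<Delta> 1 F, \<Delta> 0 F)) ` {F. calf F}" by (simp add: Z3_def Let_def carr_calderon)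
  also have "\<dots> = J3 ` {F. calf F}" by (rule image_cong) (simp_all only: mem_Collect_eq J3_Delta)
  finally show ?thesis .
qed

lemma J2_carr [simp]: "calf F \<Longrightarrow> J2 F \<in> carr Z2" by (simp add: carr_Z2)
lemma J3_carr [simp]: "calf F \<Longrightarrow> J3 F \<in> carr Z3" by (simp add: carr_Z3)

lemma nrm_Z2: assumes "calf F" shows "nrm Z2 (J2 F) = qn 2 F"
proof -
  have "nrm Z2 (J2 F) = (INF G\<in>{G. calf G \<and> (\<Delta> 1 G, \<Delta> 0 G) = J2 F}. cN G)"
    by (simp add: Z2_def Let_def quotient_norm_def carr_calderon)
  also have "{G. calf G \<and> (\<Delta> 1 G, \<Delta> 0 G) = J2 F} = {G. calf G \<and> jeq 2 G F}"
    by (intro Collect_cong conj_cong refl) (simp only: J2_Delta J2_eq_iff)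
  finally show ?thesis by (simp add: qn_def)
qed

lemma nrm_Z3: assumes "calf F" shows "nrm Z3 (J3 F) = qn 3 F"
proof -
  have "nrm Z3 (J3 F) = (INF G\<in>{G. calf G \<and> (\<Delta> 2 G, \<Delta> 1 G, \<Delta> 0 G) = J3 F}. cN G)"
    by (simp add: Z3_def Let_def quotient_norm_def carr_calderon)
  also have "{G. calf G \<and> (\<Delta> 2 G, \<Delta> 1 G, \<Delta> 0 G) = J3 F} = {G. calf G \<and> jeq 3 G F}"
    by (intro Collect_cong conj_cong refl) (simp only: J3_Delta J3_eq_iff)
  finally show ?thesis by (simp add: qn_def)
qed

lemma Z2_ops:
  "add Z2 (x1, x0) (y1, y0) = ((\<lambda>n. x1 n + y1 n), (\<lambda>n. x0 n + y0 n))"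
  "scl Z2 c (x1, x0) = ((\<lambda>n. c * x1 n), (\<lambda>n. c * x0 n))"
  "zer Z2 = ((\<lambda>n. 0), (\<lambda>n. 0))"
  by (simp_all add: Z2_def Let_def)

lemma Z3_ops:
  "add Z3 (x2, x1, x0) (y2, y1, y0) = ((\<lambda>n. x2 n + y2 n), (\<lambda>n. x1 n + y1 n), (\<lambda>n. x0 n + y0 n))"
  "scl Z3 c (x2, x1, x0) = ((\<lambda>n. c * x2 n), (\<lambda>n. c * x1 n), (\<lambda>n. c * x0 n))"
  "zer Z3 = ((\<lambda>n. 0), (\<lambda>n. 0), (\<lambda>n. 0))"
  by (simp_all add: Z3_def Let_def)

lemma J2_add: "calf F \<Longrightarrow> calf G \<Longrightarrow> J2 (F + G) = add Z2 (J2 F) (J2 G)"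
  by (simp add: J2_def Z2_ops jet_add fun_eq_iff del: jet_0)

lemma J2_scl: "calf F \<Longrightarrow> J2 (mul (\<lambda>z. c) F) = scl Z2 c (J2 F)"
  by (simp add: J2_def Z2_ops jet_cmult fun_eq_iff del: jet_0)

lemma J3_add: "calf F \<Longrightarrow> calf G \<Longrightarrow> J3 (F + G) = add Z3 (J3 F) (J3 G)"
  by (simp add: J3_def Z3_ops jet_add fun_eq_iff del: jet_0)

lemma J3_scl: "calf F \<Longrightarrow> J3 (mul (\<lambda>z. c) F) = scl Z3 c (J3 F)"
  by (simp add: J3_def Z3_ops jet_cmult fun_eq_iff del: jet_0)

text \<open>Induction on the order: once the lower jets vanish, \<open>jet_l2_bound\<close> on a
  single coordinate bounds the next one by representatives of arbitrarily small norm.\<close>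

lemma qn_eq_0_imp:
  assumes F: "calf F" and 0: "qn 3 F = 0" shows "J3 F = zer Z3"
proof -
  have "jet k F = (\<lambda>n. 0)" if "k < 3" for k
    using that
  proof (induction k rule: less_induct)
    case (less k)
    show ?case
    proof
      fix n
      have "cmod (jet k F n) \<le> 4 ^ k * e" if e: "e > 0" for e
      proof -
        have "qn 3 F < e" using 0 e by simp
        then obtain G where G: "calf G" "jeq 3 G F" "cN G < e" using qn_obtain[OF F] by metis
        have "jet i G m = 0" if "i < k" for i m
          using less.IH[OF that] less.prems that G(2) by (simp add: jeq_def)
        from jet_l2_bound[OF G(1), of "{n}", OF _ this]
        have "cmod (jet k G n) \<le> 4 ^ k * cN G" by simp
        also have "\<dots> \<le> 4 ^ k * e" using G(3) by (intro mult_left_mono) auto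
        also have "jet k G n = jet k F n" using G(2) less.prems by (simp add: jeq_def)
        finally show ?thesis .
      qed
      then have "cmod (jet k F n) \<le> 0 + e" if "e > 0" for e
        using that by (metis (no_types, lifting) add_0 divide_pos_pos mult.commute nonzero_eq_divide_eq zero_less_numeral zero_less_power less_irrefl)
      then have "cmod (jet k F n) \<le> 0" by (rule field_le_epsilon)
      then show "jet k F n = 0" by simp
    qed
  qed
  then show ?thesis by (simp add: J3_def Z3_ops del: jet_0)
qed

lemma qn_pos: "calf F \<Longrightarrow> J3 F \<noteq> zer Z3 \<Longrightarrow> qn 3 F > 0"
  using qn_eq_0_imp qn_nonneg[of F 3] by force

text \<open>Lists the first \<open>m\<close> entries of all three components as one family of
  functionals, indexed by \<open>i < 3 * m\<close>, for use in dimension counts.\<close>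

definition coord :: "nat \<Rightarrow> nat \<Rightarrow> cseq \<times> cseq \<times> cseq \<Rightarrow> complex" where
  "coord m i v = (if i < m then fst v i else if i < 2 * m then fst (snd v) (i - m) else snd (snd v) (i - 2 * m))"

lemma coord_add: "coord m i (add Z3 v w) = coord m i v + coord m i w"
  by (cases v; cases w) (simp add: coord_def Z3_ops)

lemma coord_scl: "coord m i (scl Z3 c v) = c * coord m i v"
  by (cases v) (simp add: coord_def Z3_ops)

lemma coord_J3:
  assumes "\<And>i. i < 3 * m \<Longrightarrow> coord m i (J3 F) = 0" "k < 3" "n < m"
  shows "jet k F n = 0"
proof -
  consider "k = 0" | "k = 1" | "k = 2" using assms(2) by linarith
  then show ?thesis
  proof cases
    case 1 then show ?thesis using assms(1)[of "n + 2 * m"] assms(3) by (simp add: coord_def J3_def del: jet_0)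
  next
    case 2 then show ?thesis using assms(1)[of "n + m"] assms(3) by (simp add: coord_def J3_def del: jet_0)
  next
    case 3 then show ?thesis using assms(1)[of n] assms(3) by (simp add: coord_def J3_def del: jet_0)
  qed
qed

text \<open>The target enters through the seminorm properties of its norm, which makes the locale
  fit \<open>Z2\<close>, \<open>l2\<close> and abstract twisted Hilbert spaces alike.\<close>

locale Z3_operator =
  fixes Y :: "'y cspace" and U
  assumes U: "bounded_operator Z3 Y U"
    and Y_add: "\<lbrakk>x \<in> carr Y; y \<in> carr Y\<rbrakk> \<Longrightarrow> nrm Y (add Y x y) \<le> nrm Y x + nrm Y y"
    and Y_scl: "x \<in> carr Y \<Longrightarrow> nrm Y (scl Y c x) \<le> cmod c * nrm Y x"
    and Y_nonneg: "x \<in> carr Y \<Longrightarrow> 0 \<le> nrm Y x"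
begin

definition p :: "(complex \<Rightarrow> cseq) \<Rightarrow> real" where "p F = nrm Y (U (J3 F))"

lemma U_carr: "calf F \<Longrightarrow> U (J3 F) \<in> carr Y"
  using U J3_carr by (simp add: bounded_operator_def)

lemma U_add: "calf F \<Longrightarrow> calf G \<Longrightarrow> U (J3 (F + G)) = add Y (U (J3 F)) (U (J3 G))"
  using U by (simp add: bounded_operator_def J3_add)

lemma U_scl: "calf F \<Longrightarrow> U (J3 (mul (\<lambda>z. c) F)) = scl Y c (U (J3 F))"
  using U by (simp add: bounded_operator_def J3_scl)

lemma U_diff: "calf F \<Longrightarrow> calf G \<Longrightarrow> U (J3 (F - G)) = add Y (U (J3 F)) (scl Y (-1) (U (J3 G)))"
  using U_add[of F "- G"] U_scl[of G "-1"] calf_uminus[of G]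
  by (simp add: uminus_eq_mul[symmetric] del: mul_apply)

lemma p_bound: "\<exists>K\<ge>0. \<forall>F. calf F \<longrightarrow> p F \<le> K * qn 3 F"
proof -
  obtain K where K: "\<And>v. v \<in> carr Z3 \<Longrightarrow> nrm Y (U v) \<le> K * nrm Z3 v"
    using U unfolding bounded_operator_def by blast
  have le: "p F \<le> max K 0 * qn 3 F" if "calf F" for F
  proof -
    have "p F \<le> K * qn 3 F" using K[of "J3 F"] that by (simp add: p_def nrm_Z3)
    also have "\<dots> \<le> max K 0 * qn 3 F" using qn_nonneg[OF that] by (intro mult_right_mono) auto
    finally show ?thesis .
  qed
  show ?thesis by (rule exI[of _ "max K 0"]) (use le in auto)
qed

text \<open>Translates the growth argument from Calderon functions to elements of \<open>Z3\<close>.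
  Infinite dimension of \<open>S\<close> appears as the existence of nonzero vectors killed by any
  finite set of coordinates.\<close>

lemma no_lower_bound:
  assumes st: "sign_type {F. calf F} p"
    and S: "linear_subspace Z3 S"
    and nz: "\<And>m. \<exists>v\<in>S. (\<forall>i<3*m. coord m i v = 0) \<and> v \<noteq> zer Z3"
    and B: "\<And>v. v \<in> S \<Longrightarrow> nrm Z3 v \<le> B * nrm Y (U v)"
  shows False
proof -
  obtain K where K: "K \<ge> 0" "\<And>F. calf F \<Longrightarrow> p F \<le> K * qn 3 F" using p_bound by blast
  interpret sign_type_seminorm p K
  proof
    show "p (F + G) \<le> p F + p G" if "calf F" "calf G" for F G
      using that by (simp add: p_def U_add U_carr Y_add del: plus_fun_apply)
    show "p (mul (\<lambda>z. c) F) \<le> cmod c * p F" if "calf F" for F c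
      using that by (simp add: p_def U_scl U_carr Y_scl del: mul_apply)
    show "0 \<le> p F" if "calf F" for F
      using that by (simp add: p_def U_carr Y_nonneg)
  qed (use K st in auto)
  define SS where "SS = {F. calf F \<and> J3 F \<in> S}"
  show False
  proof (rule not_bounded_below[of SS "max B 0"])
    show "calf F" if "F \<in> SS" for F using that by (simp add: SS_def)
    show "mul (\<lambda>z. c) F \<in> SS" if "F \<in> SS" for F c
      using that S calf_cmult[of F c] J3_scl[of F c] unfolding SS_def linear_subspace_def by auto
    show "F + G \<in> SS" if "F \<in> SS" "G \<in> SS" for F G
      using that S calf_add[of F G] J3_add[of F G] unfolding SS_def linear_subspace_def by auto
    show "G \<in> SS" if "F \<in> SS" "calf G" "jeq 3 G F" for F G
    proof -
      have "J3 G = J3 F" using that J3_eq_iff by blast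
      then show ?thesis using that by (simp add: SS_def)
    qed
    show "\<exists>F\<in>SS. (\<forall>k<3. \<forall>n<m. jet k F n = 0) \<and> qn 3 F > 0" for m
    proof -
      obtain v where v: "v \<in> S" "\<And>i. i < 3 * m \<Longrightarrow> coord m i v = 0" "v \<noteq> zer Z3" using nz by blast
      have "v \<in> carr Z3" using v(1) S by (auto simp: linear_subspace_def)
      then obtain F where F: "calf F" "v = J3 F" unfolding carr_Z3 by blast
      have "F \<in> SS" using F v by (simp add: SS_def)
      moreover have "jet k F n = 0" if "k < 3" "n < m" for k n
        using coord_J3[of m F k n] v(2) that F(2) by blast
      moreover have "qn 3 F > 0" using qn_pos F v(3) by blast
      ultimately show ?thesis by blast
    qed
    show "qn 3 F \<le> max B 0 * p F" if "F \<in> SS" for F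
    proof -
      have F: "calf F" "J3 F \<in> S" using that by (auto simp: SS_def)
      have "qn 3 F \<le> B * p F" using B[OF F(2)] F(1) by (simp add: nrm_Z3 p_def)
      also have "\<dots> \<le> max B 0 * p F" using p_nonneg[OF F(1)] by (intro mult_right_mono) auto
      finally show ?thesis .
    qed
  qed simp
qed

end

section \<open>Finite codimension\<close>

text \<open>Induction on the number of functionals: the kernel of the last one in \<open>S\<close>
  has codimension at most 1, so a single vector \<open>x\<close> outside it completes a finite
  spanning set. The assumption \<open>V\<close> on adding and removing a multiple of
  \<open>x\<close> is the vector space law behind this.\<close>

lemma finite_dimensional_kernel:
  fixes f :: "nat \<Rightarrow> 'a \<Rightarrow> complex"
  assumes S: "linear_subspace V S"
    and V: "\<And>x y t. \<lbrakk>x \<in> carr V; y \<in> carr V\<rbrakk> \<Longrightarrow> add V (add V y (scl V (- t) x)) (scl V t x) = y"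
    and f: "\<And>i x y. \<lbrakk>x \<in> carr V; y \<in> carr V\<rbrakk> \<Longrightarrow> f i (add V x y) = f i x + f i y"
      "\<And>i x c. x \<in> carr V \<Longrightarrow> f i (scl V c x) = c * f i x" "\<And>i. f i (zer V) = 0"
    and ker: "\<And>x. x \<in> S \<Longrightarrow> (\<forall>i<k. f i x = 0) \<Longrightarrow> x = zer V"
  shows "finite_dimensional V S"
  using S ker
proof (induction k arbitrary: S)
  case 0
  have "zer V \<in> S" using 0(1) by (simp add: linear_subspace_def)
  moreover have "x = zer V" if "x \<in> S" for x using 0(2)[OF that] by simp
  ultimately have S0: "S = {zer V}" by blast
  have "linear_subspace V hull {} = {zer V}"
  proof
    show "linear_subspace V hull {} \<subseteq> {zer V}" using 0(1) unfolding S0 by (intro hull_minimal) simp_all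
    show "{zer V} \<subseteq> linear_subspace V hull {}" unfolding hull_def linear_subspace_def by blast
  qed
  with S0 show ?case unfolding finite_dimensional_def by (intro exI[of _ "{}"]) simp
next
  case (Suc k)
  note S = Suc.prems(1)
  show ?case
  proof (cases "\<forall>x\<in>S. f k x = 0")
    case True
    have "x = zer V" if "x \<in> S" "\<forall>i<k. f i x = 0" for x
      using Suc.prems(2)[OF that(1)] that True by (simp add: less_Suc_eq)
    then show ?thesis by (rule Suc.IH[OF S])
  next
    case False
    then obtain x where x: "x \<in> S" "f k x \<noteq> 0" by blast
    have SV: "y \<in> carr V" if "y \<in> S" for y using S that by (auto simp: linear_subspace_def)
    define S' where "S' = {y \<in> S. f k y = 0}"
    have S': "linear_subspace V S'"
      using S f SV unfolding linear_subspace_def S'_def by auto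
    have "x = zer V" if "x \<in> S'" "\<forall>i<k. f i x = 0" for x
      using Suc.prems(2)[of x] that by (simp add: S'_def less_Suc_eq)
    then have "finite_dimensional V S'" by (rule Suc.IH[OF S'])
    then obtain B where B: "finite B" "B \<subseteq> S'" "linear_subspace V hull B = S'"
      by (auto simp: finite_dimensional_def)
    have "linear_subspace V hull insert x B = S"
    proof
      show "linear_subspace V hull insert x B \<subseteq> S" using B x S by (intro hull_minimal) (auto simp: S'_def)
      show "S \<subseteq> linear_subspace V hull insert x B"
        unfolding hull_def
      proof (intro subsetI InterI)
        fix y t assume y: "y \<in> S" and t: "t \<in> {t. linear_subspace V t \<and> insert x B \<subseteq> t}"
        define c where "c = f k y / f k x"
        let ?z = "add V y (scl V (- c) x)"
        have "?z \<in> S" using S x y by (auto simp: linear_subspace_def)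
        moreover have "f k ?z = 0"
          using x y S f SV by (simp add: c_def linear_subspace_def)
        ultimately have "?z \<in> linear_subspace V hull B" using B(3) by (simp add: S'_def)
        then have "?z \<in> t" using t by (auto simp: hull_def)
        then have "add V ?z (scl V c x) \<in> t" using t by (auto simp: linear_subspace_def)
        then show "y \<in> t" using V[of x y c] x y SV by simp
      qed
    qed
    moreover have "insert x B \<subseteq> S" using B(2) x by (auto simp: S'_def)
    ultimately show ?thesis using B(1) unfolding finite_dimensional_def by blast
  qed
qed

lemma infinite_dimensional_Z3:
  assumes S: "linear_subspace Z3 S" and inf: "\<not> finite_dimensional Z3 S"
  shows "\<exists>v\<in>S. (\<forall>i<3*m. coord m i v = 0) \<and> v \<noteq> zer Z3"
proof (rule ccontr)
  assume "\<not> ?thesis"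
  then have "finite_dimensional Z3 S"
    by (intro finite_dimensional_kernel[OF S, of "coord m" "3 * m"])
       (auto simp: coord_add coord_scl Z3_ops coord_def fun_eq_iff)
  with inf show False by simp
qed

text \<open>Given two solutions for \<open>k\<close> functionals, the second supported beyond the
  first, a combination of them kills one more functional and is nonzero because the supports are
  disjoint. The start \<open>m\<close> of the support is generalised to obtain that second
  solution.\<close>

lemma finitely_many_functionals:
  fixes g :: "nat \<Rightarrow> cseq \<Rightarrow> complex"
  assumes "\<And>i x y. \<lbrakk>finite {n. x n \<noteq> 0}; finite {n. y n \<noteq> 0}\<rbrakk> \<Longrightarrow> g i (\<lambda>n. x n + y n) = g i x + g i y"
    "\<And>i x c. finite {n. x n \<noteq> 0} \<Longrightarrow> g i (\<lambda>n. c * x n) = c * g i x"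
  shows "\<exists>x. finite {n. x n \<noteq> 0} \<and> {n. x n \<noteq> 0} \<subseteq> {m..} \<and> (\<exists>n. x n \<noteq> 0) \<and> (\<forall>i<k. g i x = 0)"
proof (induction k arbitrary: m)
  case 0
  have "{n. (if n = m then 1 else 0 :: complex) \<noteq> 0} = {m}" by auto
  then show ?case by (intro exI[of _ "\<lambda>n. if n = m then 1 else 0"]) auto
next
  case (Suc k)
  obtain x where x: "finite {n. x n \<noteq> 0}" "{n. x n \<noteq> 0} \<subseteq> {m..}" "\<exists>n. x n \<noteq> 0" "\<forall>i<k. g i x = 0"
    using Suc.IH[of m] by blast
  define m' where "m' = max m (Suc (Max {n. x n \<noteq> 0}))"
  have m': "n < m'" if "x n \<noteq> 0" for n
    using Max_ge[OF x(1), of n] that by (simp add: m'_def)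
  obtain y where y: "finite {n. y n \<noteq> 0}" "{n. y n \<noteq> 0} \<subseteq> {m'..}" "\<exists>n. y n \<noteq> 0" "\<forall>i<k. g i y = 0"
    using Suc.IH[of m'] by blast
  show ?case
  proof (cases "g k x = 0")
    case True
    then show ?thesis using x less_Suc_eq by blast
  next
    case False
    define a where "a = g k y"
    define b where "b = - g k x"
    define z where "z = (\<lambda>n. a * x n + b * y n)"
    have sub: "{n. z n \<noteq> 0} \<subseteq> {n. x n \<noteq> 0} \<union> {n. y n \<noteq> 0}" by (auto simp: z_def)
    have fax: "finite {n. a * x n \<noteq> 0}" "finite {n. b * y n \<noteq> 0}"
      by (rule finite_subset[OF _ x(1)], force, rule finite_subset[OF _ y(1)], force)
    have g: "g i z = a * g i x + b * g i y" for i
      unfolding z_def using assms(1)[OF fax] assms(2)[OF x(1)] assms(2)[OF y(1)] by simp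
    obtain n where n: "y n \<noteq> 0" using y(3) by blast
    then have "n \<ge> m'" using y(2) by auto
    then have "x n = 0" using m' by (meson leD)
    then have "z n \<noteq> 0" using n False by (simp add: z_def b_def)
    moreover have "finite {n. z n \<noteq> 0}" using finite_subset[OF sub] x(1) y(1) by blast
    moreover have "{n. z n \<noteq> 0} \<subseteq> {m..}" using sub x(2) y(2) by (force simp: m'_def)
    moreover have "g i z = 0" if "i < Suc k" for i
      using that x(4) y(4) unfolding g less_Suc_eq by (auto simp: a_def b_def)
    ultimately show ?thesis by blast
  qed
qed

section \<open>Operators into \<open>Z\<^sub>2\<close>\<close>

text \<open>The factor \<open>1 + 1/s\<close> stands at the term that is iterated over the levels of
  the sign tree, so \<open>s\<close> can be adapted to their number.\<close>

lemma young_sq: "(u + v)\<^sup>2 \<le> (1 + 1/s) * u\<^sup>2 + (1 + s) * v\<^sup>2" if "s > 0" for u v s :: real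
proof -
  have "0 \<le> (u - s * v)\<^sup>2 / s" using that by simp
  also have "\<dots> = u\<^sup>2 / s - 2 * u * v + s * v\<^sup>2" using that by (simp add: power2_eq_square field_simps)
  finally show ?thesis by (simp add: power2_eq_square algebra_simps)
qed

lemma sq_sum3_le: "(a + b + c)\<^sup>2 \<le> 3 * (a\<^sup>2 + b\<^sup>2 + c\<^sup>2)" for a b c :: real
proof -
  have "0 \<le> (a - b)\<^sup>2 + (b - c)\<^sup>2 + (a - c)\<^sup>2" by simp
  then show ?thesis by (simp add: power2_eq_square algebra_simps)
qed

lemma sq_le_sum:
  fixes a b c :: real
  assumes "0 \<le> c" "c \<le> a + b" shows "c\<^sup>2 \<le> 2 * (a\<^sup>2 + b\<^sup>2)"
proof -
  have "c\<^sup>2 \<le> (a + b)\<^sup>2" using assms by (intro power_mono)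
  also have "\<dots> \<le> 2 * (a\<^sup>2 + b\<^sup>2)" using young_sq[of 1 a b] by simp
  finally show ?thesis .
qed

lemma l2n_sq: "finite A \<Longrightarrow> (\<And>n. n \<notin> A \<Longrightarrow> x n = 0) \<Longrightarrow> (l2n x)\<^sup>2 = (\<Sum>n\<in>A. (cmod (x n))\<^sup>2)"
  by (simp add: l2n_eq sum_nonneg)

lemma cmod_parallelogram: "(cmod (a + b))\<^sup>2 + (cmod (a - b))\<^sup>2 = 2 * ((cmod a)\<^sup>2 + (cmod b)\<^sup>2)"
  unfolding cmod_power2 by (simp add: power2_eq_square algebra_simps)

lemma l2n_parallelogram:
  assumes "finite A" "\<And>n. n \<notin> A \<Longrightarrow> x n = 0" "\<And>n. n \<notin> A \<Longrightarrow> y n = 0"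
  shows "(l2n (x + y))\<^sup>2 + (l2n (x - y))\<^sup>2 = 2 * ((l2n x)\<^sup>2 + (l2n y)\<^sup>2)"
  using assms
  by (simp add: l2n_sq[of A] sum.distrib[symmetric] cmod_parallelogram sum_distrib_left)

lemma l2n_young:
  assumes "finite A" "\<And>n. n \<notin> A \<Longrightarrow> x n = 0" "\<And>n. n \<notin> A \<Longrightarrow> y n = 0" "s > 0"
  shows "(l2n (x + y))\<^sup>2 \<le> (1 + 1/s) * (l2n x)\<^sup>2 + (1 + s) * (l2n y)\<^sup>2"
proof -
  have "(l2n (x + y))\<^sup>2 = (\<Sum>n\<in>A. (cmod (x n + y n))\<^sup>2)" using assms by (simp add: l2n_sq[of A])
  also have "\<dots> \<le> (\<Sum>n\<in>A. (1 + 1/s) * (cmod (x n))\<^sup>2 + (1 + s) * (cmod (y n))\<^sup>2)"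
  proof (rule sum_mono)
    fix n
    have "(cmod (x n + y n))\<^sup>2 \<le> (cmod (x n) + cmod (y n))\<^sup>2" by (intro power_mono norm_triangle_ineq) simp
    also have "\<dots> \<le> (1 + 1/s) * (cmod (x n))\<^sup>2 + (1 + s) * (cmod (y n))\<^sup>2" by (rule young_sq[OF assms(4)])
    finally show "(cmod (x n + y n))\<^sup>2 \<le> (1 + 1/s) * (cmod (x n))\<^sup>2 + (1 + s) * (cmod (y n))\<^sup>2" .
  qed
  also have "\<dots> = (1 + 1/s) * (l2n x)\<^sup>2 + (1 + s) * (l2n y)\<^sup>2"
    using assms by (simp add: l2n_sq[of A] sum.distrib sum_distrib_left)
  finally show ?thesis .
qed

section \<open>The quasilinear description of \<open>Z2\<close>\<close>

definition fsupp :: "(complex \<Rightarrow> cseq) \<Rightarrow> nat set" where "fsupp F = {n. \<exists>z. F z n \<noteq> 0}"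

lemma jet_fsupp: "n \<notin> fsupp F \<Longrightarrow> jet k F n = 0"
  by (simp add: fsupp_def jet_def)

text \<open>The Kalton--Peck representation of an element of \<open>Z\<^sub>2\<close>: \<open>F (1/2)\<close> and the deviation
  of the derivative from that of the canonical lift.\<close>

definition dev :: "(complex \<Rightarrow> cseq) \<Rightarrow> cseq" where
  "dev F = jet 1 (F - lift (F (1/2)))"

text \<open>The squared quotient norm is equivalent to \<open>\<alpha> + \<eta>\<close>, the squared
  \<open>\<ell>\<^sub>2\<close> norms of the value and of \<open>dev\<close>. The value is additive;
  \<open>dev\<close> is additive up to the derivative of a combination of lifts vanishing at
  \<open>1/2\<close>, which \<open>jet_l2_bound\<close> controls in \<open>\<ell>\<^sub>2\<close> by
  the values.\<close>

lemma sign_type_qn2_finite: "sign_type {F. calf F \<and> finite (fsupp F)} (qn 2)"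
proof -
  define X where "X = {F. calf F \<and> finite (fsupp F)}"
  have Xadd: "F + G \<in> X" if "F \<in> X" "G \<in> X" for F G
  proof -
    have "fsupp (F + G) \<subseteq> fsupp F \<union> fsupp G" by (auto simp: fsupp_def)
    then show ?thesis using that calf_add finite_subset unfolding X_def by blast
  qed
  have Xdiff: "F - G \<in> X" if "F \<in> X" "G \<in> X" for F G
  proof -
    have "fsupp (F - G) \<subseteq> fsupp F \<union> fsupp G" by (auto simp: fsupp_def)
    then show ?thesis using that calf_diff finite_subset unfolding X_def by blast
  qed
  have fin: "finite {n. F (1/2) n \<noteq> 0}" if "F \<in> X" for F
    by (rule finite_subset[of _ "fsupp F"]) (use that in \<open>auto simp: fsupp_def X_def\<close>)
  have L: "calf (lift (F (1/2)))" "cN (lift (F (1/2))) \<le> 2 * l2n (F (1/2))" if "F \<in> X" for F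
    using calf_lift[OF fin[OF that]] cN_lift[OF fin[OF that]] .
  have half0: "F (1/2) n = 0" if "n \<notin> fsupp F" for F n using that by (simp add: fsupp_def)
  have dev0: "dev F n = 0" if "n \<notin> fsupp F" for F n
    unfolding dev_def
    by (rule jet_fsupp) (use that in \<open>auto simp: fsupp_def lift_eq_0\<close>)
  define \<alpha> where "\<alpha> = (\<lambda>F. (l2n (F (1/2 :: complex)))\<^sup>2)"
  define \<eta> where "\<eta> = (\<lambda>F. (l2n (dev F))\<^sup>2)"
  have alpha: "\<alpha> (F + G) + \<alpha> (F - G) = 2 * (\<alpha> F + \<alpha> G)" if "F \<in> X" "G \<in> X" for F G
    unfolding \<alpha>_def plus_fun_apply[of F] minus_apply[of F]
    by (rule l2n_parallelogram[of "fsupp F \<union> fsupp G"]) (use that half0 in \<open>auto simp: X_def\<close>)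
  have \<alpha>0: "0 \<le> \<alpha> F" for F by (simp add: \<alpha>_def)
  \<comment> \<open>\<open>A\<close> and \<open>B\<close> will be the lift of \<open>F (1/2)\<close>
    and plus or minus the lift of \<open>G (1/2)\<close>, and \<open>H\<close> is the sum or
    difference of \<open>F\<close> and \<open>G\<close>. The constant is
    \<open>8\<^sup>2 * 3 * 3\<close>: 8 is 4 from \<open>jet_l2_bound\<close> times 2 from the
    lifts, one 3 comes from squaring three terms, the other from bounding
    \<open>\<alpha> H\<close>.\<close>
  have deviation: "(l2n (jet 1 (A + B - lift (H (1/2)))))\<^sup>2 \<le> 576 * (\<alpha> F + \<alpha> G)"
    if X: "F \<in> X" "G \<in> X" "H \<in> X" and AB: "calf A" "calf B" "cN A \<le> 2 * l2n (F (1/2))" "cN B \<le> 2 * l2n (G (1/2))"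
      "A (1/2) + B (1/2) = H (1/2)" and supp: "\<And>z n. n \<notin> fsupp F \<union> fsupp G \<Longrightarrow> A z n = 0 \<and> B z n = 0 \<and> H z n = 0"
      and aH: "\<alpha> H \<le> 2 * (\<alpha> F + \<alpha> G)" for F G H A B
  proof -
    let ?E = "A + B - lift (H (1/2))"
    have E: "calf ?E" using AB L(1)[OF X(3)] by (intro calf_diff calf_add)
    have "cN ?E \<le> cN (A + B) + cN (- lift (H (1/2)))"
      using cN_add[OF calf_add[OF AB(1,2)] calf_uminus[OF L(1)[OF X(3)]]] by simp
    also have "\<dots> \<le> (2 * l2n (F (1/2)) + 2 * l2n (G (1/2))) + 2 * l2n (H (1/2))"
      by (rule add_mono[OF order_trans[OF cN_add[OF AB(1,2)] add_mono[OF AB(3,4)]]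
            order_trans[OF cN_uminus[OF L(1)[OF X(3)]] L(2)[OF X(3)]]])
    finally have cE: "cN ?E \<le> 2 * (l2n (F (1/2)) + l2n (G (1/2)) + l2n (H (1/2)))" by (simp only: distrib_left)
    have "?E (1/2) = A (1/2) + B (1/2) - lift (H (1/2)) (1/2)" by (simp only: minus_apply plus_fun_apply)
    then have E0: "?E (1/2) = 0" unfolding AB(5) lift_half by simp
    have s: "?E z n = 0" if "n \<notin> fsupp F \<union> fsupp G" for z n
      using supp[OF that] by (simp add: lift_eq_0)
    have j0: "jet 1 ?E n = 0" if "n \<notin> fsupp F \<union> fsupp G" for n
      using s[OF that] by (simp only: jet_def sjet_const_0)
    have finU: "finite (fsupp F \<union> fsupp G)" using X by (simp add: X_def)
    have "sqrt (\<Sum>n\<in>fsupp F \<union> fsupp G. (cmod (jet 1 ?E n))\<^sup>2) \<le> 4 ^ 1 * cN ?E"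
    proof (rule jet_l2_bound[OF E finU])
      show "jet i ?E n = 0" if "i < 1" for i n using that E0 by simp
    qed
    then have "l2n (jet 1 ?E) \<le> 4 * cN ?E"
      using l2n_eq[OF finU j0] by simp
    then have "l2n (jet 1 ?E) \<le> 8 * (l2n (F (1/2)) + l2n (G (1/2)) + l2n (H (1/2)))" using cE by linarith
    then have "(l2n (jet 1 ?E))\<^sup>2 \<le> (8 * (l2n (F (1/2)) + l2n (G (1/2)) + l2n (H (1/2))))\<^sup>2"
      using l2n_nonneg by (intro power_mono)
    also have "\<dots> \<le> 64 * (3 * (\<alpha> F + \<alpha> G + \<alpha> H))"
      unfolding power_mult_distrib
      using sq_sum3_le[of "l2n (F (1/2))" "l2n (G (1/2))" "l2n (H (1/2))"] by (simp add: \<alpha>_def)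
    also have "\<dots> \<le> 576 * (\<alpha> F + \<alpha> G)" using aH by simp
    finally show ?thesis .
  qed
  have eta: "\<eta> (F + G) + \<eta> (F - G) \<le> 2 * (1 + 1/s) * (\<eta> F + \<eta> G) + 2 * ((1 + s) * 576) * (\<alpha> F + \<alpha> G)"
    if X: "F \<in> X" "G \<in> X" and s: "s > 0" for F G s
  proof -
    let ?x = "F (1/2)" and ?y = "G (1/2)"
    let ?A = "fsupp F \<union> fsupp G"
    have fA: "finite ?A" using X by (simp add: X_def)
    have cF: "calf F" "calf G" using X by (auto simp: X_def)
    note L1 = L[OF X(1)] and L2 = L[OF X(2)]
    have Lp: "calf (lift ((F + G) (1/2)))" and Lm: "calf (lift ((F - G) (1/2)))"
      using L(1)[OF Xadd[OF X]] L(1)[OF Xdiff[OF X]] .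
    define wp where "wp = jet 1 (lift ?x + lift ?y - lift ((F + G) (1/2)))"
    define wm where "wm = jet 1 (lift ?x + (- lift ?y) - lift ((F - G) (1/2)))"
    have dp: "dev (F + G) = (dev F + dev G) + wp"
      unfolding dev_def wp_def using cF L1(1) L2(1) Lp
      by (simp add: jet_add jet_diff calf_add calf_diff fun_eq_iff del: plus_fun_apply[of F] jet_0)
    have dm: "dev (F - G) = (dev F - dev G) + wm"
      unfolding dev_def wm_def using cF L1(1) L2(1) Lm
      by (simp add: jet_add jet_diff jet_uminus calf_add calf_diff calf_uminus fun_eq_iff del: minus_apply[of F] jet_0)
    have out: "F z n = 0" "G z n = 0" if "n \<notin> ?A" for z n using that by (auto simp: fsupp_def)
    have ap: "\<alpha> (F + G) \<le> 2 * (\<alpha> F + \<alpha> G)" "\<alpha> (F - G) \<le> 2 * (\<alpha> F + \<alpha> G)"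
      using alpha[OF X] \<alpha>0[of "F + G"] \<alpha>0[of "F - G"] by linarith+
    have bp: "(l2n wp)\<^sup>2 \<le> 576 * (\<alpha> F + \<alpha> G)"
      unfolding wp_def
      by (rule deviation[OF X Xadd[OF X]])
         (use L1 L2 ap out in \<open>auto simp: lift_half lift_eq_0 plus_fun_def\<close>)
    have bm: "(l2n wm)\<^sup>2 \<le> 576 * (\<alpha> F + \<alpha> G)"
      unfolding wm_def
      by (rule deviation[OF X Xdiff[OF X]])
         (use L1 L2 ap out calf_uminus[OF L2(1)] cN_uminus[OF L2(1)] in \<open>auto simp: lift_half lift_eq_0 fun_diff_def plus_fun_def\<close>)
    have dF: "dev F n = 0" "dev G n = 0" if "n \<notin> ?A" for n using dev0 that by auto
    have w0: "wp n = 0" "wm n = 0" if "n \<notin> ?A" for n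
    proof -
      have "(lift ?x + lift ?y - lift ((F + G) (1/2))) z n = 0" "(lift ?x + - lift ?y - lift ((F - G) (1/2))) z n = 0" for z
        using out[OF that] by (simp_all add: lift_eq_0)
      then show "wp n = 0" "wm n = 0" unfolding wp_def wm_def by (simp_all only: jet_def sjet_const_0)
    qed
    have 1: "\<eta> (F + G) \<le> (1 + 1/s) * (l2n (dev F + dev G))\<^sup>2 + (1 + s) * (l2n wp)\<^sup>2"
      unfolding \<eta>_def dp by (rule l2n_young[OF fA _ _ s]) (use dF w0 in auto)
    have 2: "\<eta> (F - G) \<le> (1 + 1/s) * (l2n (dev F - dev G))\<^sup>2 + (1 + s) * (l2n wm)\<^sup>2"
      unfolding \<eta>_def dm by (rule l2n_young[OF fA _ _ s]) (use dF w0 in auto)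
    have 3: "(l2n (dev F + dev G))\<^sup>2 + (l2n (dev F - dev G))\<^sup>2 = 2 * (\<eta> F + \<eta> G)"
      unfolding \<eta>_def by (rule l2n_parallelogram[OF fA]) (use dF in auto)
    have "\<eta> (F + G) + \<eta> (F - G) \<le> (1 + 1/s) * ((l2n (dev F + dev G))\<^sup>2 + (l2n (dev F - dev G))\<^sup>2)
        + (1 + s) * ((l2n wp)\<^sup>2 + (l2n wm)\<^sup>2)"
      using 1 2 by (simp add: distrib_left)
    also have "\<dots> \<le> (1 + 1/s) * (2 * (\<eta> F + \<eta> G)) + (1 + s) * (2 * (576 * (\<alpha> F + \<alpha> G)))"
      unfolding 3 using bp bm s by (intro add_left_mono mult_left_mono) auto
    finally show ?thesis by (simp only: ac_simps)
  qed
  have upper: "(qn 2 F)\<^sup>2 \<le> 169 * (\<eta> F + \<alpha> F)" if X: "F \<in> X" for F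
  proof -
    have F: "calf F" using X by (simp add: X_def)
    note LF = L[OF X]
    have fd: "finite {n. dev F n \<noteq> 0}"
      by (rule finite_subset[of _ "fsupp F"]) (use dev0 X in \<open>auto simp: X_def\<close>)
    note Ld = calf_lift[OF fd] cN_lift[OF fd]
    \<comment> \<open>The factor \<open>3/2\<close> undoes the derivative \<open>2/3\<close> of
      \<open>phi\<close>, so \<open>?G\<close> has value 0 and derivative \<open>dev F\<close> at
      \<open>1/2\<close>.\<close>
    let ?G = "mul (\<lambda>z. 3/2) (mul phi (lift (dev F)))"
    have cp: "calf (mul phi (lift (dev F)))" using Ld by (intro calf_mul) auto
    have "jeq 2 ?G (F - lift (F (1/2)))"
      unfolding jeq_2_iff
    proof (intro allI conjI)
      fix n
      show "jet 0 ?G n = jet 0 (F - lift (F (1/2))) n" by (simp add: lift_half)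
      have "jet (Suc 0) ?G n = 3/2 * (2/3 * lift (dev F) (1/2) n)"
        using jet_cmult[OF cp, of "Suc 0" "3/2" n] jet_mul_012(2)[OF multiplier_phi Ld(1), of n] by simp
      then show "jet (Suc 0) ?G n = jet (Suc 0) (F - lift (F (1/2))) n"
        by (simp add: lift_half dev_def)
    qed
    then have "qn 2 (F - lift (F (1/2))) \<le> cN ?G" using cp by (intro qn_leI calf_cmult) (auto intro: jeq_sym)
    also have "\<dots> \<le> 3/2 * cN (lift (dev F))"
      using cN_cmult[OF cp, of "3/2"] cN_phi[OF Ld(1)] by simp
    also have "\<dots> \<le> 3 * l2n (dev F)" using Ld(2) by simp
    finally have "qn 2 F \<le> 3 * l2n (dev F) + 2 * l2n (F (1/2))"
      using qn_triangle[OF F LF(1), of 2] qn_le_cN[OF LF(1), of 2] LF(2) by linarith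
    then have "(qn 2 F)\<^sup>2 \<le> 2 * ((3 * l2n (dev F))\<^sup>2 + (2 * l2n (F (1/2)))\<^sup>2)"
      using qn_nonneg[OF F] by (intro sq_le_sum)
    also have "\<dots> = 18 * \<eta> F + 8 * \<alpha> F" by (simp add: \<eta>_def \<alpha>_def power_mult_distrib)
    also have "\<dots> \<le> 169 * (\<eta> F + \<alpha> F)" using \<alpha>0[of F] by (simp add: \<eta>_def)
    finally show ?thesis .
  qed
  have lower: "\<eta> F + \<alpha> F \<le> 169 * (qn 2 F)\<^sup>2" if X: "F \<in> X" for F
  proof -
    have F: "calf F" and fF: "finite (fsupp F)" using X by (simp_all add: X_def)
    note LF = L[OF X]
    \<comment> \<open>For a representative of norm \<open>c\<close>, the value has norm at most
      \<open>c\<close> and the deviation at most \<open>4 * (c + 2 * c)\<close>; then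
      \<open>12\<^sup>2 + 1 \<le> 13\<^sup>2 = 169\<close>.\<close>
    have "sqrt (\<eta> F + \<alpha> F) / 13 \<le> qn 2 F"
    proof (rule qn_geI[OF F])
      fix G assume G: "calf G" "jeq 2 G F"
      have G0: "jet 0 G n = F (1/2) n" and G1: "jet (Suc 0) G n = jet (Suc 0) F n" for n
        using G(2) unfolding jeq_2_iff by simp_all
      have "sqrt (\<Sum>n\<in>fsupp F. (cmod (jet 0 G n))\<^sup>2) \<le> 4 ^ 0 * cN G"
        by (rule jet_l2_bound[OF G(1) fF]) simp
      then have 1: "l2n (F (1/2)) \<le> cN G" using l2n_eq[OF fF, of "F (1/2)"] half0 G0 by simp
      let ?E = "G - lift (F (1/2))"
      have E: "calf ?E" using G(1) LF by (intro calf_diff)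
      have E1: "jet 1 ?E = dev F"
        using G(1) F LF G1 by (simp add: dev_def jet_diff fun_eq_iff del: minus_apply[of F])
      have "sqrt (\<Sum>n\<in>fsupp F. (cmod (jet 1 ?E n))\<^sup>2) \<le> 4 ^ 1 * cN ?E"
      proof (rule jet_l2_bound[OF E fF])
        show "jet i ?E n = 0" if "i < 1" for i n using that G0 by (simp add: lift_half)
      qed
      then have "l2n (dev F) \<le> 4 * cN ?E" unfolding E1 using l2n_eq[OF fF, of "dev F"] dev0 by simp
      moreover have "cN ?E \<le> cN G + cN (- lift (F (1/2)))" using cN_add[OF G(1) calf_uminus[OF LF(1)]] by simp
      ultimately have 2: "l2n (dev F) \<le> 12 * cN G" using cN_uminus[OF LF(1)] LF(2) 1 by linarith
      have "\<eta> F + \<alpha> F \<le> (12 * cN G)\<^sup>2 + (cN G)\<^sup>2"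
        unfolding \<eta>_def \<alpha>_def using 1 2 l2n_nonneg by (intro add_mono power_mono)
      also have "\<dots> \<le> (13 * cN G)\<^sup>2" by (simp add: power2_eq_square)
      finally have "\<eta> F + \<alpha> F \<le> (13 * cN G)\<^sup>2" .
      moreover have "0 \<le> 13 * cN G" using cN_nonneg[OF G(1)] by simp
      ultimately have "sqrt (\<eta> F + \<alpha> F) \<le> 13 * cN G" by (intro real_le_lsqrt)
      then show "sqrt (\<eta> F + \<alpha> F) / 13 \<le> cN G" by simp
    qed
    then have "sqrt (\<eta> F + \<alpha> F) \<le> 13 * qn 2 F" by simp
    then have "(sqrt (\<eta> F + \<alpha> F))\<^sup>2 \<le> (13 * qn 2 F)\<^sup>2" by (intro power_mono) (simp_all add: \<eta>_def \<alpha>_def)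
    then show ?thesis by (simp add: \<eta>_def \<alpha>_def power_mult_distrib)
  qed
  have "sign_type X (qn 2)"
  proof (rule sign_typeI[where \<eta> = \<eta> and \<alpha> = \<alpha> and C = 576 and D = 169])
    show "0 \<le> qn 2 F" if "F \<in> X" for F using that qn_nonneg by (simp add: X_def)
  qed (use Xadd Xdiff alpha eta \<alpha>0 upper lower in \<open>auto simp: \<eta>_def\<close>)
  then show ?thesis by (simp only: X_def)
qed

text \<open>By \<open>qn_tail\<close> each function is truncated to finite support with error
  \<open>R / 2 ^ k\<close>, so the errors of all \<open>2 ^ k\<close> functions sum to
  \<open>R\<close>. The case \<open>R = 0\<close> is separate because the error must be
  positive.\<close>

lemma sign_type_qn2: "sign_type {F. calf F} (qn 2)"
proof -
  obtain C where C: "C \<ge> 0" "\<And>k R F. k \<ge> 1 \<Longrightarrow> R \<ge> 0 \<Longrightarrow> (\<And>i. i < 2 ^ k \<Longrightarrow> calf (F i) \<and> finite (fsupp (F i)) \<and> qn 2 (F i) \<le> R) \<Longrightarrow>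
      \<exists>\<epsilon>. qn 2 (signed_sum \<epsilon> (2 ^ k) F) \<le> C * R * real k * sqrt (2 ^ k)"
    using sign_type_qn2_finite unfolding sign_type_def by fastforce
  show ?thesis
    unfolding sign_type_def
  proof (intro exI[of _ "2 * C + 1"] conjI allI impI)
    show "0 \<le> 2 * C + 1" using C by simp
    fix k :: nat and R :: real and F :: "nat \<Rightarrow> complex \<Rightarrow> cseq"
    assume k: "1 \<le> k" and R: "0 \<le> R" and F: "\<forall>i<2 ^ k. F i \<in> {F. calf F} \<and> qn 2 (F i) \<le> R"
    then have cF: "calf (F i)" "qn 2 (F i) \<le> R" if "i < 2 ^ k" for i using that by auto
    show "\<exists>\<epsilon>. qn 2 (signed_sum \<epsilon> (2 ^ k) F) \<le> (2 * C + 1) * R * real k * sqrt (2 ^ k)"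
    proof (cases "R = 0")
      case True
      have "qn 2 (signed_sum (\<lambda>_. True) (2 ^ k) F) \<le> (\<Sum>i<2^k. qn 2 (F i))" by (rule qn_signed_sum) (rule cF)
      also have "\<dots> \<le> (\<Sum>i<(2::nat)^k. 0)" using cF True by (intro sum_mono) auto
      finally show ?thesis using True by auto
    next
      case False
      define e where "e = R / 2 ^ k"
      have e: "e > 0" "e \<le> R" using R False by (auto simp: e_def divide_le_eq intro: mult_left_mono[of 1 _ R, simplified])
      have "\<exists>M. qn 3 (restr {M..} (F i)) < e" if "i < 2 ^ k" for i
        using qn_tail[OF cF(1)[OF that] e(1)] by blast
      then obtain M where M: "\<And>i. i < 2 ^ k \<Longrightarrow> qn 3 (restr {M i..} (F i)) < e" by metis
      define G where "G = (\<lambda>i. restr {..<M i} (F i))"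
      have FG: "F i - G i = restr {M i..} (F i)" for i by (auto simp: G_def fun_eq_iff)
      have G: "calf (G i)" "finite (fsupp (G i))" "qn 2 (F i - G i) \<le> e" "qn 2 (G i) \<le> 2 * R" if i: "i < 2 ^ k" for i
      proof -
        show 1: "calf (G i)" unfolding G_def by (intro calf_restr cF i)
        show "finite (fsupp (G i))"
          by (rule finite_subset[of _ "{..<M i}"]) (auto simp: G_def fsupp_def split: if_splits)
        show 2: "qn 2 (F i - G i) \<le> e"
          unfolding FG using M[OF i] qn_mono[of "restr {M i..} (F i)" 2 3] calf_restr cF(1)[OF i] by fastforce
        have "qn 2 (G i - F i) = qn 2 (F i - G i)"
          using qn_uminus[OF calf_diff[OF cF(1)[OF i] 1], of 2] by simp
        then show "qn 2 (G i) \<le> 2 * R" using qn_triangle[OF 1 cF(1)[OF i], of 2] 2 cF(2)[OF i] e by linarith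
      qed
      have "0 \<le> 2 * R" using R by simp
      then obtain \<epsilon> where \<epsilon>: "qn 2 (signed_sum \<epsilon> (2 ^ k) G) \<le> C * (2 * R) * real k * sqrt (2 ^ k)"
        using C(2)[OF k, of "2 * R" G] G by blast
      have cs: "calf (signed_sum \<epsilon> (2 ^ k) F)" "calf (signed_sum \<epsilon> (2 ^ k) G)"
        by (intro calf_signed_sum cF G; assumption)+
      have "qn 2 (signed_sum \<epsilon> (2 ^ k) (\<lambda>i. F i - G i)) \<le> (\<Sum>i<2^k. qn 2 (F i - G i))"
        by (intro qn_signed_sum calf_diff cF G)
      also have "\<dots> \<le> (\<Sum>i<(2::nat)^k. e)" using G by (intro sum_mono) auto
      also have "\<dots> = R" by (simp add: e_def)
      finally have "qn 2 (signed_sum \<epsilon> (2 ^ k) F) \<le> C * (2 * R) * real k * sqrt (2 ^ k) + R"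
        using qn_triangle[OF cs, of 2] \<epsilon> unfolding signed_sum_diff by linarith
      also have "R * (1 * 1) \<le> R * (real k * sqrt (2 ^ k))"
        using k R by (intro mult_left_mono mult_mono) auto
      then have "C * (2 * R) * real k * sqrt (2 ^ k) + R \<le> (2 * C + 1) * R * real k * sqrt (2 ^ k)"
        by (simp add: algebra_simps)
      finally show ?thesis by blast
    qed
  qed
qed

lemma Z3_operator_Z2:
  assumes U: "bounded_operator Z3 Z2 U" shows "Z3_operator Z2 U"
proof
  show "nrm Z2 (add Z2 x y) \<le> nrm Z2 x + nrm Z2 y" if "x \<in> carr Z2" "y \<in> carr Z2" for x y
  proof -
    obtain F G where "calf F" "x = J2 F" "calf G" "y = J2 G" using \<open>x \<in> carr Z2\<close> \<open>y \<in> carr Z2\<close> unfolding carr_Z2 by blast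
    then show ?thesis using qn_add[of F G 2] by (simp add: J2_add[symmetric] nrm_Z2 calf_add del: plus_fun_apply)
  qed
  show "nrm Z2 (scl Z2 c x) \<le> cmod c * nrm Z2 x" if x: "x \<in> carr Z2" for x c
  proof -
    obtain F where "calf F" "x = J2 F" using x unfolding carr_Z2 by blast
    then show ?thesis using qn_cmult[of F 2 c] by (simp add: J2_scl[symmetric] nrm_Z2 calf_cmult del: mul_apply)
  qed
  show "0 \<le> nrm Z2 x" if x: "x \<in> carr Z2" for x
  proof -
    obtain F where "calf F" "x = J2 F" using x unfolding carr_Z2 by blast
    then show ?thesis using qn_nonneg[of F 2] by (simp add: nrm_Z2)
  qed
qed (rule U)

text \<open>The images of the jets are represented by Calderon functions, one for each summand;
  linearity carries signed sums over to the representatives, where \<open>sign_type_qn2\<close>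
  applies.\<close>

lemma sign_type_Z2:
  assumes U: "bounded_operator Z3 Z2 U"
  shows "sign_type {F. calf F} (Z3_operator.p Z2 U)"
proof -
  interpret Z3_operator Z2 U by (rule Z3_operator_Z2[OF U])
  obtain C where C: "C \<ge> 0" "\<And>k R F. k \<ge> 1 \<Longrightarrow> R \<ge> 0 \<Longrightarrow> (\<And>i. i < 2 ^ k \<Longrightarrow> calf (F i) \<and> qn 2 (F i) \<le> R) \<Longrightarrow>
      \<exists>\<epsilon>. qn 2 (signed_sum \<epsilon> (2 ^ k) F) \<le> C * R * real k * sqrt (2 ^ k)"
    using sign_type_qn2 unfolding sign_type_def by fastforce
  show ?thesis
    unfolding sign_type_def
  proof (intro exI[of _ C] conjI allI impI C(1))
    fix k :: nat and R :: real and F :: "nat \<Rightarrow> complex \<Rightarrow> cseq"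
    assume k: "1 \<le> k" and R: "0 \<le> R" and F: "\<forall>i<2 ^ k. F i \<in> {F. calf F} \<and> p (F i) \<le> R"
    have "\<exists>G. calf G \<and> U (J3 (F i)) = J2 G" if "i < 2 ^ k" for i
    proof -
      have "U (J3 (F i)) \<in> carr Z2" using F that by (intro U_carr) auto
      then show ?thesis unfolding carr_Z2 by blast
    qed
    then obtain G where G: "\<And>i. i < 2 ^ k \<Longrightarrow> calf (G i) \<and> U (J3 (F i)) = J2 (G i)" by metis
    have eq: "U (J3 (signed_sum \<epsilon> N F)) = J2 (signed_sum \<epsilon> N G)" if "N \<le> 2 ^ k" for N \<epsilon>
      using that
    proof (induction N)
      case 0
      have "U (J3 0) = U (scl Z3 0 (J3 0))" using J3_scl[OF calf_0, of 0] by (simp add: mul_def zero_fun_def)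
      also have "\<dots> = scl Z2 0 (U (J3 0))" using U calf_0 by (simp add: bounded_operator_def)
      also have "\<dots> = J2 0" by (cases "U (J3 0)") (simp add: Z2_ops J2_def jet_def fun_eq_iff)
      finally show ?case by (simp only: signed_sum_def lessThan_0 sum.empty)
    next
      case (Suc N)
      have N: "calf (F N)" "calf (G N)" "U (J3 (F N)) = J2 (G N)" using F G[of N] Suc.prems by auto
      have sg: "U (J3 (sg b (F N))) = J2 (sg b (G N))" for b
        using U_scl[OF N(1), of "-1"] J2_scl[OF N(2), of "-1"] N(3)
        by (cases b) (simp_all add: sg_def uminus_eq_mul del: mul_apply)
      have cs: "calf (signed_sum \<epsilon> N F)" "calf (signed_sum \<epsilon> N G)"
        using F G Suc.prems by (intro calf_signed_sum; simp)+
      have "signed_sum \<epsilon> (Suc N) H = signed_sum \<epsilon> N H + sg (\<epsilon> N) (H N)" for H :: "nat \<Rightarrow> complex \<Rightarrow> cseq"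
        by (simp add: signed_sum_def)
      then show ?case
        using Suc sg[of "\<epsilon> N"] U_add[OF cs(1) calf_sg[OF N(1), of "\<epsilon> N"]] J2_add[OF cs(2) calf_sg[OF N(2), of "\<epsilon> N"]]
        by (simp only: Suc_leD)
    qed
    have "calf (G i) \<and> qn 2 (G i) \<le> R" if "i < 2 ^ k" for i
      using F G[OF that] that nrm_Z2[of "G i"] by (auto simp: p_def)
    then obtain \<epsilon> where \<epsilon>: "qn 2 (signed_sum \<epsilon> (2 ^ k) G) \<le> C * R * real k * sqrt (2 ^ k)"
      using C(2)[OF k R, of G] by blast
    have "calf (signed_sum \<epsilon> (2 ^ k) G)" using G by (intro calf_signed_sum) auto
    then have "p (signed_sum \<epsilon> (2 ^ k) F) = qn 2 (signed_sum \<epsilon> (2 ^ k) G)"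
      using eq[of "2 ^ k" \<epsilon>] by (simp add: p_def nrm_Z2)
    then show "\<exists>\<epsilon>. p (signed_sum \<epsilon> (2 ^ k) F) \<le> C * R * real k * sqrt (2 ^ k)" using \<epsilon> by metis
  qed
qed

section \<open>Operators into twisted Hilbert spaces\<close>

lemma hilbert_parallelogram:
  assumes K: "hilbert_space K" and u: "u \<in> carr K" and v: "v \<in> carr K"
  shows "(nrm K (add K u v))\<^sup>2 + (nrm K (add K u (scl K (-1) v)))\<^sup>2 = 2 * ((nrm K u)\<^sup>2 + (nrm K v)\<^sup>2)"
proof -
  obtain ip where ip: "inner_product_of K ip" using K by (auto simp: hilbert_space_def)
  interpret complex_banach_space K using K by (simp add: hilbert_space_def)
  have add: "ip (add K x y) z = ip x z + ip y z" if "x \<in> carr K" "y \<in> carr K" "z \<in> carr K" for x y z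
    using ip that unfolding inner_product_of_def by blast
  have scl: "ip (scl K c x) y = c * ip x y" if "x \<in> carr K" "y \<in> carr K" for c x y
    using ip that unfolding inner_product_of_def by blast
  have sym: "ip y x = cnj (ip x y)" if "x \<in> carr K" "y \<in> carr K" for x y
    using ip that unfolding inner_product_of_def by blast
  have sq: "ip x x = complex_of_real ((nrm K x)\<^sup>2)" if "x \<in> carr K" for x
    using ip that unfolding inner_product_of_def by blast
  have exp: "complex_of_real ((nrm K (add K u w))\<^sup>2) = ip u u + ip u w + cnj (ip u w) + ip w w" if w: "w \<in> carr K" for w
  proof -
    have uw: "add K u w \<in> carr K" by (rule add_closed[OF u w])
    have "ip u (add K u w) = cnj (ip (add K u w) u)" by (rule sym[OF uw u])
    also have "\<dots> = cnj (ip u u) + cnj (ip w u)" using add[OF u w u] by simp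
    also have "\<dots> = ip u u + ip u w" using sym[OF u u] sym[OF w u] by simp
    finally have 1: "ip u (add K u w) = ip u u + ip u w" .
    have "ip w (add K u w) = cnj (ip (add K u w) w)" by (rule sym[OF uw w])
    also have "\<dots> = cnj (ip u w) + cnj (ip w w)" using add[OF u w w] by simp
    also have "\<dots> = cnj (ip u w) + ip w w" using sym[OF w w] by simp
    finally have 2: "ip w (add K u w) = cnj (ip u w) + ip w w" .
    have "complex_of_real ((nrm K (add K u w))\<^sup>2) = ip (add K u w) (add K u w)" by (rule sq[OF uw, symmetric])
    also have "\<dots> = ip u (add K u w) + ip w (add K u w)" by (rule add[OF u w uw])
    finally show ?thesis unfolding 1 2 by (simp only: add.assoc)
  qed
  have nv: "scl K (-1) v \<in> carr K" by (rule scl_closed[OF v])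
  have "ip u (scl K (-1) v) = cnj (ip (scl K (-1) v) u)" by (rule sym[OF nv u])
  also have "\<dots> = - ip u v" using scl[OF v u, of "-1"] sym[OF v u] by simp
  finally have 1: "ip u (scl K (-1) v) = - ip u v" .
  have "nrm K (scl K (-1) v) = nrm K v" using nrm_scl[OF v, of "-1"] by simp
  then have 2: "ip (scl K (-1) v) (scl K (-1) v) = ip v v" using sq[OF nv] sq[OF v] by simp
  have "complex_of_real ((nrm K (add K u v))\<^sup>2 + (nrm K (add K u (scl K (-1) v)))\<^sup>2) =
      complex_of_real (2 * ((nrm K u)\<^sup>2 + (nrm K v)\<^sup>2))"
    using exp[OF v] exp[OF nv] sq[OF u] sq[OF v] unfolding 1 2 by simp
  then show ?thesis unfolding of_real_eq_iff .
qed

section \<open>Computing relative to a carrier\<close>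

context complex_normed_space
begin

lemma add_left_commute:
  "\<lbrakk>x \<in> carr V; y \<in> carr V; z \<in> carr V\<rbrakk> \<Longrightarrow> add V x (add V y z) = add V y (add V x z)"
  by (metis add_assoc add_commute add_closed)

lemma scl_zero: "x \<in> carr V \<Longrightarrow> scl V 0 x = zer V"
  using nrm_eq_0[OF scl_closed, of x 0] nrm_scl[of x 0] by simp

lemma add_neg: "x \<in> carr V \<Longrightarrow> add V x (scl V (-1) x) = zer V"
  using diff_self by (simp add: vdiff_def)

lemma neg_add: "x \<in> carr V \<Longrightarrow> add V (scl V (-1) x) x = zer V"
  using add_neg[of x] add_commute[of x "scl V (-1) x"] scl_closed by simp

lemma nrm_neg: "x \<in> carr V \<Longrightarrow> nrm V (scl V (-1) x) = nrm V x"
  using nrm_scl[of x "-1"] by simp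

lemma nrm_zer: "nrm V (zer V) = 0"
  using nrm_eq_0[OF zer_closed] by simp

lemma scl_zer: "scl V c (zer V) = zer V"
  using nrm_eq_0[OF scl_closed[OF zer_closed], of c] nrm_scl[OF zer_closed, of c] nrm_zer by simp

text \<open>The rearrangement behind the identity \<open>add X b \<omega> = hh z\<close> in the
  estimate for twisted sums.\<close>

lemma add_cancel_pairs:
  assumes c: "A \<in> carr V" "N \<in> carr V" "B \<in> carr V" "M \<in> carr V" "P \<in> carr V" "Q \<in> carr V" "R \<in> carr V"
    and "add V N P = zer V" "add V M Q = zer V"
  shows "add V (add V (add V A N) (add V B M)) (add V (add V P Q) R) = add V (add V A B) R"
proof -
  have "add V (add V (add V A N) (add V B M)) (add V (add V P Q) R)
      = add V (add V (add V A B) R) (add V (add V N P) (add V M Q))"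
    using c by (simp add: add_assoc add_commute add_left_commute add_closed)
  then show ?thesis using assms by (simp add: add_zer add_closed zer_closed)
qed

lemma add_solve:
  assumes "b \<in> carr V" "w \<in> carr V" "add V b w = z" shows "w = add V z (scl V (-1) b)"
proof -
  have "add V z (scl V (-1) b) = add V w (add V b (scl V (-1) b))"
    using assms scl_closed[of b "-1"] by (simp add: assms(3)[symmetric] add_assoc add_commute add_left_commute add_closed)
  then show ?thesis using assms by (simp add: add_neg add_zer)
qed

end

lemma bounded_operator_bound:
  assumes "bounded_operator V W T" and "\<And>x. x \<in> carr V \<Longrightarrow> 0 \<le> nrm V x"
  shows "\<exists>K\<ge>0. \<forall>x\<in>carr V. nrm W (T x) \<le> K * nrm V x"
proof -
  obtain K where K: "\<And>x. x \<in> carr V \<Longrightarrow> nrm W (T x) \<le> K * nrm V x"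
    using assms(1) unfolding bounded_operator_def by blast
  have "nrm W (T x) \<le> max K 0 * nrm V x" if "x \<in> carr V" for x
    using K[OF that] mult_right_mono[of K "max K 0" "nrm V x"] assms(2)[OF that] by simp
  then show ?thesis by (intro exI[of _ "max K 0"]) auto
qed

lemma isomorphism_inverse:
  assumes "isomorphism V W T" "x \<in> carr V" shows "inv_into (carr V) T (T x) = x"
  using assms by (simp add: isomorphism_def bij_betw_def)

locale twisted_sum = complex_normed_space X for X :: "'x cspace" +
  fixes H and K1 :: "'x cspace" and R1 and K2 :: "'x set cspace" and R2
  assumes H: "linear_subspace X H"
    and K1: "hilbert_space K1" and R1: "isomorphism (subspace_as_space X H) K1 R1"
    and K2: "hilbert_space K2" and R2: "isomorphism (quotient_space X H) K2 R2"
begin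

sublocale K1: complex_banach_space K1 using K1 by (simp add: hilbert_space_def)
sublocale K2: complex_banach_space K2 using K2 by (simp add: hilbert_space_def)

lemma H_carr: "h \<in> H \<Longrightarrow> h \<in> carr X" and H_zer: "zer X \<in> H"
  and H_add: "\<lbrakk>h \<in> H; k \<in> H\<rbrakk> \<Longrightarrow> add X h k \<in> H" and H_scl: "h \<in> H \<Longrightarrow> scl X c h \<in> H"
  using H by (auto simp: linear_subspace_def)

lemma mem_coset: "x \<in> carr X \<Longrightarrow> x \<in> coset X H x"
  unfolding coset_def using H_zer add_zer by force

lemma coset_add:
  assumes "x \<in> carr X" "y \<in> carr X"
  shows "add (quotient_space X H) (coset X H x) (coset X H y) = coset X H (add X x y)"
proof -
  have "{add X a b | a b. a \<in> coset X H x \<and> b \<in> coset X H y} = coset X H (add X x y)"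
  proof (intro equalityI subsetI)
    fix w assume "w \<in> {add X a b | a b. a \<in> coset X H x \<and> b \<in> coset X H y}"
    then obtain h k where hk: "h \<in> H" "k \<in> H" "w = add X (add X x h) (add X y k)" by (auto simp: coset_def)
    then have "w = add X (add X x y) (add X h k)"
      using assms H_carr by (simp add: add_assoc add_commute add_left_commute add_closed)
    then show "w \<in> coset X H (add X x y)" using hk H_add by (auto simp: coset_def)
  next
    fix w assume "w \<in> coset X H (add X x y)"
    then obtain h where h: "h \<in> H" "w = add X (add X x y) h" by (auto simp: coset_def)
    then have "w = add X x (add X y h)" using assms H_carr by (simp add: add_assoc)
    moreover have "add X y h \<in> coset X H y" using h by (auto simp: coset_def)
    ultimately show "w \<in> {add X a b | a b. a \<in> coset X H x \<and> b \<in> coset X H y}" using mem_coset[OF assms(1)] by blast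
  qed
  then show ?thesis by (simp add: quotient_space_def)
qed

lemma coset_scl:
  assumes "x \<in> carr X"
  shows "scl (quotient_space X H) c (coset X H x) = coset X H (scl X c x)"
proof -
  have "{add X (scl X c a) h | a h. a \<in> coset X H x \<and> h \<in> H} = coset X H (scl X c x)"
  proof (intro equalityI subsetI)
    fix w assume "w \<in> {add X (scl X c a) h | a h. a \<in> coset X H x \<and> h \<in> H}"
    then obtain h k where hk: "h \<in> H" "k \<in> H" "w = add X (scl X c (add X x h)) k" by (auto simp: coset_def)
    then have "w = add X (scl X c x) (add X (scl X c h) k)"
      using assms H_carr by (simp add: scl_add_right add_assoc scl_closed)
    then show "w \<in> coset X H (scl X c x)" using hk H_add H_scl by (auto simp: coset_def)
  next
    fix w assume "w \<in> coset X H (scl X c x)"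
    then show "w \<in> {add X (scl X c a) h | a h. a \<in> coset X H x \<and> h \<in> H}"
      using mem_coset[OF assms] by (auto simp: coset_def)
  qed
  then show ?thesis by (simp add: quotient_space_def)
qed

lemma coset_carr: "x \<in> carr X \<Longrightarrow> coset X H x \<in> carr (quotient_space X H)"
  by (simp add: quotient_space_def)

lemma coset_subset: "x \<in> carr X \<Longrightarrow> coset X H x \<subseteq> carr X"
  using add_closed H_carr by (auto simp: coset_def)

lemma bdd_below_coset: "x \<in> carr X \<Longrightarrow> bdd_below (nrm X ` coset X H x)"
  using coset_subset nrm_nonneg unfolding bdd_below_def by blast

lemma nrm_coset_le: "x \<in> carr X \<Longrightarrow> nrm (quotient_space X H) (coset X H x) \<le> nrm X x"
  unfolding quotient_space_def using cINF_lower[OF bdd_below_coset mem_coset] by simp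

lemma nrm_coset_nonneg: "x \<in> carr X \<Longrightarrow> 0 \<le> nrm (quotient_space X H) (coset X H x)"
  unfolding quotient_space_def using coset_subset[of x] mem_coset[of x] nrm_nonneg
  by (auto intro!: cINF_greatest)

definition q :: "'x \<Rightarrow> real" where "q x = nrm K2 (R2 (coset X H x))"

lemma R2_carr: "x \<in> carr X \<Longrightarrow> R2 (coset X H x) \<in> carr K2"
  using R2 coset_carr by (simp add: isomorphism_def bounded_operator_def)

lemma R2_add: "\<lbrakk>x \<in> carr X; y \<in> carr X\<rbrakk> \<Longrightarrow> R2 (coset X H (add X x y)) = add K2 (R2 (coset X H x)) (R2 (coset X H y))"
  using R2 coset_carr[of x] coset_carr[of y] unfolding isomorphism_def bounded_operator_def
  by (simp add: coset_add[symmetric])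

lemma R2_scl: "x \<in> carr X \<Longrightarrow> R2 (coset X H (scl X c x)) = scl K2 c (R2 (coset X H x))"
  using R2 coset_carr[of x] unfolding isomorphism_def bounded_operator_def
  by (simp add: coset_scl[symmetric])

lemma q_nonneg: "x \<in> carr X \<Longrightarrow> 0 \<le> q x"
  unfolding q_def by (intro K2.nrm_nonneg R2_carr)

lemma q_parallelogram:
  "\<lbrakk>x \<in> carr X; y \<in> carr X\<rbrakk> \<Longrightarrow> (q (add X x y))\<^sup>2 + (q (add X x (scl X (-1) y)))\<^sup>2 = 2 * ((q x)\<^sup>2 + (q y)\<^sup>2)"
  unfolding q_def using hilbert_parallelogram[OF K2 R2_carr R2_carr, of x y]
  by (simp add: R2_add R2_scl scl_closed)

lemma quotient_carr_nonneg: "A \<in> carr (quotient_space X H) \<Longrightarrow> 0 \<le> nrm (quotient_space X H) A"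
  using nrm_coset_nonneg by (auto simp: quotient_space_def)

lemma q_le: "\<exists>C\<ge>0. \<forall>x\<in>carr X. q x \<le> C * nrm X x"
proof -
  have "bounded_operator (quotient_space X H) K2 R2" using R2 by (simp add: isomorphism_def)
  then obtain C where C: "C \<ge> 0" "\<And>A. A \<in> carr (quotient_space X H) \<Longrightarrow> nrm K2 (R2 A) \<le> C * nrm (quotient_space X H) A"
    using bounded_operator_bound quotient_carr_nonneg by metis
  have "q x \<le> C * nrm X x" if "x \<in> carr X" for x
    using C(2)[OF coset_carr[OF that]] mult_left_mono[OF nrm_coset_le[OF that] C(1)] by (simp add: q_def)
  with C show ?thesis by blast
qed

text \<open>A bounded, in general nonlinear, choice of representatives modulo \<open>H\<close>; its
  failure to be additive is the twist. \<open>C + 1\<close> makes the inequality strict for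
  \<open>q x > 0\<close>, so that an element of the coset realises it.\<close>

lemma q_lift: "\<exists>C\<ge>0. \<forall>x\<in>carr X. \<exists>l\<in>carr X. add X x (scl X (-1) l) \<in> H \<and> nrm X l \<le> C * q x"
proof -
  have b: "bounded_operator K2 (quotient_space X H) (inv_into (carr (quotient_space X H)) R2)"
    using R2 by (simp add: isomorphism_def)
  obtain C where C: "C \<ge> 0" "\<And>y. y \<in> carr K2 \<Longrightarrow>
      nrm (quotient_space X H) (inv_into (carr (quotient_space X H)) R2 y) \<le> C * nrm K2 y"
    using bounded_operator_bound[OF b] K2.nrm_nonneg by metis
  have C': "nrm (quotient_space X H) (coset X H x) \<le> C * q x" if "x \<in> carr X" for x
    using C(2)[OF R2_carr[OF that]] isomorphism_inverse[OF R2 coset_carr[OF that]] by (simp add: q_def)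
  have mem: "add X x (scl X (-1) l) \<in> H \<and> l \<in> carr X" if x: "x \<in> carr X" and l: "l \<in> coset X H x" for x l
  proof -
    obtain h where h: "h \<in> H" "l = add X x h" using l by (auto simp: coset_def)
    have "add X x (scl X (-1) l) = add X (add X x (scl X (-1) x)) (scl X (-1) h)"
      using h x H_carr by (simp add: scl_add_right add_assoc scl_closed)
    also have "\<dots> = scl X (-1) h" using x h H_carr scl_closed
      by (simp add: add_neg add_commute[OF zer_closed] add_zer)
    finally show ?thesis using H_scl[OF h(1)] coset_subset[OF x] l by auto
  qed
  have "\<exists>l\<in>carr X. add X x (scl X (-1) l) \<in> H \<and> nrm X l \<le> (C + 1) * q x" if x: "x \<in> carr X" for x
  proof (cases "q x = 0")
    \<comment> \<open>Here the bound forces the representative 0, which injectivity of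
      \<open>R2\<close> places in the coset of \<open>x\<close>.\<close>
    case True
    then have "R2 (coset X H x) = zer K2" using K2.nrm_eq_0[OF R2_carr[OF x]] by (simp add: q_def)
    also have "\<dots> = R2 (coset X H (scl X 0 x))" using K2.scl_zero[OF R2_carr[OF x]] R2_scl[OF x, of 0] by simp
    finally have "coset X H x = coset X H (scl X 0 x)"
      using isomorphism_inverse[OF R2 coset_carr[OF x]] isomorphism_inverse[OF R2 coset_carr[OF scl_closed[OF x]]] by metis
    then have "zer X \<in> coset X H x" using mem_coset[OF zer_closed] by (simp add: scl_zero[OF x])
    then show ?thesis using mem[OF x] nrm_zer True by (intro bexI[of _ "zer X"]) auto
  next
    case False
    then have "q x > 0" using q_nonneg[OF x] by simp
    then have "nrm (quotient_space X H) (coset X H x) < (C + 1) * q x" using C'[OF x] by (simp add: distrib_right)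
    then have "(INF a\<in>coset X H x. nrm X a) < (C + 1) * q x" by (simp add: quotient_space_def)
    then obtain l where "l \<in> coset X H x" "nrm X l < (C + 1) * q x"
      using cINF_less_iff[OF _ bdd_below_coset[OF x]] mem_coset[OF x] by blast
    then show ?thesis using mem[OF x] by (intro bexI[of _ l]) auto
  qed
  then show ?thesis using C(1) by (intro exI[of _ "C + 1"]) auto
qed

definition \<beta> :: "'x \<Rightarrow> real" where "\<beta> h = nrm K1 (R1 h)"

lemma R1_op: "h \<in> H \<Longrightarrow> R1 h \<in> carr K1" "\<lbrakk>h \<in> H; k \<in> H\<rbrakk> \<Longrightarrow> R1 (add X h k) = add K1 (R1 h) (R1 k)"
    "h \<in> H \<Longrightarrow> R1 (scl X c h) = scl K1 c (R1 h)"
  using R1 by (simp_all add: isomorphism_def bounded_operator_def subspace_as_space_def)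

lemma beta_nonneg: "h \<in> H \<Longrightarrow> 0 \<le> \<beta> h"
  unfolding \<beta>_def by (intro K1.nrm_nonneg R1_op)

lemma beta_add: "\<lbrakk>h \<in> H; k \<in> H\<rbrakk> \<Longrightarrow> \<beta> (add X h k) \<le> \<beta> h + \<beta> k"
  unfolding \<beta>_def by (simp add: R1_op K1.nrm_triangle)

lemma beta_parallelogram:
  "\<lbrakk>x \<in> H; y \<in> H\<rbrakk> \<Longrightarrow> (\<beta> (add X x y))\<^sup>2 + (\<beta> (add X x (scl X (-1) y)))\<^sup>2 = 2 * ((\<beta> x)\<^sup>2 + (\<beta> y)\<^sup>2)"
  unfolding \<beta>_def using hilbert_parallelogram[OF K1 R1_op(1) R1_op(1), of x y] by (simp add: R1_op H_scl)

lemma beta_le: "\<exists>C\<ge>0. \<forall>h\<in>H. \<beta> h \<le> C * nrm X h"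
proof -
  have "bounded_operator (subspace_as_space X H) K1 R1" using R1 by (simp add: isomorphism_def)
  from bounded_operator_bound[OF this] show ?thesis
    using nrm_nonneg H_carr by (simp add: subspace_as_space_def \<beta>_def)
qed

lemma beta_ge: "\<exists>C\<ge>0. \<forall>h\<in>H. nrm X h \<le> C * \<beta> h"
proof -
  have b: "bounded_operator K1 (subspace_as_space X H) (inv_into H R1)"
    using R1 by (simp add: isomorphism_def subspace_as_space_def)
  obtain C where C: "C \<ge> 0" "\<And>y. y \<in> carr K1 \<Longrightarrow> nrm (subspace_as_space X H) (inv_into H R1 y) \<le> C * nrm K1 y"
    using bounded_operator_bound[OF b] K1.nrm_nonneg by metis
  have "nrm X h \<le> C * \<beta> h" if "h \<in> H" for h
  proof -
    have "inv_into H R1 (R1 h) = h"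
      using isomorphism_inverse[OF R1, of h] that by (simp add: subspace_as_space_def)
    then show ?thesis using C(2)[OF R1_op(1)[OF that]] by (simp add: \<beta>_def subspace_as_space_def)
  qed
  then show ?thesis using C(1) by blast
qed

text \<open>The abstract form of the argument for \<open>Z2\<close>: \<open>x\<close> splits into
  \<open>hh x\<close> in \<open>H\<close> and the representative \<open>l x\<close>, and
  \<open>\<alpha>\<close>, \<open>\<eta>\<close> are the squared Hilbert norms of the coset of
  \<open>x\<close> and of \<open>hh x\<close>.\<close>

lemma sign_type_operator:
  assumes U: "bounded_operator Z3 X U"
  shows "sign_type {F. calf F} (Z3_operator.p X U)"
proof -
  interpret Z3_operator X U
    by unfold_locales (use U nrm_triangle nrm_scl nrm_nonneg in auto)
  obtain Cq where Cq: "Cq \<ge> 0" "\<And>x. x \<in> carr X \<Longrightarrow> q x \<le> Cq * nrm X x" using q_le by blast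
  obtain Cl l where Cl: "Cl \<ge> 0" "\<And>x. x \<in> carr X \<Longrightarrow> l x \<in> carr X"
    "\<And>x. x \<in> carr X \<Longrightarrow> add X x (scl X (-1) (l x)) \<in> H" "\<And>x. x \<in> carr X \<Longrightarrow> nrm X (l x) \<le> Cl * q x"
    using q_lift by metis
  obtain Cb where Cb: "Cb \<ge> 0" "\<And>h. h \<in> H \<Longrightarrow> \<beta> h \<le> Cb * nrm X h" using beta_le by blast
  obtain Cb' where Cb': "Cb' \<ge> 0" "\<And>h. h \<in> H \<Longrightarrow> nrm X h \<le> Cb' * \<beta> h" using beta_ge by blast
  define hh where "hh = (\<lambda>x. add X x (scl X (-1) (l x)))"
  have hh: "hh x \<in> H" if "x \<in> carr X" for x using Cl(3)[OF that] by (simp add: hh_def)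
  have split: "x = add X (hh x) (l x)" if "x \<in> carr X" for x
    using that Cl(2)[OF that] by (simp add: hh_def add_assoc scl_closed neg_add add_zer)
  define W where "W = (Cb * Cl)\<^sup>2"
  text \<open>The defect of additivity of \<open>hh\<close> is controlled by \<open>q\<close>.\<close>
  have defect: "(\<beta> (hh z))\<^sup>2 \<le> (1 + 1/s) * (\<beta> (add X (hh x) (scl X \<delta> (hh y))))\<^sup>2 + (1 + s) * (9 * W * ((q x)\<^sup>2 + (q y)\<^sup>2))"
    if xy: "x \<in> carr X" "y \<in> carr X" and z: "z = add X x (scl X \<delta> y)" and \<delta>: "cmod \<delta> = 1"
      and qz: "(q z)\<^sup>2 \<le> 2 * ((q x)\<^sup>2 + (q y)\<^sup>2)" and s: "s > 0" for x y z \<delta> s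
  proof -
    have zc: "z \<in> carr X" using xy z by (simp add: add_closed scl_closed)
    note c = xy zc Cl(2)[OF xy(1)] Cl(2)[OF xy(2)] Cl(2)[OF zc]
    \<comment> \<open>The defect, written in terms of representatives only, hence of norm controlled
      by \<open>q\<close>. The identity \<open>add X b \<omega> = hh z\<close> then places it in
      \<open>H\<close>, where \<open>\<beta>\<close> can be applied.\<close>
    define \<omega> where "\<omega> = add X (add X (l x) (scl X \<delta> (l y))) (scl X (-1) (l z))"
    define b where "b = add X (hh x) (scl X \<delta> (hh y))"
    have bH: "b \<in> H" unfolding b_def by (intro H_add H_scl hh xy)
    have \<omega>c: "\<omega> \<in> carr X" unfolding \<omega>_def by (intro add_closed scl_closed c)
    have "scl X \<delta> (hh y) = add X (scl X \<delta> y) (scl X \<delta> (scl X (-1) (l y)))"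
      using c by (simp add: hh_def scl_add_right scl_closed)
    moreover have "add X (scl X (-1) (l x)) (l x) = zer X" using c by (simp add: neg_add)
    moreover have "add X (scl X \<delta> (scl X (-1) (l y))) (scl X \<delta> (l y)) = zer X"
    proof -
      have "add X (scl X \<delta> (scl X (-1) (l y))) (scl X \<delta> (l y)) = scl X \<delta> (add X (scl X (-1) (l y)) (l y))"
        using c by (simp add: scl_add_right scl_closed)
      also have "\<dots> = zer X" using c by (simp add: neg_add scl_zer)
      finally show ?thesis .
    qed
    moreover have hhx: "hh x = add X x (scl X (-1) (l x))" and hhz: "hh z = add X z (scl X (-1) (l z))"
      by (simp_all add: hh_def)
    ultimately have sum: "add X b \<omega> = hh z"
      unfolding b_def \<omega>_def hhx hhz
      using c by (simp add: add_cancel_pairs scl_closed z)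
    have "\<omega> = add X (hh z) (scl X (-1) b)" by (rule add_solve[OF H_carr[OF bH] \<omega>c sum])
    then have \<omega>H: "\<omega> \<in> H" using hh[OF zc] bH H_add H_scl by simp
    have "nrm X \<omega> \<le> nrm X (l x) + nrm X (scl X \<delta> (l y)) + nrm X (scl X (-1) (l z))"
      unfolding \<omega>_def using c
      by (intro order_trans[OF nrm_triangle] add_mono nrm_triangle add_closed scl_closed order_refl)
    also have "\<dots> = nrm X (l x) + nrm X (l y) + nrm X (l z)" using c \<delta> by (simp add: nrm_scl)
    also have "\<dots> \<le> Cl * q x + Cl * q y + Cl * q z" using Cl(4) c by (intro add_mono) auto
    finally have n\<omega>: "nrm X \<omega> \<le> Cl * (q x + q y + q z)" by (simp add: distrib_left)
    have "\<beta> \<omega> \<le> Cb * (Cl * (q x + q y + q z))"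
      using Cb(2)[OF \<omega>H] mult_left_mono[OF n\<omega> Cb(1)] by linarith
    then have "(\<beta> \<omega>)\<^sup>2 \<le> (Cb * Cl * (q x + q y + q z))\<^sup>2"
      using beta_nonneg[OF \<omega>H] by (intro power_mono) (simp_all add: mult.assoc)
    also have "\<dots> = W * (q x + q y + q z)\<^sup>2" unfolding W_def by (simp only: power_mult_distrib)
    also have "\<dots> \<le> W * (9 * ((q x)\<^sup>2 + (q y)\<^sup>2))"
    proof (intro mult_left_mono)
      have "(q x + q y + q z)\<^sup>2 \<le> 3 * ((q x)\<^sup>2 + (q y)\<^sup>2 + (q z)\<^sup>2)"
        by (rule sq_sum3_le)
      then show "(q x + q y + q z)\<^sup>2 \<le> 9 * ((q x)\<^sup>2 + (q y)\<^sup>2)" using qz by simp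
    qed (simp add: W_def)
    finally have \<beta>\<omega>: "(\<beta> \<omega>)\<^sup>2 \<le> 9 * W * ((q x)\<^sup>2 + (q y)\<^sup>2)" by (simp only: ac_simps)
    have "\<beta> (hh z) \<le> \<beta> b + \<beta> \<omega>" unfolding sum[symmetric] by (rule beta_add[OF bH \<omega>H])
    then have "(\<beta> (hh z))\<^sup>2 \<le> (\<beta> b + \<beta> \<omega>)\<^sup>2" using beta_nonneg[OF hh[OF zc]] by (intro power_mono)
    also have "\<dots> \<le> (1 + 1/s) * (\<beta> b)\<^sup>2 + (1 + s) * (\<beta> \<omega>)\<^sup>2"
      by (rule young_sq[OF s])
    also have "\<dots> \<le> (1 + 1/s) * (\<beta> b)\<^sup>2 + (1 + s) * (9 * W * ((q x)\<^sup>2 + (q y)\<^sup>2))"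
      using s by (intro add_left_mono mult_left_mono \<beta>\<omega>) auto
    finally show ?thesis by (simp only: b_def)
  qed
  define \<tau> where "\<tau> = (\<lambda>F. U (J3 F))"
  have \<tau>: "\<tau> F \<in> carr X" if "calf F" for F using that by (simp add: \<tau>_def U_carr)
  have \<tau>p: "\<tau> (F + G) = add X (\<tau> F) (\<tau> G)" and \<tau>m: "\<tau> (F - G) = add X (\<tau> F) (scl X (-1) (\<tau> G))"
    if "calf F" "calf G" for F G
    using U_add[OF that] U_diff[OF that] by (simp_all only: \<tau>_def)
  define D where "D = max (2 * (Cb'\<^sup>2 + Cl\<^sup>2)) ((Cb * (1 + Cl * Cq))\<^sup>2 + Cq\<^sup>2)"
  show ?thesis
  proof (rule sign_typeI[where \<eta> = "\<lambda>F. (\<beta> (hh (\<tau> F)))\<^sup>2" and \<alpha> = "\<lambda>F. (q (\<tau> F))\<^sup>2" and C = "9 * W" and D = D])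
    fix F G :: "complex \<Rightarrow> cseq" and s :: real
    assume "F \<in> {F. calf F}" "G \<in> {F. calf F}"
    then have F: "calf F" "calf G" by auto
    note t = \<tau>[OF F(1)] \<tau>[OF F(2)]
    show "F + G \<in> {F. calf F}" "F - G \<in> {F. calf F}" using F calf_add calf_diff by auto
    have par: "(q (\<tau> (F + G)))\<^sup>2 + (q (\<tau> (F - G)))\<^sup>2 = 2 * ((q (\<tau> F))\<^sup>2 + (q (\<tau> G))\<^sup>2)"
      unfolding \<tau>p[OF F] \<tau>m[OF F] by (rule q_parallelogram[OF t])
    then show "(q (\<tau> (F + G)))\<^sup>2 + (q (\<tau> (F - G)))\<^sup>2 \<le> 2 * ((q (\<tau> F))\<^sup>2 + (q (\<tau> G))\<^sup>2)" by simp
    assume s: "0 < s"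
    have qz: "(q (\<tau> (F + G)))\<^sup>2 \<le> 2 * ((q (\<tau> F))\<^sup>2 + (q (\<tau> G))\<^sup>2)" "(q (\<tau> (F - G)))\<^sup>2 \<le> 2 * ((q (\<tau> F))\<^sup>2 + (q (\<tau> G))\<^sup>2)"
      using par zero_le_power2[of "q (\<tau> (F + G))"] zero_le_power2[of "q (\<tau> (F - G))"] by linarith+
    let ?x = "hh (\<tau> F)" and ?y = "hh (\<tau> G)"
    have z1: "\<tau> (F + G) = add X (\<tau> F) (scl X 1 (\<tau> G))" using \<tau>p[OF F] t by (simp add: scl_one)
    have y1: "scl X 1 ?y = ?y" by (rule scl_one[OF H_carr[OF hh[OF t(2)]]])
    have ab: "(c * A + T) + (c * B + T) = c * (A + B) + 2 * T" for c A B T :: real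
      by (simp add: algebra_simps)
    have "(\<beta> (hh (\<tau> (F + G))))\<^sup>2 + (\<beta> (hh (\<tau> (F - G))))\<^sup>2
      \<le> (1 + 1/s) * ((\<beta> (add X ?x ?y))\<^sup>2 + (\<beta> (add X ?x (scl X (-1) ?y)))\<^sup>2)
         + 2 * ((1 + s) * (9 * W * ((q (\<tau> F))\<^sup>2 + (q (\<tau> G))\<^sup>2)))"
      using add_mono[OF defect[OF t z1 _ qz(1) s] defect[OF t \<tau>m[OF F] _ qz(2) s]]
      unfolding y1 ab by simp
    also have "\<dots> = 2 * (1 + 1/s) * ((\<beta> ?x)\<^sup>2 + (\<beta> ?y)\<^sup>2) + 2 * ((1 + s) * (9 * W)) * ((q (\<tau> F))\<^sup>2 + (q (\<tau> G))\<^sup>2)"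
      unfolding beta_parallelogram[OF hh[OF t(1)] hh[OF t(2)]] by (simp add: algebra_simps)
    finally show "(\<beta> (hh (\<tau> (F + G))))\<^sup>2 + (\<beta> (hh (\<tau> (F - G))))\<^sup>2 \<le>
       2 * (1 + 1/s) * ((\<beta> ?x)\<^sup>2 + (\<beta> ?y)\<^sup>2) + 2 * ((1 + s) * (9 * W)) * ((q (\<tau> F))\<^sup>2 + (q (\<tau> G))\<^sup>2)" .
  next
    fix F :: "complex \<Rightarrow> cseq" assume "F \<in> {F. calf F}"
    then have F: "calf F" by simp
    let ?x = "\<tau> F"
    note x = \<tau>[OF F]
    have pF: "p F = nrm X ?x" by (simp add: p_def \<tau>_def)
    show "0 \<le> p F" unfolding pF by (rule nrm_nonneg[OF x])
    have b0: "0 \<le> \<beta> (hh ?x)" by (rule beta_nonneg[OF hh[OF x]])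
    have "nrm X ?x \<le> nrm X (hh ?x) + nrm X (l ?x)"
      using nrm_triangle[OF H_carr[OF hh[OF x]] Cl(2)[OF x]] split[OF x] by simp
    also have "\<dots> \<le> Cb' * \<beta> (hh ?x) + Cl * q ?x" using Cb'(2)[OF hh[OF x]] Cl(4)[OF x] by linarith
    finally have "(p F)\<^sup>2 \<le> (Cb' * \<beta> (hh ?x) + Cl * q ?x)\<^sup>2"
      unfolding pF using nrm_nonneg[OF x] by (intro power_mono)
    also have "\<dots> \<le> 2 * ((Cb' * \<beta> (hh ?x))\<^sup>2 + (Cl * q ?x)\<^sup>2)"
      using zero_le_power2[of "Cb' * \<beta> (hh ?x) - Cl * q ?x"] by (simp add: power2_eq_square algebra_simps)
    also have "\<dots> \<le> 2 * (Cb'\<^sup>2 + Cl\<^sup>2) * ((\<beta> (hh ?x))\<^sup>2 + (q ?x)\<^sup>2)"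
      by (simp add: power_mult_distrib algebra_simps)
    also have "\<dots> \<le> D * ((\<beta> (hh ?x))\<^sup>2 + (q ?x)\<^sup>2)"
      by (intro mult_right_mono) (simp_all add: D_def)
    finally show "(p F)\<^sup>2 \<le> D * ((\<beta> (hh ?x))\<^sup>2 + (q ?x)\<^sup>2)" .
    have "nrm X (hh ?x) \<le> nrm X ?x + nrm X (l ?x)"
      unfolding hh_def using nrm_triangle[OF x scl_closed[OF Cl(2)[OF x], of "-1"]] nrm_neg[OF Cl(2)[OF x]] by simp
    also have "\<dots> \<le> (1 + Cl * Cq) * nrm X ?x"
      using Cl(4)[OF x] mult_left_mono[OF Cq(2)[OF x] Cl(1)] by (simp add: algebra_simps)
    finally have "\<beta> (hh ?x) \<le> Cb * ((1 + Cl * Cq) * nrm X ?x)"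
      using Cb(2)[OF hh[OF x]] mult_left_mono[of "nrm X (hh ?x)" "(1 + Cl * Cq) * nrm X ?x" Cb] Cb(1) by linarith
    then have "(\<beta> (hh ?x))\<^sup>2 \<le> (Cb * (1 + Cl * Cq) * nrm X ?x)\<^sup>2"
      using b0 by (intro power_mono) (simp_all add: mult.assoc)
    moreover have "(q ?x)\<^sup>2 \<le> (Cq * nrm X ?x)\<^sup>2" using Cq(2)[OF x] q_nonneg[OF x] by (intro power_mono)
    ultimately have "(\<beta> (hh ?x))\<^sup>2 + (q ?x)\<^sup>2 \<le> ((Cb * (1 + Cl * Cq))\<^sup>2 + Cq\<^sup>2) * (p F)\<^sup>2"
      unfolding pF by (simp add: power_mult_distrib distrib_right)
    also have "\<dots> \<le> D * (p F)\<^sup>2" by (intro mult_right_mono) (simp_all add: D_def)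
    finally show "(\<beta> (hh ?x))\<^sup>2 + (q ?x)\<^sup>2 \<le> D * (p F)\<^sup>2" .
  next
    have "0 \<le> (Cb * (1 + Cl * Cq))\<^sup>2 + Cq\<^sup>2" by simp
    then show "0 \<le> D" unfolding D_def by (rule max.coboundedI2)
  qed (simp_all add: W_def)
qed

end

section \<open>Operators into \<open>\<ell>\<^sub>2\<close>\<close>

lemma l2_simps [simp]:
  "carr l2 = {x. summable (\<lambda>n. (cmod (x n))\<^sup>2)}" "add l2 x y = (\<lambda>n. x n + y n)"
  "scl l2 c x = (\<lambda>n. c * x n)"
  by (simp_all add: l2_def)

lemma nrm_l2: "nrm l2 x = sqrt (\<Sum>n. (cmod (x n))\<^sup>2)"
  by (simp add: l2_def)

lemma nrm_l2_nonneg: "x \<in> carr l2 \<Longrightarrow> 0 \<le> nrm l2 x"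
  by (simp add: nrm_l2 suminf_nonneg)

lemma nrm_l2_sq: "x \<in> carr l2 \<Longrightarrow> (nrm l2 x)\<^sup>2 = (\<Sum>n. (cmod (x n))\<^sup>2)"
  by (simp add: nrm_l2 suminf_nonneg)

lemma l2_summable_add:
  assumes "summable (\<lambda>n. (cmod (x n))\<^sup>2)" "summable (\<lambda>n. (cmod (y n))\<^sup>2)"
  shows "summable (\<lambda>n. (cmod (x n + y n))\<^sup>2)"
proof (rule summable_comparison_test'[of _ 0])
  show "summable (\<lambda>n. 2 * ((cmod (x n))\<^sup>2 + (cmod (y n))\<^sup>2))"
    by (intro summable_mult summable_add assms)
  show "norm ((cmod (x n + y n))\<^sup>2) \<le> 2 * ((cmod (x n))\<^sup>2 + (cmod (y n))\<^sup>2)" for n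
    using sq_le_sum[of "cmod (x n + y n)" "cmod (x n)" "cmod (y n)"] norm_triangle_ineq[of "x n" "y n"] by simp
qed

lemma nrm_l2_triangle:
  assumes "x \<in> carr l2" "y \<in> carr l2" shows "nrm l2 (add l2 x y) \<le> nrm l2 x + nrm l2 y"
proof -
  have le: "L2_set (\<lambda>n. cmod (z n)) {..<N} \<le> nrm l2 z" if "z \<in> carr l2" for z N
    unfolding L2_set_def nrm_l2 using that by (intro real_sqrt_le_mono sum_le_suminf) auto
  have "(\<Sum>n<N. (cmod (x n + y n))\<^sup>2) \<le> (nrm l2 x + nrm l2 y)\<^sup>2" for N
  proof -
    have "L2_set (\<lambda>n. cmod (x n + y n)) {..<N} \<le> L2_set (\<lambda>n. cmod (x n) + cmod (y n)) {..<N}"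
      by (intro L2_set_mono norm_triangle_ineq) auto
    also have "\<dots> \<le> L2_set (\<lambda>n. cmod (x n)) {..<N} + L2_set (\<lambda>n. cmod (y n)) {..<N}" by (rule L2_set_triangle_ineq)
    also have "\<dots> \<le> nrm l2 x + nrm l2 y" by (intro add_mono le assms)
    finally have "(L2_set (\<lambda>n. cmod (x n + y n)) {..<N})\<^sup>2 \<le> (nrm l2 x + nrm l2 y)\<^sup>2"
      by (intro power_mono) auto
    then show ?thesis by (simp add: L2_set_def sum_nonneg)
  qed
  then have "(\<Sum>n. (cmod (x n + y n))\<^sup>2) \<le> (nrm l2 x + nrm l2 y)\<^sup>2"
    using assms by (intro suminf_le_const l2_summable_add) auto
  moreover have "0 \<le> nrm l2 x + nrm l2 y" by (intro add_nonneg_nonneg nrm_l2_nonneg assms)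
  moreover have "nrm l2 (add l2 x y) = sqrt (\<Sum>n. (cmod (x n + y n))\<^sup>2)" by (simp add: nrm_l2)
  ultimately show ?thesis by (simp only: real_le_lsqrt)
qed

lemma nrm_l2_scl: "x \<in> carr l2 \<Longrightarrow> nrm l2 (scl l2 c x) = cmod c * nrm l2 x"
  by (simp add: nrm_l2 norm_mult power_mult_distrib suminf_mult real_sqrt_mult)

lemma nrm_l2_parallelogram:
  assumes "x \<in> carr l2" "y \<in> carr l2"
  shows "(nrm l2 (add l2 x y))\<^sup>2 + (nrm l2 (add l2 x (scl l2 (-1) y)))\<^sup>2 = 2 * ((nrm l2 x)\<^sup>2 + (nrm l2 y)\<^sup>2)"
proof -
  have x: "summable (\<lambda>n. (cmod (x n))\<^sup>2)" and y: "summable (\<lambda>n. (cmod (y n))\<^sup>2)" using assms by auto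
  have my: "summable (\<lambda>n. (cmod (- y n))\<^sup>2)" using y by simp
  have s: "summable (\<lambda>n. (cmod (x n + y n))\<^sup>2)" "summable (\<lambda>n. (cmod (x n - y n))\<^sup>2)"
    using l2_summable_add[OF x y] l2_summable_add[OF x my] by simp_all
  have "(nrm l2 (add l2 x y))\<^sup>2 + (nrm l2 (add l2 x (scl l2 (-1) y)))\<^sup>2
      = (\<Sum>n. (cmod (x n + y n))\<^sup>2) + (\<Sum>n. (cmod (x n - y n))\<^sup>2)"
    using nrm_l2_sq[of "\<lambda>n. x n + y n"] nrm_l2_sq[of "\<lambda>n. x n - y n"] s by simp
  also have "\<dots> = (\<Sum>n. 2 * ((cmod (x n))\<^sup>2 + (cmod (y n))\<^sup>2))"
    unfolding suminf_add[OF s] cmod_parallelogram ..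
  also have "\<dots> = 2 * ((nrm l2 x)\<^sup>2 + (nrm l2 y)\<^sup>2)"
    unfolding nrm_l2_sq[OF assms(1)] nrm_l2_sq[OF assms(2)] suminf_add[OF x y] by (intro suminf_mult summable_add x y)
  finally show ?thesis .
qed

lemma Z3_operator_l2: "bounded_operator Z3 l2 U \<Longrightarrow> Z3_operator l2 U"
  by unfold_locales (auto simp only: nrm_l2_triangle nrm_l2_scl nrm_l2_nonneg)

text \<open>The parallelogram law holds for the norm itself, so \<open>\<alpha>\<close> is 0 and
  there is no defect.\<close>

lemma sign_type_l2:
  assumes U: "bounded_operator Z3 l2 U"
  shows "sign_type {F. calf F} (Z3_operator.p l2 U)"
proof -
  interpret Z3_operator l2 U by (rule Z3_operator_l2[OF U])
  have eq: "(p (F + G))\<^sup>2 + (p (F - G))\<^sup>2 = 2 * ((p F)\<^sup>2 + (p G)\<^sup>2)" if "calf F" "calf G" for F G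
    using nrm_l2_parallelogram[OF U_carr[OF that(1)] U_carr[OF that(2)]]
    unfolding p_def U_add[OF that] U_diff[OF that] .
  show ?thesis
  proof (rule sign_typeI[where \<eta> = "\<lambda>F. (p F)\<^sup>2" and \<alpha> = "\<lambda>F. 0" and C = 0 and D = 1])
    fix F G :: "complex \<Rightarrow> cseq" and s :: real
    assume F: "F \<in> {F. calf F}" "G \<in> {F. calf F}"
    then show "F + G \<in> {F. calf F}" "F - G \<in> {F. calf F}" using calf_add calf_diff by auto
    assume s: "0 < s"
    have "(p (F + G))\<^sup>2 + (p (F - G))\<^sup>2 = 1 * (2 * ((p F)\<^sup>2 + (p G)\<^sup>2))" using eq F by auto
    also have "\<dots> \<le> (1 + 1/s) * (2 * ((p F)\<^sup>2 + (p G)\<^sup>2))"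
      using s by (intro mult_right_mono) auto
    also have "\<dots> = 2 * (1 + 1/s) * ((p F)\<^sup>2 + (p G)\<^sup>2)" by (simp only: ac_simps)
    finally show "(p (F + G))\<^sup>2 + (p (F - G))\<^sup>2 \<le> 2 * (1 + 1/s) * ((p F)\<^sup>2 + (p G)\<^sup>2) + 2 * ((1 + s) * 0) * (0 + 0)"
      by simp
  next
    fix F assume "F \<in> {F. calf F}"
    then show "0 \<le> p F" unfolding p_def by (intro Y_nonneg U_carr) simp
  qed auto
qed

section \<open>Complemented copies\<close>

lemma nrm_Z3_nonneg: "v \<in> carr Z3 \<Longrightarrow> 0 \<le> nrm Z3 v"
  unfolding carr_Z3 using nrm_Z3 qn_nonneg by auto

text \<open>A projection onto \<open>S\<close> followed by the isomorphism with \<open>Y\<close> is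
  an operator bounded below on \<open>S\<close>. The injective linear map \<open>J\<close> from
  finitely supported sequences witnesses that \<open>S\<close> is infinite dimensional.\<close>

lemma not_contains_complemented_copy:
  fixes Y :: "'y cspace" and J :: "cseq \<Rightarrow> 'y"
  assumes op: "\<And>U. bounded_operator Z3 Y U \<Longrightarrow> Z3_operator Y U"
    and st: "\<And>U. bounded_operator Z3 Y U \<Longrightarrow> sign_type {F. calf F} (Z3_operator.p Y U)"
    and J: "\<And>x. finite {n. x n \<noteq> 0} \<Longrightarrow> J x \<in> carr Y"
      "\<And>x y. \<lbrakk>finite {n. x n \<noteq> 0}; finite {n. y n \<noteq> 0}\<rbrakk> \<Longrightarrow> J (\<lambda>n. x n + y n) = add Y (J x) (J y)"
      "\<And>c x. finite {n. x n \<noteq> 0} \<Longrightarrow> J (\<lambda>n. c * x n) = scl Y c (J x)"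
      "\<And>x. J x = J (\<lambda>n. 0) \<Longrightarrow> x = (\<lambda>n. 0)"
  shows "\<not> contains_complemented_copy Z3 Y"
proof
  assume "contains_complemented_copy Z3 Y"
  then obtain S where "complemented_subspace Z3 S" and iso: "isomorphic (subspace_as_space Z3 S) Y"
    unfolding contains_complemented_copy_def by blast
  then obtain P where S: "linear_subspace Z3 S"
    and P: "bounded_operator Z3 Z3 P" "P ` carr Z3 = S" "\<And>x. x \<in> S \<Longrightarrow> P x = x"
    unfolding complemented_subspace_def closed_subspace_def by metis
  obtain R where R: "isomorphism (subspace_as_space Z3 S) Y R"
    using iso unfolding isomorphic_def by auto
  have SZ: "v \<in> carr Z3" if "v \<in> S" for v using S that by (auto simp: linear_subspace_def)
  have sub [simp]: "carr (subspace_as_space Z3 S) = S" "add (subspace_as_space Z3 S) = add Z3"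
     "scl (subspace_as_space Z3 S) = scl Z3" "nrm (subspace_as_space Z3 S) = nrm Z3"
    by (simp_all add: subspace_as_space_def)
  define Ri where "Ri = inv_into S R"
  have Rop: "bounded_operator (subspace_as_space Z3 S) Y R" and Riop: "bounded_operator Y (subspace_as_space Z3 S) Ri"
    and bij: "bij_betw R S (carr Y)"
    using R by (simp_all add: isomorphism_def Ri_def)
  have RiR: "Ri (R v) = v" if "v \<in> S" for v using bij that by (simp add: Ri_def bij_betw_def)
  have RRi: "R (Ri y) = y" if "y \<in> carr Y" for y using bij that by (simp add: Ri_def bij_betw_def f_inv_into_f)
  have Ri: "y \<in> carr Y \<Longrightarrow> Ri y \<in> S" "\<lbrakk>y \<in> carr Y; z \<in> carr Y\<rbrakk> \<Longrightarrow> Ri (add Y y z) = add Z3 (Ri y) (Ri z)"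
    "y \<in> carr Y \<Longrightarrow> Ri (scl Y c y) = scl Z3 c (Ri y)" for y z c
    using Riop by (simp_all add: bounded_operator_def)
  have PS: "P v \<in> S" if "v \<in> carr Z3" for v using P(2) that by blast
  define U where "U = (\<lambda>v. R (P v))"
  obtain KR where KR: "KR \<ge> 0" "\<And>v. v \<in> S \<Longrightarrow> nrm Y (R v) \<le> KR * nrm Z3 v"
    using bounded_operator_bound[OF Rop] nrm_Z3_nonneg SZ by auto
  obtain KP where KP: "\<And>v. v \<in> carr Z3 \<Longrightarrow> nrm Z3 (P v) \<le> KP * nrm Z3 v"
    using P(1) unfolding bounded_operator_def by blast
  have U: "bounded_operator Z3 Y U"
    unfolding bounded_operator_def
  proof (intro conjI ballI allI exI[of _ "KR * KP"])
    fix v assume v: "v \<in> carr Z3"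
    show "U v \<in> carr Y" using Rop PS[OF v] by (simp add: bounded_operator_def U_def)
    show "U (scl Z3 c v) = scl Y c (U v)" for c
      using Rop P(1) PS[OF v] v by (simp add: bounded_operator_def U_def)
    show "U (add Z3 v w) = add Y (U v) (U w)" if w: "w \<in> carr Z3" for w
      using Rop P(1) PS[OF v] PS[OF w] v w by (simp add: bounded_operator_def U_def)
    have "nrm Y (U v) \<le> KR * nrm Z3 (P v)" unfolding U_def by (rule KR(2)[OF PS[OF v]])
    also have "\<dots> \<le> KR * (KP * nrm Z3 v)" by (intro mult_left_mono KP v KR(1))
    finally show "nrm Y (U v) \<le> KR * KP * nrm Z3 v" by (simp add: mult.assoc)
  qed
  interpret Z3_operator Y U by (rule op[OF U])
  obtain B where B: "\<And>y. y \<in> carr Y \<Longrightarrow> nrm Z3 (Ri y) \<le> B * nrm Y y"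
    using Riop unfolding bounded_operator_def sub by blast
  show False
  proof (rule no_lower_bound[OF st[OF U] S, of B])
    fix m
    have a: "coord m i (Ri (J (\<lambda>n. x n + y n))) = coord m i (Ri (J x)) + coord m i (Ri (J y))"
      if "finite {n. x n \<noteq> 0}" "finite {n. y n \<noteq> 0}" for i x y
      using J(1,2) that Ri(2) by (simp add: coord_add)
    have s: "coord m i (Ri (J (\<lambda>n. c * x n))) = c * coord m i (Ri (J x))" if "finite {n. x n \<noteq> 0}" for i x c
      using J(1,3) that Ri(3) by (simp add: coord_scl)
    \<comment> \<open>The coordinates of \<open>Z3\<close> are pulled back along \<open>Ri\<close>
      and \<open>J\<close> to functionals on finitely supported sequences.\<close>
    obtain x where x: "finite {n. x n \<noteq> 0}" "\<exists>n. x n \<noteq> 0" "\<And>i. i < 3 * m \<Longrightarrow> coord m i (Ri (J x)) = 0"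
      using finitely_many_functionals[where g = "\<lambda>i x. coord m i (Ri (J x))" and k = "3 * m", OF a s] by blast
    have "Ri (J x) \<noteq> zer Z3"
    proof
      assume "Ri (J x) = zer Z3"
      moreover have "Ri (J (\<lambda>n. 0 * x n)) = zer Z3"
      proof -
        have "Ri (J (\<lambda>n. 0 * x n)) = scl Z3 0 (Ri (J x))"
          unfolding J(3)[OF x(1)] by (rule Ri(3)[OF J(1)[OF x(1)]])
        also have "\<dots> = zer Z3" by (cases "Ri (J x)") (simp add: Z3_ops)
        finally show ?thesis .
      qed
      ultimately have "R (Ri (J x)) = R (Ri (J (\<lambda>n. 0)))" by simp
      moreover have "J (\<lambda>n. 0) \<in> carr Y" by (rule J(1)) simp
      ultimately have "J x = J (\<lambda>n. 0)" using RRi J(1)[OF x(1)] by simp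
      then show False using J(4) x(2) by blast
    qed
    then show "\<exists>v\<in>S. (\<forall>i<3*m. coord m i v = 0) \<and> v \<noteq> zer Z3" using Ri(1)[OF J(1)[OF x(1)]] x(3) by blast
  next
    fix v assume v: "v \<in> S"
    have "R v \<in> carr Y" using Rop v by (simp add: bounded_operator_def)
    from B[OF this] show "nrm Z3 v \<le> B * nrm Y (U v)" using RiR[OF v] P(3)[OF v] by (simp add: U_def)
  qed
qed

text \<open>The copy of \<open>\<ell>\<^sub>2\<close> inside \<open>Z2\<close> formed by derivatives
  of functions vanishing at \<open>1/2\<close>; \<open>3/2\<close> is the inverse of the derivative
  of \<open>phi\<close> there.\<close>

lemma finite_support_Z2:
  assumes "finite {n. x n \<noteq> 0}" shows "(x, \<lambda>n. 0) \<in> carr Z2"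
proof -
  let ?G = "mul (\<lambda>z. 3/2) (mul phi (lift x))"
  have cp: "calf (mul phi (lift x))" using calf_lift[OF assms] by (intro calf_mul) auto
  have "jet 0 ?G = (\<lambda>n. 0)" by (simp add: fun_eq_iff)
  moreover have "jet 1 ?G n = x n" for n
    using jet_cmult[OF cp, of "Suc 0" "3/2" n] jet_mul_012(2)[OF multiplier_phi calf_lift[OF assms], of n]
    by (simp add: lift_half)
  ultimately have "J2 ?G = (x, \<lambda>n. 0)" by (simp add: J2_def fun_eq_iff del: jet_0)
  then show ?thesis using J2_carr[OF calf_cmult[OF cp]] by metis
qed

lemma twisted_strictly_singular:
  fixes X :: "'x cspace"
  assumes X: "twisted_hilbert_space X" and T: "bounded_operator Z3 X T"
  shows "strictly_singular Z3 X T"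
  unfolding strictly_singular_def
proof (intro allI impI notI)
  fix S assume S: "closed_subspace Z3 S \<and> \<not> finite_dimensional Z3 S"
    and iso: "isomorphism (subspace_as_space Z3 S) (subspace_as_space X (T ` S)) T"
  obtain H where XH: "complex_banach_space X" "linear_subspace X H"
     "isomorphic_to_hilbert (subspace_as_space X H)" "isomorphic_to_hilbert (quotient_space X H)"
    using X unfolding twisted_hilbert_space_def closed_subspace_def by auto
  obtain K1 :: "'x cspace" and R1 where K1: "hilbert_space K1" "isomorphism (subspace_as_space X H) K1 R1"
    using XH(3) unfolding isomorphic_to_hilbert_def isomorphic_def by auto
  obtain K2 :: "'x set cspace" and R2 where K2: "hilbert_space K2" "isomorphism (quotient_space X H) K2 R2"
    using XH(4) unfolding isomorphic_to_hilbert_def isomorphic_def by auto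
  note H = XH(1,2) K1 K2
  interpret complex_banach_space X by (rule H)
  interpret twisted_sum X H K1 R1 K2 R2 by unfold_locales (use H in auto)
  interpret Z3_operator X T by unfold_locales (use T nrm_triangle nrm_scl nrm_nonneg in auto)
  have lin: "linear_subspace Z3 S" using S by (simp add: closed_subspace_def)
  have "bounded_operator (subspace_as_space X (T ` S)) (subspace_as_space Z3 S) (inv_into S T)"
    using iso by (simp add: isomorphism_def subspace_as_space_def)
  then have "\<exists>B. \<forall>y\<in>T ` S. nrm Z3 (inv_into S T y) \<le> B * nrm X y"
    by (simp add: bounded_operator_def subspace_as_space_def)
  then obtain B where B: "\<And>y. y \<in> T ` S \<Longrightarrow> nrm Z3 (inv_into S T y) \<le> B * nrm X y" by blast
  have inv: "inv_into S T (T v) = v" if "v \<in> S" for v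
    using isomorphism_inverse[OF iso, of v] that by (simp add: subspace_as_space_def)
  show False
  proof (rule no_lower_bound[OF sign_type_operator[OF T] lin, of B])
    show "\<exists>v\<in>S. (\<forall>i<3*m. coord m i v = 0) \<and> v \<noteq> zer Z3" for m
      using infinite_dimensional_Z3[OF lin] S by blast
    show "nrm Z3 v \<le> B * nrm X (T v)" if "v \<in> S" for v
      using B[of "T v"] inv[OF that] that by simp
  qed
qed

theorem corollary7p7:
  shows "(\<forall>(X :: 'x cspace) T. twisted_hilbert_space X \<and> bounded_operator Z3 X T \<longrightarrow>
            strictly_singular Z3 X T) \<and>
         \<not> contains_complemented_copy Z3 Z2 \<and>
         \<not> contains_complemented_copy Z3 l2"
proof (intro conjI allI impI)
  show "strictly_singular Z3 X T" if "twisted_hilbert_space X \<and> bounded_operator Z3 X T" for X :: "'x cspace" and T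
    using that twisted_strictly_singular by blast
  show "\<not> contains_complemented_copy Z3 Z2"
    by (rule not_contains_complemented_copy[OF Z3_operator_Z2 sign_type_Z2, where J = "\<lambda>x. (x, \<lambda>n. 0)"])
       (simp_all add: finite_support_Z2 Z2_ops)
  show "\<not> contains_complemented_copy Z3 l2"
  proof (rule not_contains_complemented_copy[OF Z3_operator_l2 sign_type_l2, where J = "\<lambda>x. x"])
    show "x \<in> carr l2" if "finite {n. x n \<noteq> 0}" for x :: cseq
      by (simp, rule summable_finite[OF that]) simp
  qed simp_all
qed

end
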